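(* Let $(\mu_n)$ be an SI-martingale on $\mathbb{R}^d$ which either is of $(\mathcal{F},\tau,\zeta)$-cell type with $\mu_n\le C2^{\alpha n}$, or is of $(\mathcal{F},\alpha,\zeta)$-cutout type. Let $\Gamma$ be a bounded subset of $(\mathrm{Sim}_d^c)^m\times P_m$ whose elements consist of contracting similitudes with contraction ratios bounded uniformly away from $0$ and $1$, and such that for some $s>\alpha$, $$\eta_t(B(x,r))=O(r^s)\quad\text{for all }x\in\mathbb{R}^d,\ t\in\Gamma,\ 0<r<1.$$ Assume furthermore that for some $0<\gamma_1<s$, for all $0<\varepsilon<1$, all $(F,p)\in\Gamma$ and all $\Lambda\in\mathcal{F}$, the set $\partial\Lambda(\varepsilon)\cap E_F$ can be covered by $O(\varepsilon^{-\gamma_1})$ balls of radius $\varepsilon$ (with implicit constants uniform). Then there are a deterministic $\gamma>0$ and a finite random variable $K$ such that almost surely: (i) the sequence $Y_n^t:=\int\mu_n\,d\eta_t$ converges uniformly over $t\in\Gamma$; denote the limit by $Y^t$; (ii) $|Y^t-Y^u|\le K\,d(t,u)^\gamma$ for all $t,u\in\Gamma$.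
   Context: An SI-martingale on $\mathbb{R}^d$ is a sequence $(\mu_n)_{n\ge0}$ of random functions $\mu_n:\mathbb{R}^d\to[0,\infty)$ such that: (SI1) $\mu_0$ is deterministic, bounded, with bounded support; (SI2) $\mu_n$ is $\mathcal{B}_n$-measurable for an increasing filtration and $\mathbb{E}(\mu_{n+1}(x)\mid\mathcal{B}_n)=\mu_n(x)$; (SI3) $\mu_{n+1}\le C\mu_n$ pointwise; (SI4) for some $C$, for any $(C2^{-n})$-separated family of half-open dyadic cubes of side $2^{-(n+1)}$, the restrictions of $\mu_{n+1}$ to them are conditionally independent given $\mathcal{B}_n$. For a family $\mathcal{F}$ of Borel subsets of a fixed ball: $(\mu_n)$ is of $(\mathcal{F},\alpha,\zeta)$-cutout type if $\mu_n=2^{\alpha n}\mathbf{1}_{A_n}$, $A_n=\Omega\setminus\bigcup_{j=1}^{M_n}\Lambda^{(n)}_j$ with $\Omega\in\mathcal{F}$, random $\Lambda_j^{(n)}\in\mathcal{F}$, and a.s. $M_n\le C2^{\zeta n}$ for $n\ge N_0$ (random, a.s. finite); of $(\mathcal{F},\tau,\zeta)$-cell type if $\mu_n=\sum_{j=1}^{M_n}c_j^{(n)}\mathbf{1}[F_j^{(n)}]$, random $F_j^{(n)}\in\mathcal{F}$, $0\le c_j^{(n)}\le C2^{\tau n}$, and a.s. $M_n\le C2^{\zeta n}$ for $n\ge N_0$. $\mathrm{Sim}_d^c$ is the set of contracting similarities of $\mathbb{R}^d$. $\Sigma_m=\{1,\dots,m\}^{\mathbb{N}}$; for $F=(F_1,\dots,F_m)\in(\mathrm{Sim}^c_d)^m$,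 $\Pi_F:\Sigma_m\to\mathbb{R}^d$, $\Pi_F(i_1i_2\dots)=\lim_N F_{i_1}\circ\cdots\circ F_{i_N}(0)$, and $E_F=\Pi_F(\Sigma_m)$. $P_m$ is the set of probability vectors $(p_1,\dots,p_m)$ with all $p_i>0$. On $(\mathrm{Sim}^c_d)^m\times P_m$ the metric is $d((F,p),(G,q))=\sup_{\Sigma_m}|\Pi_F-\Pi_G|+\max_i|p_i-q_i|$. For $t=(F,p)$, $\eta_t=\Pi_F(p^{\infty})$, the self-similar measure (push-forward of the Bernoulli product measure). $E(\varepsilon)$ is the open $\varepsilon$-neighbourhood of $E$. *)

theory Defs
  imports "HOL-Probability.Probability"
begin

definition dyadic_cubes :: "nat \<Rightarrow> 'a::euclidean_space set set" where
  "dyadic_cubes n = range (\<lambda>k::'a \<Rightarrow> int.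
     {x. \<forall>i\<in>Basis. real_of_int (k i) / 2 ^ n \<le> x \<bullet> i \<and> x \<bullet> i < (real_of_int (k i) + 1) / 2 ^ n})"

definition separated_family :: "real \<Rightarrow> 'a::metric_space set set \<Rightarrow> bool" where
  "separated_family \<delta> Q \<longleftrightarrow> (\<forall>A\<in>Q. \<forall>B\<in>Q. A \<noteq> B \<longrightarrow> (\<forall>x\<in>A. \<forall>y\<in>B. \<delta> \<le> dist x y))"

definition gen_sets :: "'b measure \<Rightarrow> ('b \<Rightarrow> 'a \<Rightarrow> real) \<Rightarrow> 'a set \<Rightarrow> 'b set set" where
  "gen_sets M X S = sigma_sets (space M)
     (\<Union>x\<in>S. {(\<lambda>\<omega>. X \<omega> x) -` A \<inter> space M | A. A \<in> sets borel})"

definition cond_indep_sets :: "'b measure \<Rightarrow> 'b measure \<Rightarrow> ('i \<Rightarrow> 'b set set) \<Rightarrow> 'i set \<Rightarrow> bool" where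
  "cond_indep_sets M F G I \<longleftrightarrow>
     (\<forall>J\<subseteq>I. finite J \<longrightarrow> J \<noteq> {} \<longrightarrow> (\<forall>A. (\<forall>j\<in>J. A j \<in> G j) \<longrightarrow>
        (AE \<omega> in M. real_cond_exp M F (indicator (\<Inter>j\<in>J. A j) :: 'b \<Rightarrow> real) \<omega>
            = (\<Prod>j\<in>J. real_cond_exp M F (indicator (A j) :: 'b \<Rightarrow> real) \<omega>))))"

definition SI_martingale :: "'b measure \<Rightarrow> (nat \<Rightarrow> 'b measure) \<Rightarrow> (nat \<Rightarrow> 'b \<Rightarrow> 'a::euclidean_space \<Rightarrow> real) \<Rightarrow> bool" where
  "SI_martingale M B \<mu> \<longleftrightarrow>
     prob_space M \<and>
     (\<forall>n. subalgebra M (B n)) \<and> (\<forall>n. sets (B n) \<subseteq> sets (B (Suc n))) \<and>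
     (\<forall>n. \<forall>\<omega>\<in>space M. \<forall>x. 0 \<le> \<mu> n \<omega> x) \<and>
     \<comment> \<open>SI1\<close>
     (\<exists>f. (\<forall>\<omega>\<in>space M. \<mu> 0 \<omega> = f) \<and> bounded (range f) \<and> bounded {x. f x \<noteq> 0}) \<and>
     \<comment> \<open>SI2\<close>
     (\<forall>n x. (\<lambda>\<omega>. \<mu> n \<omega> x) \<in> borel_measurable (B n)) \<and>
     (\<forall>n x. AE \<omega> in M. real_cond_exp M (B n) (\<lambda>\<omega>. \<mu> (Suc n) \<omega> x) \<omega> = \<mu> n \<omega> x) \<and>
     \<comment> \<open>SI3\<close>
     (\<exists>C. \<forall>n. \<forall>\<omega>\<in>space M. \<forall>x. \<mu> (Suc n) \<omega> x \<le> C * \<mu> n \<omega> x) \<and>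
     \<comment> \<open>SI4\<close>
     (\<exists>C. \<forall>n Q. Q \<subseteq> dyadic_cubes (Suc n) \<longrightarrow> separated_family (C / 2 ^ n) Q \<longrightarrow>
         cond_indep_sets M (B n) (\<lambda>Q. gen_sets M (\<mu> (Suc n)) Q) Q)"

definition cutout_type :: "'b measure \<Rightarrow> 'a set set \<Rightarrow> real \<Rightarrow> real \<Rightarrow> (nat \<Rightarrow> 'b \<Rightarrow> 'a::euclidean_space \<Rightarrow> real) \<Rightarrow> bool" where
  "cutout_type M \<F> \<alpha> \<zeta> \<mu> \<longleftrightarrow>
     (\<exists>\<Omega>\<in>\<F>. \<exists>C. \<exists>Mn :: nat \<Rightarrow> 'b \<Rightarrow> nat. \<exists>\<Lambda> :: nat \<Rightarrow> 'b \<Rightarrow> nat \<Rightarrow> 'a set.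
        (\<forall>n. \<forall>\<omega>\<in>space M. (\<forall>j. \<Lambda> n \<omega> j \<in> \<F>) \<and>
            \<mu> n \<omega> = (\<lambda>x. 2 powr (\<alpha> * real n) * indicator (\<Omega> - (\<Union>j\<in>{1..Mn n \<omega>}. \<Lambda> n \<omega> j)) x)) \<and>
        (AE \<omega> in M. \<exists>N0. \<forall>n\<ge>N0. real (Mn n \<omega>) \<le> C * 2 powr (\<zeta> * real n)))"

definition cell_type :: "'b measure \<Rightarrow> 'a set set \<Rightarrow> real \<Rightarrow> real \<Rightarrow> (nat \<Rightarrow> 'b \<Rightarrow> 'a::euclidean_space \<Rightarrow> real) \<Rightarrow> bool" where
  "cell_type M \<F> \<tau> \<zeta> \<mu> \<longleftrightarrow>
     (\<exists>C. \<exists>Mn :: nat \<Rightarrow> 'b \<Rightarrow> nat. \<exists>c :: nat \<Rightarrow> 'b \<Rightarrow> nat \<Rightarrow> real. \<exists>Fs :: nat \<Rightarrow> 'b \<Rightarrow> nat \<Rightarrow> 'a set.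
        (\<forall>n. \<forall>\<omega>\<in>space M. (\<forall>j. Fs n \<omega> j \<in> \<F>) \<and>
            (\<forall>j. 0 \<le> c n \<omega> j \<and> c n \<omega> j \<le> C * 2 powr (\<tau> * real n)) \<and>
            \<mu> n \<omega> = (\<lambda>x. \<Sum>j\<in>{1..Mn n \<omega>}. c n \<omega> j * indicator (Fs n \<omega> j) x)) \<and>
        (AE \<omega> in M. \<exists>N0. \<forall>n\<ge>N0. real (Mn n \<omega>) \<le> C * 2 powr (\<zeta> * real n)))"

definition contracting_similarity :: "('a::metric_space \<Rightarrow> 'a) \<Rightarrow> bool" where
  "contracting_similarity f \<longleftrightarrow> (\<exists>r. 0 < r \<and> r < 1 \<and> (\<forall>x y. dist (f x) (f y) = r * dist x y))"

definition prob_vector :: "('i::finite \<Rightarrow> real) \<Rightarrow> bool" where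
  "prob_vector p \<longleftrightarrow> (\<forall>i. 0 < p i) \<and> sum p UNIV = 1"

primrec prefix_map :: "('i \<Rightarrow> 'a \<Rightarrow> 'a) \<Rightarrow> (nat \<Rightarrow> 'i) \<Rightarrow> nat \<Rightarrow> 'a \<Rightarrow> 'a" where
  "prefix_map F w 0 = id"
| "prefix_map F w (Suc N) = prefix_map F w N \<circ> F (w N)"

definition coding_map :: "('i \<Rightarrow> 'a::euclidean_space \<Rightarrow> 'a) \<Rightarrow> (nat \<Rightarrow> 'i) \<Rightarrow> 'a" where
  "coding_map F w = lim (\<lambda>N. prefix_map F w N 0)"

definition attractor :: "('i \<Rightarrow> 'a::euclidean_space \<Rightarrow> 'a) \<Rightarrow> 'a set" where
  "attractor F = range (coding_map F)"

definition bernoulli_measure :: "('i::finite \<Rightarrow> real) \<Rightarrow> (nat \<Rightarrow> 'i) measure" where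
  "bernoulli_measure p = PiM UNIV (\<lambda>_::nat. point_measure UNIV (\<lambda>i. ennreal (p i)))"

definition ss_measure :: "('i::finite \<Rightarrow> 'a::euclidean_space \<Rightarrow> 'a) \<times> ('i \<Rightarrow> real) \<Rightarrow> 'a measure" where
  "ss_measure t = distr (bernoulli_measure (snd t)) borel (coding_map (fst t))"

definition ifs_dist :: "('i::finite \<Rightarrow> 'a::euclidean_space \<Rightarrow> 'a) \<times> ('i \<Rightarrow> real)
     \<Rightarrow> ('i \<Rightarrow> 'a \<Rightarrow> 'a) \<times> ('i \<Rightarrow> real) \<Rightarrow> real" where
  "ifs_dist t u = (SUP w. norm (coding_map (fst t) w - coding_map (fst u) w))
                   + Max (range (\<lambda>i. \<bar>snd t i - snd u i\<bar>))"

definition nbhd :: "'a::metric_space set \<Rightarrow> real \<Rightarrow> 'a set" where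
  "nbhd E \<epsilon> = (\<Union>z\<in>E. ball z \<epsilon>)"

end

theory Submission
  imports Defs "HOL-Real_Asymp.Real_Asymp"
begin

text \<open>
  Fix \<open>t\<close>. Conditionally on the past, the increment of \<open>\<integral>\<mu>\<^sub>n d\<eta>\<^sub>t\<close> is a sum of boundedly many families of
  independent terms, one per dyadic cube of side \<open>2\<^sup>-\<^sup>n\<^sup>-\<^sup>1\<close>, each bounded by a multiple of
  \<open>2\<^bsup>(\<alpha>-s)n\<^esup>\<close>. An exponential moment bound makes a relative increment larger than \<open>2\<^bsup>-\<delta>n\<^esup>\<close>
  super-exponentially unlikely in \<open>n\<close>, so Borel-Cantelli applies along nets of \<open>\<Gamma>\<close> of exponentially
  growing size. Such nets exist at every exponential scale since a similarity is affine, hence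
  determined by finitely many coordinates. A priori \<open>\<integral>\<mu>\<^sub>n d\<eta>\<^sub>t\<close> is Hoelder in \<open>t\<close> with a constant
  growing exponentially in \<open>n\<close>, because \<open>\<mu>\<^sub>n\<close> only jumps at the boundaries of exponentially many sets
  of \<open>\<F>\<close>, whose neighbourhoods have small measure; this passes from the nets to all of \<open>\<Gamma>\<close> and
  then, by interpolation, gives the Hoelder bound for the limit.

  No joint measurability of \<open>\<mu>\<^sub>n \<omega> x\<close> is available, so Fubini cannot be used. Instead the integrals
  are replaced by finite sums over cylinders of the coding map, the error being again controlled by
  the boundaries of the sets in \<open>\<F>\<close>.
\<close>

section \<open>Concentration under conditional independence\<close>

text \<open>Deviations are measured relative to \<open>max 1\<close> of the current value. The
  exponential moment is compensated by the conditional mean, which also controls the variance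
  because the terms lie between 0 and \<open>b\<close>. A threshold proportional to that mean
  therefore has the same tail whatever the past, and boundedness of the integrals comes out
  afterwards: the factors \<open>1 + A * q ^ n\<close> have a convergent product. Here
  \<open>b\<close> is of order 2^(-(s-\<alpha>)n), so with
  \<open>\<delta> = (s - \<alpha>) / 4\<close> a relative deviation 2^(-\<delta>n) has probability
  about exp(-const 2^(2\<delta>n)), which beats every net of size 2^(\<kappa>n). The exponent
  \<theta> dominates the growth of the density and of its variation; net mesh and word length at
  level n are tuned to turn 2^(\<theta>n) into 2^(-n). The condition \<gamma>1 < s gives the
  r-neighbourhood of a boundary measure at most a multiple of r^(s - \<gamma>1), a positive power
  that drives every continuity estimate.\<close>

text \<open>Tested against \<open>B \<in> F\<close>, both the hypothesis and the claim say that \<open>(g - h) 1\<^sub>B\<close> is orthogonal to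
  functions measurable with respect to \<open>G\<close>, so no approximation of \<open>f\<close> by simple functions is needed.\<close>

lemma (in prob_space) real_cond_exp_mult_indep:
  assumes F: "subalgebra M F" and G: "subalgebra M G"
    and g: "integrable M g" and h: "integrable M h" "h \<in> borel_measurable F"
    and f: "f \<in> borel_measurable G" "\<And>\<omega>. \<omega> \<in> space M \<Longrightarrow> \<bar>f \<omega>\<bar> \<le> c"
    and eq: "\<And>A. A \<in> sets G \<Longrightarrow> AE \<omega> in M. real_cond_exp M F (\<lambda>\<omega>. g \<omega> * indicator A \<omega>) \<omega>
               = h \<omega> * real_cond_exp M F (indicator A) \<omega>"
  shows "AE \<omega> in M. real_cond_exp M F (\<lambda>\<omega>. g \<omega> * f \<omega>) \<omega> = h \<omega> * real_cond_exp M F f \<omega>"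
proof -
  interpret F: finite_measure_subalgebra M F by unfold_locales (rule F)
  interpret G: finite_measure_subalgebra M G by unfold_locales (rule G)
  have FM: "A \<in> sets M" if "A \<in> sets F" for A using F that by (auto simp: subalgebra_def)
  have GM: "A \<in> sets M" if "A \<in> sets G" for A using G that by (auto simp: subalgebra_def)
  have fM[measurable]: "f \<in> borel_measurable M" by (rule measurable_from_subalg[OF G f(1)])
  have gM[measurable]: "g \<in> borel_measurable M" and hM[measurable]: "h \<in> borel_measurable M" using g h by auto
  have int_f: "integrable M (\<lambda>\<omega>. k \<omega> * f \<omega>)" if "integrable M k" for k
  proof (rule Bochner_Integration.integrable_bound[of _ "\<lambda>\<omega>. c * k \<omega>"])
    show "integrable M (\<lambda>\<omega>. c * k \<omega>)" using that by simp
    show "(\<lambda>\<omega>. k \<omega> * f \<omega>) \<in> borel_measurable M" using that by measurable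
    show "AE \<omega> in M. norm (k \<omega> * f \<omega>) \<le> norm (c * k \<omega>)"
    proof (rule AE_I2)
      fix \<omega> assume "\<omega> \<in> space M"
      then have "\<bar>f \<omega>\<bar> \<le> \<bar>c\<bar>" using f(2)[of \<omega>] by linarith
      then show "norm (k \<omega> * f \<omega>) \<le> norm (c * k \<omega>)"
        by (simp add: abs_mult mult.commute mult_right_mono)
    qed
  qed
  have bd_f: "integrable M f" using int_f[of "\<lambda>_. 1"] by simp
  have key: "(\<integral>\<omega>\<in>B. g \<omega> * f \<omega> \<partial>M) = (\<integral>\<omega>\<in>B. h \<omega> * f \<omega> \<partial>M)" if B: "B \<in> sets F" for B
  proof -
    define k where "k = (\<lambda>\<omega>. (g \<omega> - h \<omega>) * indicator B \<omega>)"
    have BM[measurable]: "B \<in> sets M" using FM B .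
    have k: "integrable M k" unfolding k_def
      using g h(1) by (intro integrable_real_mult_indicator) auto
    \<comment> \<open>Integrated over \<open>B\<close>, the hypothesis for \<open>A\<close> says
      that \<open>k\<close> has integral 0 over \<open>A\<close>; this characterises 0 as its
      conditional expectation given \<open>G\<close>.\<close>
    have "AE \<omega> in M. real_cond_exp M G k \<omega> = 0"
    proof (rule G.real_cond_exp_charact)
      fix A assume A: "A \<in> sets G"
      have AM[measurable]: "A \<in> sets M" using GM A .
      have i1: "integrable M (\<lambda>\<omega>. g \<omega> * indicator A \<omega>)"
        using g by (intro integrable_real_mult_indicator) auto
      have i2: "integrable M (\<lambda>\<omega>. h \<omega> * indicator A \<omega>)"
        using h by (intro integrable_real_mult_indicator) auto
      have "AE \<omega> in M. real_cond_exp M F (\<lambda>\<omega>. g \<omega> * indicator A \<omega>) \<omega>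
              = real_cond_exp M F (\<lambda>\<omega>. h \<omega> * indicator A \<omega>) \<omega>"
        using eq[OF A] F.real_cond_exp_mult[OF h(2) _ i2] by auto
      then have "(\<integral>\<omega>\<in>B. real_cond_exp M F (\<lambda>\<omega>. g \<omega> * indicator A \<omega>) \<omega> \<partial>M)
          = (\<integral>\<omega>\<in>B. real_cond_exp M F (\<lambda>\<omega>. h \<omega> * indicator A \<omega>) \<omega> \<partial>M)"
        unfolding set_lebesgue_integral_def by (intro integral_cong_AE) auto
      then have e: "(\<integral>\<omega>\<in>B. g \<omega> * indicator A \<omega> \<partial>M) = (\<integral>\<omega>\<in>B. h \<omega> * indicator A \<omega> \<partial>M)"
        using F.real_cond_exp_intA[OF i1 B] F.real_cond_exp_intA[OF i2 B] by simp
      have "(\<integral>\<omega>\<in>A. k \<omega> \<partial>M) = (\<integral>\<omega>\<in>B. g \<omega> * indicator A \<omega> - h \<omega> * indicator A \<omega> \<partial>M)"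
        unfolding set_lebesgue_integral_def k_def
        by (intro Bochner_Integration.integral_cong) (auto simp: indicator_def)
      also have "\<dots> = (\<integral>\<omega>\<in>B. g \<omega> * indicator A \<omega> \<partial>M) - (\<integral>\<omega>\<in>B. h \<omega> * indicator A \<omega> \<partial>M)"
      proof (rule set_integral_diff(2))
        show "set_integrable M B (\<lambda>\<omega>. g \<omega> * indicator A \<omega>)" "set_integrable M B (\<lambda>\<omega>. h \<omega> * indicator A \<omega>)"
          unfolding set_integrable_def real_scaleR_def
          using integrable_real_mult_indicator[OF BM i1] integrable_real_mult_indicator[OF BM i2]
          by (simp_all add: mult_ac)
      qed
      finally show "(\<integral>\<omega>\<in>A. k \<omega> \<partial>M) = (\<integral>\<omega>\<in>A. 0 \<partial>M)" using e by (simp add: set_lebesgue_integral_def)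
    qed (use k in auto)
    then have "(\<integral>\<omega>. f \<omega> * real_cond_exp M G k \<omega> \<partial>M) = (\<integral>\<omega>. 0 \<partial>M)"
      by (intro integral_cong_AE) auto
    \<comment> \<open>Conditional expectation is self-adjoint: \<open>f\<close> is
      \<open>G\<close>-measurable, so \<open>k\<close> may stand in place of its projection.\<close>
    moreover have "(\<integral>\<omega>. f \<omega> * real_cond_exp M G k \<omega> \<partial>M) = (\<integral>\<omega>. f \<omega> * k \<omega> \<partial>M)"
      using int_f[OF k] f(1) k by (intro G.real_cond_exp_intg) (auto simp: mult.commute)
    ultimately have z: "(\<integral>\<omega>. f \<omega> * k \<omega> \<partial>M) = 0" by simp
    have "(\<integral>\<omega>\<in>B. g \<omega> * f \<omega> \<partial>M) - (\<integral>\<omega>\<in>B. h \<omega> * f \<omega> \<partial>M) = (\<integral>\<omega>\<in>B. g \<omega> * f \<omega> - h \<omega> * f \<omega> \<partial>M)"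
    proof (rule set_integral_diff(2)[symmetric])
      show "set_integrable M B (\<lambda>\<omega>. g \<omega> * f \<omega>)" "set_integrable M B (\<lambda>\<omega>. h \<omega> * f \<omega>)"
        unfolding set_integrable_def real_scaleR_def
        using integrable_real_mult_indicator[OF BM int_f[OF g]] integrable_real_mult_indicator[OF BM int_f[OF h(1)]]
        by (simp_all add: mult_ac)
    qed
    also have "\<dots> = (\<integral>\<omega>. f \<omega> * k \<omega> \<partial>M)"
      unfolding set_lebesgue_integral_def k_def
      by (intro Bochner_Integration.integral_cong) (auto simp: algebra_simps)
    finally show ?thesis using z by simp
  qed
  have "AE \<omega> in M. real_cond_exp M F (\<lambda>\<omega>. g \<omega> * f \<omega>) \<omega> = real_cond_exp M F (\<lambda>\<omega>. h \<omega> * f \<omega>) \<omega>"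
  proof (rule F.real_cond_exp_charact)
    fix A assume A: "A \<in> sets F"
    show "(\<integral>\<omega>\<in>A. g \<omega> * f \<omega> \<partial>M) = (\<integral>\<omega>\<in>A. real_cond_exp M F (\<lambda>\<omega>. h \<omega> * f \<omega>) \<omega> \<partial>M)"
      using key[OF A] F.real_cond_exp_intA[OF int_f[OF h(1)] A] by simp
  qed (use int_f g h in auto)
  with F.real_cond_exp_mult[OF h(2) fM int_f[OF h(1)]] show ?thesis by auto
qed

text \<open>Indicators are exchanged for bounded functions one index at a time. When index
  \<open>k\<close> is exchanged, \<open>g\<close> is the product of the other factors and
  \<open>h\<close> that of their conditional expectations; \<open>real_cond_exp_mult_indep\<close>
  applies because the factorisation is already known for every event in position
  \<open>k\<close>.\<close>

lemma (in prob_space) real_cond_exp_prod_cond_indep: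
  fixes f :: "'i \<Rightarrow> 'a \<Rightarrow> real"
  assumes F: "subalgebra M F" and ci: "cond_indep_sets M F (\<lambda>j. sets (G j)) I"
    and J: "finite J" "J \<noteq> {}" "J \<subseteq> I" and G: "\<And>j. j \<in> J \<Longrightarrow> subalgebra M (G j)"
    and f: "\<And>j. j \<in> J \<Longrightarrow> f j \<in> borel_measurable (G j)"
      "\<And>j \<omega>. j \<in> J \<Longrightarrow> \<omega> \<in> space M \<Longrightarrow> \<bar>f j \<omega>\<bar> \<le> c"
  shows "AE \<omega> in M. real_cond_exp M F (\<lambda>\<omega>. \<Prod>j\<in>J. f j \<omega>) \<omega> = (\<Prod>j\<in>J. real_cond_exp M F (f j) \<omega>)"
proof -
  interpret F: finite_measure_subalgebra M F by unfold_locales (rule F)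
  define c' where "c' = max c 1"
  have int: "integrable M k" if "k \<in> borel_measurable M" "\<And>\<omega>. \<omega> \<in> space M \<Longrightarrow> \<bar>k \<omega>\<bar> \<le> b" for k and b :: real
    using that by (intro integrable_const_bound[of _ b]) auto
  have fc: "\<bar>f j \<omega>\<bar> \<le> c'" if "j \<in> J" "\<omega> \<in> space M" for j \<omega>
    using f(2)[OF that] by (simp add: c'_def)
  have fM: "f j \<in> borel_measurable M" if "j \<in> J" for j
    using measurable_from_subalg[OF G f(1)] that by auto
  \<comment> \<open>\<open>K\<close> collects the indices where \<open>f j\<close> already stands in
    place of an event: \<open>K = {}\<close> is conditional independence, \<open>K = J\<close> the
    assertion.\<close>
  have claim: "\<forall>A. (\<forall>j\<in>J - K. A j \<in> sets (G j)) \<longrightarrow>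
     (AE \<omega> in M. real_cond_exp M F (\<lambda>\<omega>. \<Prod>j\<in>J. (if j \<in> K then f j else indicator (A j)) \<omega>) \<omega>
       = (\<Prod>j\<in>J. real_cond_exp M F (if j \<in> K then f j else indicator (A j)) \<omega>))" if "finite K" "K \<subseteq> J" for K
    using that
  proof (induction K rule: finite_induct)
    case empty
    show ?case
    proof (intro allI impI)
      fix A assume A: "\<forall>j\<in>J - {}. A j \<in> sets (G j)"
      have "(\<lambda>\<omega>. \<Prod>j\<in>J. (indicator (A j) \<omega> :: real)) = indicator (\<Inter>j\<in>J. A j)"
        using J(1) by (auto simp: indicator_def fun_eq_iff)
      with ci J A show "AE \<omega> in M. real_cond_exp M F (\<lambda>\<omega>. \<Prod>j\<in>J. (if j \<in> {} then f j else indicator (A j)) \<omega>) \<omega>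
       = (\<Prod>j\<in>J. real_cond_exp M F (if j \<in> {} then f j else indicator (A j)) \<omega>)"
        unfolding cond_indep_sets_def by simp
    qed
  next
    case (insert k K)
    then have k: "k \<in> J" "k \<notin> K" "K \<subseteq> J" by auto
    show ?case
    proof (intro allI impI)
      fix A assume A: "\<forall>j\<in>J - insert k K. A j \<in> sets (G j)"
      define u where "u = (\<lambda>j. if j \<in> K then f j else (indicator (A j) :: 'a \<Rightarrow> real))"
      define g where "g = (\<lambda>\<omega>. \<Prod>j\<in>J - {k}. u j \<omega>)"
      define h where "h = (\<lambda>\<omega>. \<Prod>j\<in>J - {k}. real_cond_exp M F (u j) \<omega>)"
      have uM: "u j \<in> borel_measurable M" and ub: "\<omega> \<in> space M \<Longrightarrow> \<bar>u j \<omega>\<bar> \<le> c'" if "j \<in> J - {k}" for j \<omega>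
      proof -
        have "j \<notin> K \<Longrightarrow> A j \<in> sets M" using A G that by (auto simp: subalgebra_def)
        then show "u j \<in> borel_measurable M" using fM that by (auto simp: u_def)
        show "\<omega> \<in> space M \<Longrightarrow> \<bar>u j \<omega>\<bar> \<le> c'" using fc that by (auto simp: u_def indicator_def c'_def)
      qed
      have gb: "\<bar>g \<omega>\<bar> \<le> c' ^ card (J - {k})" if "\<omega> \<in> space M" for \<omega>
        unfolding g_def abs_prod using ub that prod_mono[of "J - {k}" "\<lambda>j. \<bar>u j \<omega>\<bar>" "\<lambda>_. c'"] by simp
      have gi: "integrable M g"
        by (rule int[OF _ gb]) (use uM in \<open>auto simp: g_def intro!: borel_measurable_prod\<close>)
      have hF: "h \<in> borel_measurable F" unfolding h_def by measurable
      have hM: "h \<in> borel_measurable M" by (rule measurable_from_subalg[OF F hF])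
      have "AE \<omega> in M. \<bar>real_cond_exp M F (u j) \<omega>\<bar> \<le> c'" if j: "j \<in> J - {k}" for j
      proof -
        have i: "integrable M (u j)" by (rule int[OF uM[OF j] ub[OF j]])
        have "AE \<omega> in M. u j \<omega> \<ge> - c'" "AE \<omega> in M. u j \<omega> \<le> c'"
          using ub[OF j] by (auto intro!: AE_I2 simp: abs_le_iff minus_le_iff)
        from F.real_cond_exp_ge_c[OF i this(1)] F.real_cond_exp_le_c[OF i this(2)]
        show ?thesis by eventually_elim auto
      qed
      then have "AE \<omega> in M. \<forall>j\<in>J - {k}. \<bar>real_cond_exp M F (u j) \<omega>\<bar> \<le> c'"
        using J(1) by (intro AE_finite_allI) auto
      then have "AE \<omega> in M. norm (h \<omega>) \<le> c' ^ card (J - {k})"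
      proof eventually_elim
        case (elim \<omega>)
        then show ?case unfolding h_def real_norm_def abs_prod
          using prod_mono[of "J - {k}" "\<lambda>j. \<bar>real_cond_exp M F (u j) \<omega>\<bar>" "\<lambda>_. c'"] by simp
      qed
      then have hi: "integrable M h" using hM by (intro integrable_const_bound) auto
      have eq: "AE \<omega> in M. real_cond_exp M F (\<lambda>\<omega>. g \<omega> * indicator E \<omega>) \<omega>
               = h \<omega> * real_cond_exp M F (indicator E) \<omega>" if E: "E \<in> sets (G k)" for E
      proof -
        have "\<forall>j\<in>J - K. (A(k := E)) j \<in> sets (G j)" using A E by auto
        from insert.IH[OF k(3), rule_format, OF this[rule_format]]
        have "AE \<omega> in M. real_cond_exp M F (\<lambda>\<omega>. \<Prod>j\<in>J. (if j \<in> K then f j else indicator ((A(k := E)) j)) \<omega>) \<omega>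
           = (\<Prod>j\<in>J. real_cond_exp M F (if j \<in> K then f j else indicator ((A(k := E)) j)) \<omega>)" by simp
        moreover have "(\<Prod>j\<in>J. (if j \<in> K then f j else indicator ((A(k := E)) j)) \<omega>) = g \<omega> * indicator E \<omega>" for \<omega>
          unfolding g_def u_def using k J(1)
          by (subst prod.remove[of _ k]) (auto intro!: prod.cong simp: mult.commute split: if_splits)
        moreover have "(\<Prod>j\<in>J. real_cond_exp M F (if j \<in> K then f j else indicator ((A(k := E)) j)) \<omega>)
            = h \<omega> * real_cond_exp M F (indicator E) \<omega>" for \<omega>
          unfolding h_def u_def using k J(1)
          by (subst prod.remove[of _ k]) (auto intro!: prod.cong simp: mult.commute split: if_splits)
        ultimately show ?thesis by simp
      qed
      have "AE \<omega> in M. real_cond_exp M F (\<lambda>\<omega>. g \<omega> * f k \<omega>) \<omega> = h \<omega> * real_cond_exp M F (f k) \<omega>"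
        by (rule real_cond_exp_mult_indep[OF F G[OF k(1)] gi hi hF f(1)[OF k(1)] f(2)[OF k(1)] eq])
      moreover have "(\<Prod>j\<in>J. (if j \<in> insert k K then f j else indicator (A j)) \<omega>) = g \<omega> * f k \<omega>" for \<omega>
        unfolding g_def u_def using k J(1)
        by (subst prod.remove[of _ k]) (auto intro!: prod.cong simp: mult.commute split: if_splits)
      moreover have "(\<Prod>j\<in>J. real_cond_exp M F (if j \<in> insert k K then f j else indicator (A j)) \<omega>)
            = h \<omega> * real_cond_exp M F (f k) \<omega>" for \<omega>
        unfolding h_def u_def using k J(1)
        by (subst prod.remove[of _ k]) (auto intro!: prod.cong simp: mult.commute split: if_splits)
      ultimately show "AE \<omega> in M. real_cond_exp M F (\<lambda>\<omega>. \<Prod>j\<in>J. (if j \<in> insert k K then f j else indicator (A j)) \<omega>) \<omega>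
       = (\<Prod>j\<in>J. real_cond_exp M F (if j \<in> insert k K then f j else indicator (A j)) \<omega>)" by simp
    qed
  qed
  from claim[OF J(1) subset_refl] show ?thesis by (auto cong: prod.cong)
qed

section \<open>Exponential moments and tail bounds\<close>

lemma exp_le_quadratic:
  fixes x :: real
  assumes "\<bar>x\<bar> \<le> 1"
  shows "exp x \<le> 1 + x + x\<^sup>2"
proof (cases "0 \<le> x")
  case True
  then show ?thesis using exp_bound[of x] assms by auto
next
  case False
  define y where "y = - x"
  have y: "0 < y" "y \<le> 1" using False assms by (auto simp: y_def)
  \<comment> \<open>The product is \<open>1 + y ^ 3\<close>; together with
    \<open>1 + y \<le> exp y\<close> this bounds the reciprocal of \<open>exp y\<close>.\<close>
  have "1 \<le> (1 - y + y\<^sup>2) * (1 + y)"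
    using y by (simp add: algebra_simps power2_eq_square)
  also have "\<dots> \<le> (1 - y + y\<^sup>2) * exp y"
    using y by (intro mult_left_mono) auto
  finally have "exp (- y) \<le> 1 - y + y\<^sup>2"
    by (simp add: exp_minus field_simps)
  then show ?thesis by (simp add: y_def)
qed

text \<open>A Bernstein bound. From 0 \<le> Z \<le> b follows Z^2 \<le> b Z, so exp(l Z) \<le> 1 +
  (l + l^2 b) Z as long as |l| b \<le> 1; taking conditional means and using 1 + x \<le> exp x turns
  this into an exponential of the conditional mean. As \<open>W\<close> is
  \<open>F\<close>-measurable, it can be moved into the exponent as a compensator.\<close>

lemma (in prob_space) cond_indep_exp_moment:
  fixes Z :: "'i \<Rightarrow> 'a \<Rightarrow> real"
  assumes F: "subalgebra M F" and ci: "cond_indep_sets M F (\<lambda>j. sets (G j)) I"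
    and J: "finite J" "J \<subseteq> I" and G: "\<And>j. j \<in> J \<Longrightarrow> subalgebra M (G j)"
    and Z: "\<And>j. j \<in> J \<Longrightarrow> Z j \<in> borel_measurable (G j)"
      "\<And>j \<omega>. j \<in> J \<Longrightarrow> \<omega> \<in> space M \<Longrightarrow> 0 \<le> Z j \<omega>"
      "\<And>j \<omega>. j \<in> J \<Longrightarrow> \<omega> \<in> space M \<Longrightarrow> Z j \<omega> \<le> b"
    and l: "\<bar>l\<bar> * b \<le> 1"
  defines "W \<equiv> (\<lambda>\<omega>. \<Sum>j\<in>J. real_cond_exp M F (Z j) \<omega>)"
  shows "integrable M (\<lambda>\<omega>. exp (l * (\<Sum>j\<in>J. Z j \<omega>) - (l + l\<^sup>2 * b) * W \<omega>))"
    and "(\<integral>\<omega>. exp (l * (\<Sum>j\<in>J. Z j \<omega>) - (l + l\<^sup>2 * b) * W \<omega>) \<partial>M) \<le> 1"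
proof -
  interpret F: finite_measure_subalgebra M F by unfold_locales (rule F)
  define h where "h = (\<lambda>\<omega>. exp (- (l + l\<^sup>2 * b) * W \<omega>))"
  define e where "e = (\<lambda>j \<omega>. exp (l * Z j \<omega>))"
  have WF: "W \<in> borel_measurable F" unfolding W_def by measurable
  have WM[measurable]: "W \<in> borel_measurable M" by (rule measurable_from_subalg[OF F WF])
  have hF[measurable]: "h \<in> borel_measurable F" using WF unfolding h_def by measurable
  have hM[measurable]: "h \<in> borel_measurable M" by (rule measurable_from_subalg[OF F hF])
  have ZM[measurable]: "Z j \<in> borel_measurable M" if "j \<in> J" for j
    using measurable_from_subalg[OF G Z(1)] that by auto
  have Zi: "integrable M (Z j)" if "j \<in> J" for j
    using Z(2,3) that by (intro integrable_const_bound[of _ b]) auto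
  have eM[measurable]: "e j \<in> borel_measurable M" if "j \<in> J" for j
    using that unfolding e_def by measurable
  have lZ: "\<bar>l * Z j \<omega>\<bar> \<le> 1" if "j \<in> J" "\<omega> \<in> space M" for j \<omega>
  proof -
    have "\<bar>l * Z j \<omega>\<bar> \<le> \<bar>l\<bar> * b" using Z(2,3)[OF that] by (simp add: abs_mult mult_left_mono)
    with l show ?thesis by linarith
  qed
  have e_bd: "e j \<omega> \<le> exp 1" if "j \<in> J" "\<omega> \<in> space M" for j \<omega>
    using lZ[OF that] unfolding e_def by auto
  have ei: "integrable M (e j)" if "j \<in> J" for j
    using that e_bd by (intro integrable_const_bound[of _ "exp 1"]) (auto simp: e_def)
  have cond_e: "AE \<omega> in M. 0 \<le> real_cond_exp M F (e j) \<omega>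
       \<and> real_cond_exp M F (e j) \<omega> \<le> exp ((l + l\<^sup>2 * b) * real_cond_exp M F (Z j) \<omega>)" if j: "j \<in> J" for j
  proof -
    have "AE \<omega> in M. e j \<omega> \<le> 1 + (l + l\<^sup>2 * b) * Z j \<omega>"
    proof (rule AE_I2)
      fix \<omega> assume w: "\<omega> \<in> space M"
      have "Z j \<omega> * Z j \<omega> \<le> b * Z j \<omega>" using Z(2,3)[OF j w] by (intro mult_right_mono) auto
      then have "l\<^sup>2 * (Z j \<omega> * Z j \<omega>) \<le> l\<^sup>2 * (b * Z j \<omega>)" by (intro mult_left_mono) auto
      then show "e j \<omega> \<le> 1 + (l + l\<^sup>2 * b) * Z j \<omega>"
        using exp_le_quadratic[OF lZ[OF j w]] unfolding e_def by (simp add: algebra_simps power2_eq_square)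
    qed
    from F.real_cond_exp_mono[OF this ei[OF j]] Zi[OF j]
    have 1: "AE \<omega> in M. real_cond_exp M F (e j) \<omega> \<le> real_cond_exp M F (\<lambda>\<omega>. 1 + (l + l\<^sup>2 * b) * Z j \<omega>) \<omega>" by auto
    have 2: "AE \<omega> in M. real_cond_exp M F (\<lambda>\<omega>. 1 + (l + l\<^sup>2 * b) * Z j \<omega>) \<omega>
      = real_cond_exp M F (\<lambda>_. 1) \<omega> + real_cond_exp M F (\<lambda>\<omega>. (l + l\<^sup>2 * b) * Z j \<omega>) \<omega>"
      using Zi[OF j] by (intro F.real_cond_exp_add) auto
    have 3: "AE \<omega> in M. real_cond_exp M F (\<lambda>\<omega>. (l + l\<^sup>2 * b) * Z j \<omega>) \<omega> = (l + l\<^sup>2 * b) * real_cond_exp M F (Z j) \<omega>"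
      using Zi[OF j] by (intro F.real_cond_exp_cmult) auto
    have 4: "AE \<omega> in M. real_cond_exp M F (\<lambda>_. 1) \<omega> = 1" by (intro F.real_cond_exp_F_meas) auto
    have 5: "AE \<omega> in M. real_cond_exp M F (e j) \<omega> \<ge> 0"
      using j by (intro F.real_cond_exp_pos) (auto simp: e_def)
    from 1 2 3 4 5 show ?thesis
    proof eventually_elim
      case (elim \<omega>)
      then show ?case using exp_ge_add_one_self[of "(l + l\<^sup>2 * b) * real_cond_exp M F (Z j) \<omega>"] by linarith
    qed
  qed
  have "AE \<omega> in M. 0 \<le> real_cond_exp M F (Z j) \<omega> \<and> real_cond_exp M F (Z j) \<omega> \<le> b" if j: "j \<in> J" for j
  proof -
    have "AE \<omega> in M. Z j \<omega> \<ge> 0" "AE \<omega> in M. Z j \<omega> \<le> b" using Z(2,3)[OF j] by auto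
    from F.real_cond_exp_ge_c[OF Zi[OF j] this(1)] F.real_cond_exp_le_c[OF Zi[OF j] this(2)]
    show ?thesis by eventually_elim auto
  qed
  then have "AE \<omega> in M. \<forall>j\<in>J. 0 \<le> real_cond_exp M F (Z j) \<omega> \<and> real_cond_exp M F (Z j) \<omega> \<le> b"
    using J(1) by (intro AE_finite_allI) auto
  \<comment> \<open>This bound depends on \<open>card J\<close> and only makes the compensated
    exponential integrable.\<close>
  then have W_bd: "AE \<omega> in M. \<bar>W \<omega>\<bar> \<le> real (card J) * b"
  proof eventually_elim
    case (elim \<omega>)
    then show ?case unfolding W_def using sum_bounded_above[of J "\<lambda>j. real_cond_exp M F (Z j) \<omega>" b]
      sum_nonneg[of J "\<lambda>j. real_cond_exp M F (Z j) \<omega>"] by auto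
  qed
  define H where "H = exp (\<bar>l + l\<^sup>2 * b\<bar> * (real (card J) * b))"
  have h_bd: "AE \<omega> in M. h \<omega> \<le> H"
    using W_bd
  proof eventually_elim
    case (elim \<omega>)
    have "- (l + l\<^sup>2 * b) * W \<omega> \<le> \<bar>l + l\<^sup>2 * b\<bar> * \<bar>W \<omega>\<bar>"
      by (metis abs_ge_self abs_minus_cancel abs_mult)
    also have "\<dots> \<le> \<bar>l + l\<^sup>2 * b\<bar> * (real (card J) * b)" using elim by (intro mult_left_mono) auto
    finally show ?case unfolding h_def H_def by simp
  qed
  have prod_e: "(\<Prod>j\<in>J. e j \<omega>) = exp (l * (\<Sum>j\<in>J. Z j \<omega>))" for \<omega>
    unfolding e_def using J(1) by (simp add: exp_sum sum_distrib_left)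
  have eq: "exp (l * (\<Sum>j\<in>J. Z j \<omega>) - (l + l\<^sup>2 * b) * W \<omega>) = h \<omega> * (\<Prod>j\<in>J. e j \<omega>)" for \<omega>
    unfolding prod_e h_def by (simp add: mult_exp_exp algebra_simps)
  have eprod_bd: "(\<Prod>j\<in>J. e j \<omega>) \<le> exp 1 ^ card J" "0 \<le> (\<Prod>j\<in>J. e j \<omega>)" if "\<omega> \<in> space M" for \<omega>
    using prod_mono[of J "\<lambda>j. e j \<omega>" "\<lambda>_. exp 1"] e_bd that
    by (auto simp: e_def intro: prod_nonneg)
  have hp: "integrable M (\<lambda>\<omega>. h \<omega> * (\<Prod>j\<in>J. e j \<omega>))"
  proof (rule integrable_const_bound[of _ "H * exp 1 ^ card J"])
    show "AE \<omega> in M. norm (h \<omega> * (\<Prod>j\<in>J. e j \<omega>)) \<le> H * exp 1 ^ card J"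
      using h_bd AE_space
    proof eventually_elim
      case (elim \<omega>)
      have "0 \<le> h \<omega>" by (simp add: h_def)
      then show ?case using elim eprod_bd[OF elim(2)] by (simp add: abs_mult mult_mono)
    qed
  qed auto
  then show i: "integrable M (\<lambda>\<omega>. exp (l * (\<Sum>j\<in>J. Z j \<omega>) - (l + l\<^sup>2 * b) * W \<omega>))" unfolding eq .
  have "AE \<omega> in M. h \<omega> * real_cond_exp M F (\<lambda>\<omega>. \<Prod>j\<in>J. e j \<omega>) \<omega> \<le> 1"
  \<comment> \<open>\<open>cond_indep_sets\<close> speaks of nonempty index sets only.\<close>
  proof (cases "J = {}")
    case True
    have "AE \<omega> in M. real_cond_exp M F (\<lambda>_. 1) \<omega> = 1" by (intro F.real_cond_exp_F_meas) auto
    then show ?thesis by eventually_elim (simp add: True h_def W_def)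
  next
    case False
    have "AE \<omega> in M. real_cond_exp M F (\<lambda>\<omega>. \<Prod>j\<in>J. e j \<omega>) \<omega> = (\<Prod>j\<in>J. real_cond_exp M F (e j) \<omega>)"
    proof (rule real_cond_exp_prod_cond_indep[OF F ci J(1) False J(2) G])
      show "e j \<in> borel_measurable (G j)" if "j \<in> J" for j using Z(1)[OF that] unfolding e_def by measurable
      show "\<bar>e j \<omega>\<bar> \<le> exp 1" if "j \<in> J" "\<omega> \<in> space M" for j \<omega> using e_bd[OF that] by (simp add: e_def)
    qed
    moreover have "AE \<omega> in M. \<forall>j\<in>J. 0 \<le> real_cond_exp M F (e j) \<omega>
       \<and> real_cond_exp M F (e j) \<omega> \<le> exp ((l + l\<^sup>2 * b) * real_cond_exp M F (Z j) \<omega>)"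
      using cond_e J(1) by (intro AE_finite_allI) auto
    ultimately show ?thesis
    proof eventually_elim
      case (elim \<omega>)
      have "(\<Prod>j\<in>J. real_cond_exp M F (e j) \<omega>) \<le> (\<Prod>j\<in>J. exp ((l + l\<^sup>2 * b) * real_cond_exp M F (Z j) \<omega>))"
        using elim(2) by (intro prod_mono) auto
      also have "\<dots> = exp ((l + l\<^sup>2 * b) * W \<omega>)"
        using J(1) by (simp add: exp_sum W_def sum_distrib_left)
      finally have "h \<omega> * (\<Prod>j\<in>J. real_cond_exp M F (e j) \<omega>) \<le> h \<omega> * exp ((l + l\<^sup>2 * b) * W \<omega>)"
        by (intro mult_left_mono) (auto simp: h_def)
      also have "\<dots> = 1" by (simp add: h_def mult_exp_exp algebra_simps)
      finally show ?case using elim by simp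
    qed
  qed
  then have "(\<integral>\<omega>. h \<omega> * real_cond_exp M F (\<lambda>\<omega>. \<Prod>j\<in>J. e j \<omega>) \<omega> \<partial>M) \<le> (\<integral>\<omega>. 1 \<partial>M)"
    using hp by (intro integral_mono_AE F.real_cond_exp_intg) auto
  moreover have "(\<integral>\<omega>. h \<omega> * real_cond_exp M F (\<lambda>\<omega>. \<Prod>j\<in>J. e j \<omega>) \<omega> \<partial>M) = (\<integral>\<omega>. h \<omega> * (\<Prod>j\<in>J. e j \<omega>) \<partial>M)"
    using hp by (intro F.real_cond_exp_intg) auto
  ultimately show "(\<integral>\<omega>. exp (l * (\<Sum>j\<in>J. Z j \<omega>) - (l + l\<^sup>2 * b) * W \<omega>) \<partial>M) \<le> 1"
    unfolding eq by (simp add: prob_space)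
qed

text \<open>Markov's inequality for the compensated exponential. The threshold \<open>k * T\<close>
  may be random because \<open>T\<close> dominates \<open>W\<close> in the quadratic term, and
  \<open>1 \<le> T\<close> then leaves a deterministic exponent.\<close>

lemma (in prob_space) cond_indep_concentration:
  fixes Z :: "'i \<Rightarrow> 'a \<Rightarrow> real"
  assumes F: "subalgebra M F" and ci: "cond_indep_sets M F (\<lambda>j. sets (G j)) I"
    and J: "finite J" "J \<subseteq> I" and G: "\<And>j. j \<in> J \<Longrightarrow> subalgebra M (G j)"
    and Z: "\<And>j. j \<in> J \<Longrightarrow> Z j \<in> borel_measurable (G j)"
      "\<And>j \<omega>. j \<in> J \<Longrightarrow> \<omega> \<in> space M \<Longrightarrow> 0 \<le> Z j \<omega>"
      "\<And>j \<omega>. j \<in> J \<Longrightarrow> \<omega> \<in> space M \<Longrightarrow> Z j \<omega> \<le> b"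
    and b: "0 < b" and k: "0 < k" "k \<le> 2"
    and W: "W \<in> borel_measurable M" "AE \<omega> in M. W \<omega> = (\<Sum>j\<in>J. real_cond_exp M F (Z j) \<omega>)"
    and T: "T \<in> borel_measurable M" "AE \<omega> in M. W \<omega> \<le> T \<omega>" "AE \<omega> in M. 1 \<le> T \<omega>"
  shows "prob {\<omega> \<in> space M. k * T \<omega> < \<bar>(\<Sum>j\<in>J. Z j \<omega>) - W \<omega>\<bar>} \<le> 2 * exp (- k\<^sup>2 / (4 * b))"
proof -
  have ZM[measurable]: "Z j \<in> borel_measurable M" if "j \<in> J" for j
    using measurable_from_subalg[OF G Z(1)] that by auto
  note [measurable] = W(1) T(1)
  have one: "prob {\<omega> \<in> space M. k * T \<omega> < \<sigma> * ((\<Sum>j\<in>J. Z j \<omega>) - W \<omega>)} \<le> exp (- k\<^sup>2 / (4 * b))"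
    if s: "\<sigma> = 1 \<or> \<sigma> = -1" for \<sigma> :: real
  proof -
    \<comment> \<open>Its modulus maximises \<open>\<bar>l\<bar> * k - l\<^sup>2 * b\<close>, with
      maximum \<open>k\<^sup>2 / (4 * b)\<close>; \<open>k \<le> 2\<close> is what
      \<open>\<bar>l\<bar> * b \<le> 1\<close> demands. The sign \<sigma> selects the tail.\<close>
    define l where "l = \<sigma> * k / (2 * b)"
    have lb: "\<bar>l\<bar> * b \<le> 1" using s b k unfolding l_def by auto
    have l2: "l\<^sup>2 = k\<^sup>2 / (4 * b\<^sup>2)" using s unfolding l_def by (auto simp: power_divide power_mult_distrib)
    define u where "u = (\<lambda>\<omega>. exp (l * (\<Sum>j\<in>J. Z j \<omega>) - (l + l\<^sup>2 * b) * (\<Sum>j\<in>J. real_cond_exp M F (Z j) \<omega>)))"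
    note m = cond_indep_exp_moment[OF F ci J G Z lb, folded u_def]
    have "prob {\<omega> \<in> space M. k * T \<omega> < \<sigma> * ((\<Sum>j\<in>J. Z j \<omega>) - W \<omega>)}
        \<le> prob {\<omega> \<in> space M. exp (k\<^sup>2 / (4 * b)) \<le> u \<omega>}"
    proof (rule finite_measure_mono_AE)
      show "{\<omega> \<in> space M. exp (k\<^sup>2 / (4 * b)) \<le> u \<omega>} \<in> sets M" unfolding u_def by measurable
      show "AE \<omega> in M. \<omega> \<in> {\<omega> \<in> space M. k * T \<omega> < \<sigma> * ((\<Sum>j\<in>J. Z j \<omega>) - W \<omega>)} \<longrightarrow>
          \<omega> \<in> {\<omega> \<in> space M. exp (k\<^sup>2 / (4 * b)) \<le> u \<omega>}"
        using W(2) T(2,3)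
      proof eventually_elim
        case (elim \<omega>)
        show ?case
        proof (intro impI)
          assume "\<omega> \<in> {\<omega> \<in> space M. k * T \<omega> < \<sigma> * ((\<Sum>j\<in>J. Z j \<omega>) - W \<omega>)}"
          then have w: "\<omega> \<in> space M" and kT: "k * T \<omega> < \<sigma> * ((\<Sum>j\<in>J. Z j \<omega>) - W \<omega>)" by auto
          have "k / (2 * b) * (k * T \<omega>) \<le> k / (2 * b) * (\<sigma> * ((\<Sum>j\<in>J. Z j \<omega>) - W \<omega>))"
            using kT k b by (intro mult_left_mono) auto
          then have 1: "k / (2 * b) * (k * T \<omega>) \<le> l * ((\<Sum>j\<in>J. Z j \<omega>) - W \<omega>)" by (simp add: l_def mult_ac)
          have 2: "l\<^sup>2 * b * W \<omega> \<le> l\<^sup>2 * b * T \<omega>" using elim b by (intro mult_left_mono) auto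
          have "k\<^sup>2 / (4 * b) * 1 \<le> k\<^sup>2 / (4 * b) * T \<omega>"
            using elim b by (intro mult_left_mono) auto
          also have "\<dots> = k / (2 * b) * (k * T \<omega>) - l\<^sup>2 * b * T \<omega>"
            unfolding l2 using b by (simp add: field_simps power2_eq_square)
          also have "\<dots> \<le> l * ((\<Sum>j\<in>J. Z j \<omega>) - W \<omega>) - l\<^sup>2 * b * W \<omega>" using 1 2 by linarith
          also have "\<dots> = l * (\<Sum>j\<in>J. Z j \<omega>) - (l + l\<^sup>2 * b) * W \<omega>" by (simp add: algebra_simps)
          finally show "\<omega> \<in> {\<omega> \<in> space M. exp (k\<^sup>2 / (4 * b)) \<le> u \<omega>}"
            using w elim unfolding u_def by simp
        qed
      qed
    qed
    also have "\<dots> \<le> (\<integral>\<omega>. u \<omega> \<partial>M) / exp (k\<^sup>2 / (4 * b))"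
      using m(1) by (intro integral_Markov_inequality_measure[of _ _ "{}"]) (auto simp: u_def)
    also have "\<dots> \<le> 1 / exp (k\<^sup>2 / (4 * b))" using m(2) by (intro divide_right_mono) auto
    also have "\<dots> = exp (- k\<^sup>2 / (4 * b))" by (simp add: exp_minus field_simps)
    finally show ?thesis .
  qed
  have "prob {\<omega> \<in> space M. k * T \<omega> < \<bar>(\<Sum>j\<in>J. Z j \<omega>) - W \<omega>\<bar>}
      \<le> prob ({\<omega> \<in> space M. k * T \<omega> < 1 * ((\<Sum>j\<in>J. Z j \<omega>) - W \<omega>)} \<union> {\<omega> \<in> space M. k * T \<omega> < -1 * ((\<Sum>j\<in>J. Z j \<omega>) - W \<omega>)})"
    by (intro finite_measure_mono) (auto simp: abs_if split: if_splits)
  also have "\<dots> \<le> exp (- k\<^sup>2 / (4 * b)) + exp (- k\<^sup>2 / (4 * b))"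
    by (intro order.trans[OF measure_Un_le] add_mono one) auto
  finally show ?thesis by simp
qed

section \<open>Dyadic cubes and SI-martingales\<close>

text \<open>The cube of \<open>dyadic_cubes n\<close> around \<open>x\<close>; equality of floors
  makes membership an equivalence relation, so points can be grouped by cell.\<close>

definition dyadic_cell :: "nat \<Rightarrow> 'a::euclidean_space \<Rightarrow> 'a set" where
  "dyadic_cell n x = {y. \<forall>i\<in>Basis. \<lfloor>2 ^ n * (y \<bullet> i)\<rfloor> = \<lfloor>2 ^ n * (x \<bullet> i)\<rfloor>}"

text \<open>The cube index modulo \<open>L\<close>, restricted to \<open>Basis\<close> so that only
  finitely many colours occur. Cells of one colour are far apart, as SI4 requires.\<close>

definition dyadic_colour :: "nat \<Rightarrow> int \<Rightarrow> 'a::euclidean_space \<Rightarrow> 'a \<Rightarrow> int" where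
  "dyadic_colour n L x = (\<lambda>i\<in>Basis. \<lfloor>2 ^ n * (x \<bullet> i)\<rfloor> mod L)"

lemma dyadic_cell_self: "x \<in> dyadic_cell n x"
  by (simp add: dyadic_cell_def)

lemma dyadic_cell_eq: "y \<in> dyadic_cell n x \<Longrightarrow> dyadic_cell n y = dyadic_cell n x"
  by (auto simp: dyadic_cell_def)

lemma dyadic_cell_in_cubes: "dyadic_cell n x \<in> dyadic_cubes n"
proof -
  have "dyadic_cell n x = {y. \<forall>i\<in>Basis. real_of_int \<lfloor>2 ^ n * (x \<bullet> i)\<rfloor> / 2 ^ n \<le> y \<bullet> i
          \<and> y \<bullet> i < (real_of_int \<lfloor>2 ^ n * (x \<bullet> i)\<rfloor> + 1) / 2 ^ n}"
    unfolding dyadic_cell_def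
  proof (intro Collect_cong ball_cong refl)
    fix y i :: 'a
    have "\<lfloor>2 ^ n * (y \<bullet> i)\<rfloor> = k \<longleftrightarrow> real_of_int k / 2 ^ n \<le> y \<bullet> i \<and> y \<bullet> i < (real_of_int k + 1) / 2 ^ n" for k
      by (simp add: floor_eq_iff field_simps)
    then show "\<lfloor>2 ^ n * (y \<bullet> i)\<rfloor> = \<lfloor>2 ^ n * (x \<bullet> i)\<rfloor> \<longleftrightarrow>
      real_of_int \<lfloor>2 ^ n * (x \<bullet> i)\<rfloor> / 2 ^ n \<le> y \<bullet> i \<and> y \<bullet> i < (real_of_int \<lfloor>2 ^ n * (x \<bullet> i)\<rfloor> + 1) / 2 ^ n" .
  qed
  then show ?thesis unfolding dyadic_cubes_def
    by (rule image_eqI[where x = "\<lambda>i. \<lfloor>2 ^ n * (x \<bullet> i)\<rfloor>"]) simp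
qed

lemma dyadic_cell_dist:
  assumes "y \<in> dyadic_cell n (x::'a::euclidean_space)"
  shows "dist x y \<le> real DIM('a) / 2 ^ n"
proof -
  have "\<bar>(x - y) \<bullet> i\<bar> \<le> 1 / 2 ^ n" if "i \<in> Basis" for i
  proof -
    have "\<lfloor>2 ^ n * (y \<bullet> i)\<rfloor> = \<lfloor>2 ^ n * (x \<bullet> i)\<rfloor>" using assms that by (simp add: dyadic_cell_def)
    then have "\<bar>2 ^ n * (x \<bullet> i) - 2 ^ n * (y \<bullet> i)\<bar> \<le> 1" by linarith
    moreover have "\<bar>2 ^ n * (x \<bullet> i) - 2 ^ n * (y \<bullet> i)\<bar> = 2 ^ n * \<bar>(x - y) \<bullet> i\<bar>"
      by (simp add: inner_diff_left abs_mult flip: right_diff_distrib)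
    ultimately show ?thesis by (simp add: field_simps)
  qed
  then have "(\<Sum>i\<in>Basis. \<bar>(x - y) \<bullet> i\<bar>) \<le> of_nat DIM('a) * (1 / 2 ^ n)" by (intro sum_bounded_above)
  then show ?thesis using norm_le_l1[of "x - y"] by (simp add: dist_norm)
qed

text \<open>Two different integers congruent modulo \<open>L\<close> differ by at least
  \<open>L\<close>, and passing from floors back to coordinates loses at most 1.\<close>

lemma dyadic_colour_separated:
  assumes "dyadic_colour n L x = dyadic_colour n L y" "dyadic_cell n x \<noteq> dyadic_cell n y"
  shows "(real_of_int L - 1) / 2 ^ n \<le> dist x y"
proof -
  obtain i where i: "i \<in> Basis" "\<lfloor>2 ^ n * (x \<bullet> i)\<rfloor> \<noteq> \<lfloor>2 ^ n * (y \<bullet> i)\<rfloor>"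
  proof -
    have "\<exists>i\<in>Basis. \<lfloor>2 ^ n * (x \<bullet> i)\<rfloor> \<noteq> \<lfloor>2 ^ n * (y \<bullet> i)\<rfloor>"
    proof (rule ccontr)
      assume "\<not> ?thesis"
      then have "dyadic_cell n x = dyadic_cell n y" unfolding dyadic_cell_def by simp
      with assms(2) show False by simp
    qed
    then show thesis using that by blast
  qed
  have "\<lfloor>2 ^ n * (x \<bullet> i)\<rfloor> mod L = \<lfloor>2 ^ n * (y \<bullet> i)\<rfloor> mod L"
    using fun_cong[OF assms(1), of i] i by (simp add: dyadic_colour_def)
  then have "L dvd \<lfloor>2 ^ n * (x \<bullet> i)\<rfloor> - \<lfloor>2 ^ n * (y \<bullet> i)\<rfloor>" by (simp add: mod_eq_dvd_iff)
  then have "\<bar>L\<bar> \<le> \<bar>\<lfloor>2 ^ n * (x \<bullet> i)\<rfloor> - \<lfloor>2 ^ n * (y \<bullet> i)\<rfloor>\<bar>" using i by (intro dvd_imp_le_int) auto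
  then have "real_of_int L - 1 \<le> \<bar>2 ^ n * (x \<bullet> i) - 2 ^ n * (y \<bullet> i)\<bar>" by linarith
  also have "\<dots> = 2 ^ n * \<bar>(x - y) \<bullet> i\<bar>"
    by (simp add: inner_diff_left abs_mult flip: right_diff_distrib)
  also have "\<dots> \<le> 2 ^ n * dist x y" using i Basis_le_norm[of i "x - y"] by (simp add: dist_norm)
  finally show ?thesis by (simp add: field_simps)
qed

section \<open>Concentration for SI-martingales\<close>

lemma SI_martingale_measurable:
  assumes "SI_martingale M B \<mu>"
  shows "(\<lambda>\<omega>. \<mu> n \<omega> x) \<in> borel_measurable M"
proof (rule measurable_from_subalg)
  show "subalgebra M (B n)" "(\<lambda>\<omega>. \<mu> n \<omega> x) \<in> borel_measurable (B n)"
    using assms by (simp_all add: SI_martingale_def)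
qed

text \<open>Integrals appear as finite sums over points \<open>p v\<close> with weights
  \<open>q v\<close>, for which pointwise measurability suffices. Points are grouped by cell and
  cells by colour; within a colour SI4 makes the cell sums conditionally independent. The constant
  \<open>m\<close> is the number of colours, fixed by the constant of SI4 and the dimension, hence
  the same for all \<open>n\<close> and all weights. \<open>b\<close> bounds the contribution of one
  cell.\<close>

lemma SI_martingale_concentration:
  fixes \<mu> :: "nat \<Rightarrow> 'b \<Rightarrow> 'a::euclidean_space \<Rightarrow> real"
  assumes SI: "SI_martingale M B \<mu>"
  obtains m :: real where "0 < m"
    "\<And>n (V::'v set) q p b U k. finite V \<Longrightarrow> (\<And>v. v \<in> V \<Longrightarrow> 0 \<le> q v) \<Longrightarrow>
       (\<And>\<omega> x. \<omega> \<in> space M \<Longrightarrow> \<mu> (Suc n) \<omega> x \<le> U) \<Longrightarrow>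
       (\<And>v. v \<in> V \<Longrightarrow> U * (\<Sum>v' | v' \<in> V \<and> p v' \<in> dyadic_cell (Suc n) (p v). q v') \<le> b) \<Longrightarrow>
       0 < b \<Longrightarrow> 0 < k \<Longrightarrow> k \<le> 2 \<Longrightarrow>
       measure M {\<omega> \<in> space M. m * k * max 1 (\<Sum>v\<in>V. q v * \<mu> n \<omega> (p v))
           < \<bar>(\<Sum>v\<in>V. q v * \<mu> (Suc n) \<omega> (p v)) - (\<Sum>v\<in>V. q v * \<mu> n \<omega> (p v))\<bar>}
        \<le> 2 * m * exp (- k\<^sup>2 / (4 * b))"
proof -
  interpret prob_space M using SI by (simp add: SI_martingale_def)
  have Bs: "subalgebra M (B n)" for n using SI by (simp add: SI_martingale_def)
  have pos: "\<omega> \<in> space M \<Longrightarrow> 0 \<le> \<mu> n \<omega> x" for n \<omega> x using SI by (simp add: SI_martingale_def)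
  note muM[measurable] = SI_martingale_measurable[OF SI]
  have mart: "AE \<omega> in M. real_cond_exp M (B n) (\<lambda>\<omega>. \<mu> (Suc n) \<omega> x) \<omega> = \<mu> n \<omega> x" for n x
    using SI by (simp add: SI_martingale_def)
  obtain C where "\<forall>n Q. Q \<subseteq> dyadic_cubes (Suc n) \<longrightarrow> separated_family (C / 2 ^ n) Q \<longrightarrow>
         cond_indep_sets M (B n) (\<lambda>Q. gen_sets M (\<mu> (Suc n)) Q) Q"
    using SI unfolding SI_martingale_def by (elim conjE exE)
  then have C: "Q \<subseteq> dyadic_cubes (Suc n) \<Longrightarrow> separated_family (C / 2 ^ n) Q \<Longrightarrow>
         cond_indep_sets M (B n) (\<lambda>Q. gen_sets M (\<mu> (Suc n)) Q) Q" for n Q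
    by simp
  \<comment> \<open>Separation is prescribed as \<open>C / 2 ^ n\<close> for cubes of side
    2^(-(n+1)), hence the factor 2; the maximum with 1 keeps the range of residues nonempty.\<close>
  define L where "L = max 1 \<lceil>2 * C + 1\<rceil>"
  have L: "1 \<le> L" "2 * C \<le> real_of_int L - 1" unfolding L_def by linarith+
  define Col where "Col = (PiE Basis (\<lambda>_. {0..<L}) :: ('a \<Rightarrow> int) set)"
  have Col: "finite Col" "Col \<noteq> {}" using L unfolding Col_def by (auto simp: PiE_eq_empty_iff intro!: finite_PiE)
  have col_in: "dyadic_colour n L x \<in> Col" for n x
    using L unfolding Col_def dyadic_colour_def by auto
  define m where "m = real (card Col)"
  have m: "0 < m" using Col by (simp add: m_def card_gt_0_iff)
  define G where "G = (\<lambda>n S. sigma (space M) (\<Union>x\<in>S. {(\<lambda>\<omega>. \<mu> n \<omega> x) -` A \<inter> space M | A. A \<in> sets borel}))"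
  have setsG: "sets (G n S) = gen_sets M (\<mu> n) S" for n S
    unfolding G_def gen_sets_def by (rule sets_measure_of) auto
  have spaceG: "space (G n S) = space M" for n S
    unfolding G_def by (rule space_measure_of) auto
  have subG: "subalgebra M (G n S)" for n S
  proof -
    have "(\<Union>x\<in>S. {(\<lambda>\<omega>. \<mu> n \<omega> x) -` A \<inter> space M | A. A \<in> sets borel}) \<subseteq> sets M"
      using measurable_sets[OF muM] by blast
    then show ?thesis
      unfolding subalgebra_def spaceG setsG gen_sets_def by (simp add: sets.sigma_sets_subset)
  qed
  have measG: "(\<lambda>\<omega>. \<mu> n \<omega> x) \<in> borel_measurable (G n S)" if "x \<in> S" for n S x
  proof (rule measurableI)
    fix A :: "real set" assume "A \<in> sets borel"
    then show "(\<lambda>\<omega>. \<mu> n \<omega> x) -` A \<inter> space (G n S) \<in> sets (G n S)"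
      unfolding setsG spaceG gen_sets_def using that by (intro sigma_sets.Basic) auto
  qed auto
  show thesis
  proof (rule that[OF m])
    fix n and V :: "'v set" and q :: "'v \<Rightarrow> real" and p :: "'v \<Rightarrow> 'a" and b U k :: real
    assume V: "finite V" and q: "\<And>v. v \<in> V \<Longrightarrow> 0 \<le> q v"
      and U: "\<And>\<omega> x. \<omega> \<in> space M \<Longrightarrow> \<mu> (Suc n) \<omega> x \<le> U"
      and b: "\<And>v. v \<in> V \<Longrightarrow> U * (\<Sum>v' | v' \<in> V \<and> p v' \<in> dyadic_cell (Suc n) (p v). q v') \<le> b" "0 < b"
      and k: "0 < k" "k \<le> 2"
    interpret Bn: finite_measure_subalgebra M "B n" by unfold_locales (rule Bs)
    let ?cell = "\<lambda>v. dyadic_cell (Suc n) (p v)"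
    \<comment> \<open>One threshold for all colours: each colour sum is at most the full sum, since
      all terms are nonnegative.\<close>
    define T where "T = (\<lambda>\<omega>. max 1 (\<Sum>v\<in>V. q v * \<mu> n \<omega> (p v)))"
    define Vc where "Vc = (\<lambda>c. {v \<in> V. dyadic_colour (Suc n) L (p v) = c})"
    define S where "S = (\<lambda>c l \<omega>. \<Sum>v\<in>Vc c. q v * \<mu> l \<omega> (p v))"
    have Vc: "finite (Vc c)" "Vc c \<subseteq> V" for c using V by (auto simp: Vc_def)
    have VcV: "v \<in> V" if "v \<in> Vc c" for v c using that by (simp add: Vc_def)
    have [measurable]: "S c l \<in> borel_measurable M" "T \<in> borel_measurable M" for c l
      unfolding S_def T_def by measurable
    have int: "integrable M (\<lambda>\<omega>. \<mu> (Suc n) \<omega> x)" for x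
      using U pos by (intro integrable_const_bound[of _ U]) auto
    have tot: "(\<Sum>v\<in>V. q v * \<mu> l \<omega> (p v)) = (\<Sum>c\<in>Col. S c l \<omega>)" for l \<omega>
      unfolding S_def Vc_def using V Col(1) col_in by (intro sum.group[symmetric]) auto
    have one: "prob {\<omega> \<in> space M. k * T \<omega> < \<bar>S c (Suc n) \<omega> - S c n \<omega>\<bar>} \<le> 2 * exp (- k\<^sup>2 / (4 * b))" if "c \<in> Col" for c
    proof -
      define J where "J = ?cell ` Vc c"
      define Z where "Z = (\<lambda>Q \<omega>. \<Sum>v | v \<in> Vc c \<and> ?cell v = Q. q v * \<mu> (Suc n) \<omega> (p v))"
      have SZ: "S c (Suc n) \<omega> = (\<Sum>Q\<in>J. Z Q \<omega>)" for \<omega>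
        unfolding S_def Z_def J_def using Vc(1) by (intro sum.group[symmetric]) auto
      have J: "finite J" unfolding J_def using Vc by simp
      have "separated_family (C / 2 ^ n) J"
        unfolding separated_family_def J_def
      proof (intro ballI impI)
        fix Q Q' x y assume Q: "Q \<in> ?cell ` Vc c" "Q' \<in> ?cell ` Vc c" "Q \<noteq> Q'" "x \<in> Q" "y \<in> Q'"
        obtain v v' where v: "v \<in> Vc c" "Q = ?cell v" "v' \<in> Vc c" "Q' = ?cell v'" using Q(1,2) by auto
        have x: "dyadic_cell (Suc n) x = Q" "dyadic_cell (Suc n) y = Q'" using Q v by (simp_all add: dyadic_cell_eq)
        have "dyadic_colour (Suc n) L z = dyadic_colour (Suc n) L z'" if "z \<in> dyadic_cell (Suc n) z'" for z z' :: 'a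
          using that by (auto simp: dyadic_colour_def dyadic_cell_def fun_eq_iff restrict_def)
        from this[of x "p v"] this[of y "p v'"] Q v have "dyadic_colour (Suc n) L x = dyadic_colour (Suc n) L y"
          by (simp add: Vc_def)
        from dyadic_colour_separated[OF this] have "(real_of_int L - 1) / 2 ^ Suc n \<le> dist x y"
          using x Q by auto
        moreover have "C / 2 ^ n = 2 * C / 2 ^ Suc n" by simp
        moreover have "2 * C / 2 ^ Suc n \<le> (real_of_int L - 1) / 2 ^ Suc n" using L by (intro divide_right_mono) auto
        ultimately show "C / 2 ^ n \<le> dist x y" by linarith
      qed
      moreover have "J \<subseteq> dyadic_cubes (Suc n)" unfolding J_def using dyadic_cell_in_cubes by blast
      ultimately have ci: "cond_indep_sets M (B n) (\<lambda>Q. sets (G (Suc n) Q)) J"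
        unfolding setsG by (intro C)
      \<comment> \<open>The martingale property turns conditional means of the cell sums at level
        \<open>Suc n\<close> into the sums at level \<open>n\<close>.\<close>
      have W: "AE \<omega> in M. S c n \<omega> = (\<Sum>Q\<in>J. real_cond_exp M (B n) (Z Q) \<omega>)"
      proof -
        have "AE \<omega> in M. real_cond_exp M (B n) (Z Q) \<omega> = (\<Sum>v | v \<in> Vc c \<and> ?cell v = Q. q v * \<mu> n \<omega> (p v))" for Q
        proof -
          have "AE \<omega> in M. real_cond_exp M (B n) (\<lambda>\<omega>. q v * \<mu> (Suc n) \<omega> (p v)) \<omega> = q v * \<mu> n \<omega> (p v)" for v
            using Bn.real_cond_exp_cmult[OF int[of "p v"], of "q v"] mart[of n "p v"] by eventually_elim simp
          then have "AE \<omega> in M. \<forall>v\<in>{v \<in> Vc c. ?cell v = Q}. real_cond_exp M (B n) (\<lambda>\<omega>. q v * \<mu> (Suc n) \<omega> (p v)) \<omega> = q v * \<mu> n \<omega> (p v)"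
            using Vc(1)[of c] by (intro AE_finite_allI) auto
          moreover have "AE \<omega> in M. real_cond_exp M (B n) (Z Q) \<omega> = (\<Sum>v\<in>{v \<in> Vc c. ?cell v = Q}. real_cond_exp M (B n) (\<lambda>\<omega>. q v * \<mu> (Suc n) \<omega> (p v)) \<omega>)"
            unfolding Z_def using int by (intro Bn.real_cond_exp_sum) auto
          ultimately show ?thesis by eventually_elim simp
        qed
        then have "AE \<omega> in M. \<forall>Q\<in>J. real_cond_exp M (B n) (Z Q) \<omega> = (\<Sum>v | v \<in> Vc c \<and> ?cell v = Q. q v * \<mu> n \<omega> (p v))"
          using J by (intro AE_finite_allI) auto
        then show ?thesis
        proof eventually_elim
          case (elim \<omega>)
          have "S c n \<omega> = (\<Sum>Q\<in>J. \<Sum>v | v \<in> Vc c \<and> ?cell v = Q. q v * \<mu> n \<omega> (p v))"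
            unfolding S_def J_def using Vc(1) by (intro sum.group[symmetric]) auto
          with elim show ?case by simp
        qed
      qed
      show ?thesis unfolding SZ
      proof (rule cond_indep_concentration[OF Bs ci J subset_refl subG _ _ _ b(2) k _ W])
        fix Q assume Q: "Q \<in> J"
        show "Z Q \<in> borel_measurable (G (Suc n) Q)"
          unfolding Z_def using dyadic_cell_self by (intro borel_measurable_sum borel_measurable_times measG) auto
        fix \<omega> assume w: "\<omega> \<in> space M"
        show "0 \<le> Z Q \<omega>" unfolding Z_def using w q pos VcV by (intro sum_nonneg mult_nonneg_nonneg) auto
        obtain v where v: "v \<in> Vc c" "Q = ?cell v" using Q by (auto simp: J_def)
        have U0: "0 \<le> U" using U[OF w] pos[OF w] by (meson order_trans)
        have "Z Q \<omega> \<le> (\<Sum>v' | v' \<in> Vc c \<and> ?cell v' = Q. q v' * U)"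
          unfolding Z_def using U[OF w] q VcV by (intro sum_mono mult_left_mono) auto
        also have "\<dots> \<le> (\<Sum>v' | v' \<in> V \<and> p v' \<in> ?cell v. q v' * U)"
        proof (rule sum_mono2)
          show "{v' \<in> Vc c. ?cell v' = Q} \<subseteq> {v' \<in> V. p v' \<in> ?cell v}"
          proof
            fix u assume "u \<in> {v' \<in> Vc c. ?cell v' = Q}"
            then have "u \<in> Vc c" "?cell u = ?cell v" using v(2) by auto
            then show "u \<in> {v' \<in> V. p v' \<in> ?cell v}"
              using VcV[of u c] dyadic_cell_self[of "p u" "Suc n"] by simp
          qed
        qed (use V q U0 in auto)
        also have "\<dots> = U * (\<Sum>v' | v' \<in> V \<and> p v' \<in> ?cell v. q v')"
          unfolding sum_distrib_right[symmetric] by (rule mult.commute)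
        also have "\<dots> \<le> b" by (rule b(1)[OF VcV[OF v(1)]])
        finally show "Z Q \<omega> \<le> b" .
      next
        show "AE \<omega> in M. S c n \<omega> \<le> T \<omega>"
        proof (rule AE_I2)
          fix \<omega> assume w: "\<omega> \<in> space M"
          have "S c n \<omega> \<le> (\<Sum>v\<in>V. q v * \<mu> n \<omega> (p v))"
            unfolding S_def using V VcV q pos[OF w] by (intro sum_mono2) auto
          then show "S c n \<omega> \<le> T \<omega>" by (simp add: T_def)
        qed
      qed (auto simp: T_def)
    qed
    \<comment> \<open>Pigeonhole: a total deviation above \<open>m * (k * T)\<close> forces one
      above \<open>k * T\<close> in one of the \<open>m\<close> colours.\<close>
    have "{\<omega> \<in> space M. m * k * T \<omega> < \<bar>(\<Sum>v\<in>V. q v * \<mu> (Suc n) \<omega> (p v)) - (\<Sum>v\<in>V. q v * \<mu> n \<omega> (p v))\<bar>}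
        \<subseteq> (\<Union>c\<in>Col. {\<omega> \<in> space M. k * T \<omega> < \<bar>S c (Suc n) \<omega> - S c n \<omega>\<bar>})"
    proof safe
      fix \<omega> assume w: "\<omega> \<in> space M" and lt: "m * k * T \<omega> < \<bar>(\<Sum>v\<in>V. q v * \<mu> (Suc n) \<omega> (p v)) - (\<Sum>v\<in>V. q v * \<mu> n \<omega> (p v))\<bar>"
      show "\<omega> \<in> (\<Union>c\<in>Col. {\<omega> \<in> space M. k * T \<omega> < \<bar>S c (Suc n) \<omega> - S c n \<omega>\<bar>})"
      proof (rule ccontr)
        assume "\<not> ?thesis"
        then have "\<bar>S c (Suc n) \<omega> - S c n \<omega>\<bar> \<le> k * T \<omega>" if "c \<in> Col" for c
          using w that by (simp add: not_less)
        then have "(\<Sum>c\<in>Col. \<bar>S c (Suc n) \<omega> - S c n \<omega>\<bar>) \<le> m * (k * T \<omega>)"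
          unfolding m_def by (intro sum_bounded_above) auto
        then have "\<bar>\<Sum>c\<in>Col. (S c (Suc n) \<omega> - S c n \<omega>)\<bar> \<le> m * (k * T \<omega>)" by (rule order_trans[OF sum_abs])
        then show False using lt by (simp add: tot sum_subtractf mult_ac)
      qed
    qed
    then have "prob {\<omega> \<in> space M. m * k * T \<omega> < \<bar>(\<Sum>v\<in>V. q v * \<mu> (Suc n) \<omega> (p v)) - (\<Sum>v\<in>V. q v * \<mu> n \<omega> (p v))\<bar>}
       \<le> prob (\<Union>c\<in>Col. {\<omega> \<in> space M. k * T \<omega> < \<bar>S c (Suc n) \<omega> - S c n \<omega>\<bar>})"
      using Col(1) by (intro finite_measure_mono sets.finite_UN) auto
    also have "\<dots> \<le> (\<Sum>c\<in>Col. prob {\<omega> \<in> space M. k * T \<omega> < \<bar>S c (Suc n) \<omega> - S c n \<omega>\<bar>})"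
      using Col(1) by (intro finite_measure_subadditive_finite) auto
    also have "\<dots> \<le> m * (2 * exp (- k\<^sup>2 / (4 * b)))"
      unfolding m_def using one by (intro sum_bounded_above) auto
    finally show "measure M {\<omega> \<in> space M. m * k * max 1 (\<Sum>v\<in>V. q v * \<mu> n \<omega> (p v))
           < \<bar>(\<Sum>v\<in>V. q v * \<mu> (Suc n) \<omega> (p v)) - (\<Sum>v\<in>V. q v * \<mu> n \<omega> (p v))\<bar>}
        \<le> 2 * m * exp (- k\<^sup>2 / (4 * b))" by (simp add: T_def mult_ac)
  qed
qed

section \<open>Coding maps and Bernoulli measures\<close>

lemma prefix_map_add: "prefix_map F w (N + k) = prefix_map F w N \<circ> prefix_map F (\<lambda>j. w (N + j)) k"
  by (induction k) (auto simp: o_assoc)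

lemma prefix_map_cong: "(\<And>k. k < N \<Longrightarrow> w k = w' k) \<Longrightarrow> prefix_map F w N = prefix_map F w' N"
  by (induction N) auto

locale contracting_ifs =
  fixes F :: "'i::finite \<Rightarrow> 'a::euclidean_space \<Rightarrow> 'a" and b :: real
  assumes b: "0 \<le> b" "b < 1"
    and lip: "dist (F i x) (F i y) \<le> b * dist x y"
begin

lemma prefix_map_lip: "dist (prefix_map F w N x) (prefix_map F w N y) \<le> b ^ N * dist x y"
proof (induction N arbitrary: x y)
  case (Suc N)
  have "dist (prefix_map F w (Suc N) x) (prefix_map F w (Suc N) y) \<le> b ^ N * dist (F (w N) x) (F (w N) y)"
    using Suc by simp
  also have "\<dots> \<le> b ^ N * (b * dist x y)" using b lip by (intro mult_left_mono) auto
  finally show ?case by (simp add: mult_ac)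
qed simp

lemma continuous_prefix_map: "continuous_on UNIV (prefix_map F w N)"
  unfolding continuous_on_iff
proof (intro ballI allI impI)
  fix x :: 'a and e :: real assume e: "0 < e"
  have "dist (prefix_map F w N y) (prefix_map F w N x) \<le> dist y x" for y
    using prefix_map_lip[of w N y x] b mult_right_mono[of "b ^ N" 1 "dist y x"] power_le_one[of b N] by simp
  then show "\<exists>d>0. \<forall>y\<in>UNIV. dist y x < d \<longrightarrow> dist (prefix_map F w N y) (prefix_map F w N x) < e"
    using e le_less_trans by blast
qed

lemma prefix_map_tendsto: "(\<lambda>N. prefix_map F w N 0) \<longlonglongrightarrow> coding_map F w"
proof -
  define m where "m = Max (range (\<lambda>i. norm (F i 0)))"
  have m: "norm (F i 0) \<le> m" for i unfolding m_def by (intro Max_ge) auto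
  have "summable (\<lambda>N. norm (prefix_map F w (Suc N) 0 - prefix_map F w N 0))"
  proof (rule summable_comparison_test')
    show "summable (\<lambda>N. m * b ^ N)" using b by (intro summable_mult summable_geometric) auto
    fix N
    have "norm (prefix_map F w (Suc N) 0 - prefix_map F w N 0) \<le> b ^ N * norm (F (w N) 0)"
      using prefix_map_lip[of w N "F (w N) 0" 0] by (simp add: dist_norm)
    also have "\<dots> \<le> b ^ N * m" using b m by (intro mult_left_mono) auto
    finally show "norm (norm (prefix_map F w (Suc N) 0 - prefix_map F w N 0)) \<le> m * b ^ N" by (simp add: mult.commute)
  qed
  then have "summable (\<lambda>N. prefix_map F w (Suc N) 0 - prefix_map F w N 0)" by (rule summable_norm_cancel)
  moreover have "(\<Sum>i<n. prefix_map F w (Suc i) 0 - prefix_map F w i 0) = prefix_map F w n 0" for n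
    using sum_lessThan_telescope[of "\<lambda>N. prefix_map F w N 0" n] by simp
  ultimately have "convergent (\<lambda>N. prefix_map F w N 0)"
    by (simp only: summable_iff_convergent)
  then show ?thesis unfolding coding_map_def by (rule convergent_LIMSEQ_iff[THEN iffD1])
qed

text \<open>The composition of the first \<open>N\<close> maps is continuous and passes through the
  limit that defines \<open>coding_map\<close>. The cylinder estimates rest on this.\<close>

lemma coding_map_shift: "coding_map F w = prefix_map F w N (coding_map F (\<lambda>j. w (N + j)))"
proof (rule LIMSEQ_unique)
  show "(\<lambda>k. prefix_map F w (N + k) 0) \<longlonglongrightarrow> coding_map F w"
    using LIMSEQ_ignore_initial_segment[OF prefix_map_tendsto, of w N] by (simp add: add.commute)
  have "(\<lambda>k. prefix_map F w N (prefix_map F (\<lambda>j. w (N + j)) k 0)) \<longlonglongrightarrow> prefix_map F w N (coding_map F (\<lambda>j. w (N + j)))"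
    using continuous_prefix_map prefix_map_tendsto by (rule continuous_on_tendsto_compose) auto
  then show "(\<lambda>k. prefix_map F w (N + k) 0) \<longlonglongrightarrow> prefix_map F w N (coding_map F (\<lambda>j. w (N + j)))"
    by (simp add: prefix_map_add)
qed

lemma coding_map_Suc: "coding_map F w = F (w 0) (coding_map F (\<lambda>j. w (Suc j)))"
  using coding_map_shift[of w 1] by simp

text \<open>The ball of radius \<open>m / (1 - b)\<close> about 0 is mapped into itself by every
  \<open>F i\<close>, so it contains all approximants started at 0.\<close>

lemma bounded_coding_map: "bounded (range (coding_map F))"
proof -
  define m where "m = Max (range (\<lambda>i. norm (F i 0)))"
  have m: "norm (F i 0) \<le> m" for i unfolding m_def by (intro Max_ge) auto
  have m0: "0 \<le> m" using m norm_ge_zero order_trans by blast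
  have step: "norm (F i x) \<le> m / (1 - b)" if "norm x \<le> m / (1 - b)" for i x
  proof -
    have "norm (F i x) \<le> norm (F i x - F i 0) + norm (F i 0)"
      by (metis norm_triangle_sub add.commute)
    also have "\<dots> \<le> b * (m / (1 - b)) + m"
      using lip[of i x 0] m[of i] mult_left_mono[OF that b(1)] by (simp add: dist_norm)
    also have "\<dots> = m / (1 - b)" using b by (simp add: field_simps)
    finally show ?thesis .
  qed
  have pre: "norm x \<le> m / (1 - b) \<Longrightarrow> norm (prefix_map F w N x) \<le> m / (1 - b)" for w N x
    by (induction N arbitrary: x) (auto intro: step)
  have "norm (coding_map F w) \<le> m / (1 - b)" for w
    using prefix_map_tendsto[of w] pre[of 0 w] m0 b
    by (intro LIMSEQ_le_const2[OF tendsto_norm[OF prefix_map_tendsto]]) auto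
  then show ?thesis unfolding bounded_iff by blast
qed

lemma coding_map_cylinder:
  assumes "\<And>k. k < N \<Longrightarrow> w k = w' k" and D: "\<And>v. norm (coding_map F v) \<le> D"
  shows "dist (coding_map F w) (coding_map F w') \<le> 2 * D * b ^ N"
proof -
  let ?x = "coding_map F (\<lambda>j. w (N + j))" and ?y = "coding_map F (\<lambda>j. w' (N + j))"
  have "dist (coding_map F w) (coding_map F w') = dist (prefix_map F w N ?x) (prefix_map F w N ?y)"
    using coding_map_shift[of w N] coding_map_shift[of w' N] prefix_map_cong[of N w w' F] assms(1) by simp
  also have "\<dots> \<le> b ^ N * dist ?x ?y" by (rule prefix_map_lip)
  also have "\<dots> \<le> b ^ N * (2 * D)"
  proof (rule mult_left_mono)
    show "dist ?x ?y \<le> 2 * D"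
      using norm_triangle_ineq4[of ?x ?y] D[of "\<lambda>j. w (N + j)"] D[of "\<lambda>j. w' (N + j)"] by (simp add: dist_norm)
  qed (use b in auto)
  finally show ?thesis by (simp add: mult_ac)
qed

end

section \<open>Bernoulli measures and finite words\<close>

lemma space_bernoulli [simp]: "space (bernoulli_measure p) = UNIV"
  unfolding bernoulli_measure_def by (simp add: space_PiM space_point_measure PiE_UNIV_domain)

lemma prob_space_point_measure:
  assumes "prob_vector p"
  shows "prob_space (point_measure UNIV (\<lambda>i. ennreal (p i)))"
proof
  have "(\<Sum>i\<in>UNIV. ennreal (p i)) = ennreal (\<Sum>i\<in>UNIV. p i)"
    using assms by (intro sum_ennreal) (auto simp: prob_vector_def less_imp_le)
  then show "emeasure (point_measure UNIV (\<lambda>i. ennreal (p i))) (space (point_measure UNIV (\<lambda>i. ennreal (p i)))) = 1"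
    using assms by (simp add: emeasure_point_measure_finite space_point_measure prob_vector_def)
qed

lemma prob_space_bernoulli: "prob_vector p \<Longrightarrow> prob_space (bernoulli_measure p)"
  unfolding bernoulli_measure_def by (intro prob_space_PiM prob_space_point_measure)

lemma sets_bernoulli_cylinder:
  "{w. restrict w {..<N} = v} \<in> sets (bernoulli_measure p)"
\<comment> \<open>A restricted word is \<open>undefined\<close> from index \<open>N\<close> on, so
  only such \<open>v\<close> give a nonempty set.\<close>
proof (cases "v \<in> extensional {..<N}")
  case True
  then have "{w. restrict w {..<N} = v} = {w \<in> space (bernoulli_measure p). \<forall>k\<in>{..<N}. w k = v k}"
    by (auto simp: fun_eq_iff restrict_def extensional_def)
  also have "\<dots> \<in> sets (bernoulli_measure p)"
  proof (rule sets.sets_Collect_finite_All)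
    fix k
    have "(\<lambda>w. w k) -` {v k} \<inter> space (bernoulli_measure p) \<in> sets (bernoulli_measure p)"
      unfolding bernoulli_measure_def
      by (rule measurable_sets[OF measurable_component_singleton]) (auto simp: sets_point_measure)
    then show "{w \<in> space (bernoulli_measure p). w k = v k} \<in> sets (bernoulli_measure p)"
      by (simp add: vimage_def)
  qed auto
  finally show ?thesis .
next
  case False
  then have "{w. restrict w {..<N} = v} = {}" by auto
  then show ?thesis by simp
qed

lemma finite_words: "finite (PiE {..<N::nat} (\<lambda>_. UNIV :: 'i::finite set))"
  by (intro finite_PiE) auto

lemma measurable_restrict_word:
  fixes p :: "'i::finite \<Rightarrow> real"
  shows "(\<lambda>w. restrict w {..<N}) \<in> measurable (bernoulli_measure p) (count_space UNIV)"
proof -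
  have "(\<lambda>w. restrict w {..<N}) \<in> measurable (bernoulli_measure p) (count_space (PiE {..<N} (\<lambda>_. UNIV)))"
    unfolding measurable_count_space_eq2[OF finite_words]
    using sets_bernoulli_cylinder[of N _ p] by (auto simp: vimage_def)
  then have "(\<lambda>w. id (restrict w {..<N})) \<in> measurable (bernoulli_measure p) (count_space UNIV)"
    by (rule measurable_compose) auto
  then show ?thesis by simp
qed

text \<open>The prefix takes finitely many values, so every function of it is measurable;
  indicators, densities and coding maps can thus be composed freely with truncated words.\<close>

lemma measurable_finite_word:
  fixes f :: "(nat \<Rightarrow> 'i::finite) \<Rightarrow> 'c"
  assumes "f \<in> UNIV \<rightarrow> space L"
  shows "(\<lambda>w. f (restrict w {..<N})) \<in> measurable (bernoulli_measure p) L"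
  by (rule measurable_compose[OF measurable_restrict_word]) (use assms in auto)

lemma measure_bernoulli_cylinder:
  assumes p: "prob_vector p" and v: "v \<in> PiE {..<N} (\<lambda>_. UNIV)"
  shows "measure (bernoulli_measure p) {w. restrict w {..<N} = v} = (\<Prod>k<N. p (v k))"
proof -
  let ?P = "\<lambda>_::nat. point_measure UNIV (\<lambda>i. ennreal (p i))"
  have "{w. restrict w {..<N} = v} = prod_emb UNIV ?P {..<N} (PiE {..<N} (\<lambda>k. {v k}))"
  proof -
    have "v \<in> extensional {..<N}" using v by (simp add: PiE_def)
    from PiE_singleton[OF this] show ?thesis
      by (simp add: prod_emb_def space_point_measure vimage_def PiE_UNIV_domain)
  qed
  then have "emeasure (bernoulli_measure p) {w. restrict w {..<N} = v} = (\<Prod>k<N. emeasure (?P k) {v k})"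
    unfolding bernoulli_measure_def using prob_space_point_measure[OF p]
    by (simp add: emeasure_PiM_emb sets_point_measure)
  also have "\<dots> = (\<Prod>k<N. ennreal (p (v k)))"
    by (simp add: emeasure_point_measure_finite)
  also have "\<dots> = ennreal (\<Prod>k<N. p (v k))"
    using p by (intro prod_ennreal) (auto simp: prob_vector_def less_imp_le)
  finally show ?thesis
    using p by (simp add: measure_def prod_nonneg prob_vector_def less_imp_le)
qed

text \<open>The bridge between integrals over infinite words and the finite weighted sums on which
  the probabilistic estimates act.\<close>

lemma integral_finite_word:
  fixes f :: "(nat \<Rightarrow> 'i::finite) \<Rightarrow> real"
  assumes p: "prob_vector p"
  shows "(\<integral>w. f (restrict w {..<N}) \<partial>bernoulli_measure p) = (\<Sum>v\<in>PiE {..<N} (\<lambda>_. UNIV). (\<Prod>k<N. p (v k)) * f v)"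
proof -
  interpret prob_space "bernoulli_measure p" using p by (rule prob_space_bernoulli)
  have "f (restrict w {..<N}) = (\<Sum>v\<in>PiE {..<N} (\<lambda>_. UNIV). f v * indicator {w. restrict w {..<N} = v} w)" for w
  proof -
    have "(\<Sum>v\<in>PiE {..<N} (\<lambda>_. UNIV). f v * indicator {w. restrict w {..<N} = v} w)
        = (\<Sum>v\<in>PiE {..<N} (\<lambda>_. UNIV). if restrict w {..<N} = v then f v else 0)"
      by (intro sum.cong refl) (simp add: indicator_def)
    also have "\<dots> = f (restrict w {..<N})"
      by (subst sum.delta'[OF finite_words]) simp
    finally show ?thesis by (rule sym)
  qed
  then have "(\<integral>w. f (restrict w {..<N}) \<partial>bernoulli_measure p)
     = (\<integral>w. (\<Sum>v\<in>PiE {..<N} (\<lambda>_. UNIV). f v * indicator {w. restrict w {..<N} = v} w) \<partial>bernoulli_measure p)" by simp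
  also have "\<dots> = (\<Sum>v\<in>PiE {..<N} (\<lambda>_. UNIV). (\<integral>w. f v * indicator {w. restrict w {..<N} = v} w \<partial>bernoulli_measure p))"
    by (intro Bochner_Integration.integral_sum integrable_mult_right integrable_real_indicator sets_bernoulli_cylinder)
      (simp add: emeasure_eq_measure)
  also have "\<dots> = (\<Sum>v\<in>PiE {..<N} (\<lambda>_. UNIV). f v * (\<Prod>k<N. p (v k)))"
    by (intro sum.cong refl) (simp add: measure_bernoulli_cylinder[OF p])
  finally show ?thesis by (simp add: mult.commute)
qed

lemma (in contracting_ifs) measurable_coding_map: "coding_map F \<in> borel_measurable (bernoulli_measure p)"
proof (rule borel_measurable_LIMSEQ_metric[OF _ prefix_map_tendsto])
  fix N
  have "(\<lambda>w. prefix_map F w N 0) = (\<lambda>w. prefix_map F (restrict w {..<N}) N 0)"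
  proof
    fix w
    have "prefix_map F w N = prefix_map F (restrict w {..<N}) N" by (rule prefix_map_cong) simp
    then show "prefix_map F w N 0 = prefix_map F (restrict w {..<N}) N 0" by simp
  qed
  moreover have "(\<lambda>w. prefix_map F (restrict w {..<N}) N 0) \<in> borel_measurable (bernoulli_measure p)"
    by (rule measurable_finite_word) auto
  ultimately show "(\<lambda>w. prefix_map F w N 0) \<in> borel_measurable (bernoulli_measure p)" by simp
qed

section \<open>Families of iterated function systems\<close>

text \<open>Coordinates are rounded down to a grid of mesh \<open>e\<close>, and one element of
  \<open>T\<close> is kept for each occupied box. Representatives in \<open>T\<close> keep the net
  inside the family, where the measure estimates hold.\<close>

lemma finite_net_bounded_coordinates:
  fixes V :: "'t \<Rightarrow> 'k \<Rightarrow> real"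
  assumes K: "finite K" and D: "0 \<le> D" "\<And>t k. t \<in> T \<Longrightarrow> k \<in> K \<Longrightarrow> \<bar>V t k\<bar> \<le> D" and e: "0 < e"
  obtains N where "N \<subseteq> T" "finite N" "real (card N) \<le> (2 * D / e + 2) ^ card K"
    "\<And>t. t \<in> T \<Longrightarrow> \<exists>u\<in>N. \<forall>k\<in>K. \<bar>V t k - V u k\<bar> \<le> e"
proof -
  define h where "h = (\<lambda>t. \<lambda>k\<in>K. \<lfloor>V t k / e\<rfloor>)"
  define R where "R = {\<lfloor>- D / e\<rfloor>..\<lfloor>D / e\<rfloor>}"
  have hR: "h ` T \<subseteq> PiE K (\<lambda>_. R)"
  proof (rule image_subsetI)
    fix t assume t: "t \<in> T"
    have "\<lfloor>- D / e\<rfloor> \<le> \<lfloor>V t k / e\<rfloor> \<and> \<lfloor>V t k / e\<rfloor> \<le> \<lfloor>D / e\<rfloor>" if "k \<in> K" for k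
      using D(2)[OF t that] e by (intro conjI floor_mono divide_right_mono) linarith+
    then show "h t \<in> PiE K (\<lambda>_. R)" by (auto simp: h_def R_def)
  qed
  have fin: "finite (PiE K (\<lambda>_. R))" using K by (intro finite_PiE) (auto simp: R_def)
  have "real (card R) \<le> 2 * D / e + 2"
  proof -
    have "0 \<le> D / e" using D e by simp
    then have "real (card R) = real_of_int (\<lfloor>D / e\<rfloor> - \<lfloor>- D / e\<rfloor> + 1)"
      unfolding R_def by simp linarith
    also have "\<dots> \<le> D / e - (- D / e - 1) + 1" by linarith
    finally show ?thesis by simp
  qed
  then have cR: "real (card R) ^ card K \<le> (2 * D / e + 2) ^ card K" by (intro power_mono) auto
  define N where "N = inv_into T h ` (h ` T)"
  show thesis
  proof (rule that[of N])
    show "N \<subseteq> T" unfolding N_def by (auto simp: inv_into_into)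
    have finh: "finite (h ` T)" by (rule finite_subset[OF hR fin])
    then show "finite N" unfolding N_def by simp
    have "card N \<le> card (PiE K (\<lambda>_. R))"
      unfolding N_def using card_image_le[OF finh] card_mono[OF fin hR] order_trans by blast
    also have "\<dots> = card R ^ card K" using K by (simp add: card_PiE)
    finally have "real (card N) \<le> real (card R) ^ card K"
      by (metis of_nat_le_iff of_nat_power)
    with cR show "real (card N) \<le> (2 * D / e + 2) ^ card K" by linarith
    fix t assume t: "t \<in> T"
    let ?u = "inv_into T h (h t)"
    have "h ?u = h t" using t by (intro f_inv_into_f) auto
    have "\<bar>V t k - V ?u k\<bar> \<le> e" if k: "k \<in> K" for k
    proof -
      have "\<lfloor>V ?u k / e\<rfloor> = \<lfloor>V t k / e\<rfloor>" using fun_cong[OF \<open>h ?u = h t\<close>, of k] k by (simp add: h_def)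
      then have "\<bar>V t k / e - V ?u k / e\<bar> \<le> 1" by linarith
      then have "\<bar>(V t k - V ?u k) / e\<bar> \<le> 1" by (simp add: diff_divide_distrib)
      then show ?thesis using e by (simp add: abs_divide divide_le_eq)
    qed
    then show "\<exists>u\<in>N. \<forall>k\<in>K. \<bar>V t k - V u k\<bar> \<le> e" unfolding N_def using t by blast
  qed
qed

section \<open>Similarities and the distance between iterated function systems\<close>

text \<open>After subtraction of its value at 0, a map that scales all distances by one factor is
  linear (\<open>scaling_linear\<close>).\<close>

lemma similarity_affine:
  fixes G :: "'a::euclidean_space \<Rightarrow> 'a"
  assumes "\<forall>x y. dist (G x) (G y) = r * dist x y"
  shows "G x = G 0 + (\<Sum>e\<in>Basis. (x \<bullet> e) *\<^sub>R (G e - G 0))"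
proof -
  have "linear (\<lambda>x. G x - G 0)"
  proof (rule scaling_linear)
    show "\<forall>x y. dist (G x - G 0) (G y - G 0) = r * dist x y" using assms by (simp add: dist_norm)
  qed simp
  then have "G (\<Sum>e\<in>Basis. (x \<bullet> e) *\<^sub>R e) - G 0 = (\<Sum>e\<in>Basis. (x \<bullet> e) *\<^sub>R (G e - G 0))"
    by (simp add: linear_sum[of "\<lambda>x. G x - G 0"] linear_cmul[of "\<lambda>x. G x - G 0"])
  then show ?thesis by (simp add: euclidean_representation algebra_simps)
qed

text \<open>An error \<open>e\<close> per coordinate gives \<open>DIM('a) * e\<close> at 0 and at
  each basis vector, hence at most twice that in each column of the linear part, and each coordinate
  of \<open>x\<close> is at most \<open>D\<close>.\<close>

lemma similarity_dist_le:
  fixes F G :: "'a::euclidean_space \<Rightarrow> 'a" and e D :: real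
  assumes F: "\<forall>x y. dist (F x) (F y) = r * dist x y" and G: "\<forall>x y. dist (G x) (G y) = r' * dist x y"
    and e: "\<And>a a' :: 'a. a \<in> insert 0 Basis \<Longrightarrow> a' \<in> Basis \<Longrightarrow> \<bar>F a \<bullet> a' - G a \<bullet> a'\<bar> \<le> (e :: real)"
    and x: "norm x \<le> D"
  shows "norm (F x - G x) \<le> e * DIM('a) * (1 + 2 * DIM('a) * D)"
proof -
  have c: "norm (F a - G a) \<le> DIM('a) * e" if "a \<in> insert 0 Basis" for a
  proof -
    have "(\<Sum>a'\<in>Basis. \<bar>(F a - G a) \<bullet> a'\<bar>) \<le> of_nat DIM('a) * e"
      using e[OF that] by (intro sum_bounded_above) (simp add: inner_diff_left)
    then show ?thesis using norm_le_l1[of "F a - G a"] by linarith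
  qed
  have D0: "0 \<le> D" using x norm_ge_zero order_trans by blast
  have "F x - G x = (F 0 - G 0) + (\<Sum>a\<in>Basis. (x \<bullet> a) *\<^sub>R ((F a - G a) - (F 0 - G 0)))"
    unfolding similarity_affine[OF F, of x] similarity_affine[OF G, of x]
    by (simp add: algebra_simps sum_subtractf sum.distrib)
  also have "norm \<dots> \<le> norm (F 0 - G 0) + (\<Sum>a\<in>Basis. norm ((x \<bullet> a) *\<^sub>R ((F a - G a) - (F 0 - G 0))))"
    by (intro norm_triangle_mono norm_sum order_refl)
  also have "\<dots> \<le> DIM('a) * e + of_nat DIM('a) * (D * (2 * (DIM('a) * e)))"
  proof (intro add_mono sum_bounded_above)
    fix a :: 'a assume a: "a \<in> Basis"
    have "norm ((F a - G a) - (F 0 - G 0)) \<le> 2 * (DIM('a) * e)"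
      using c[of a] c[of 0] a norm_triangle_ineq4[of "F a - G a" "F 0 - G 0"] by simp
    moreover have "\<bar>x \<bullet> a\<bar> \<le> D" using Basis_le_norm[OF a, of x] x by linarith
    ultimately show "norm ((x \<bullet> a) *\<^sub>R ((F a - G a) - (F 0 - G 0))) \<le> D * (2 * (DIM('a) * e))"
      unfolding norm_scaleR using D0 by (intro mult_mono) auto
  qed (use c[of 0] in auto)
  finally show ?thesis by (simp add: algebra_simps)
qed

text \<open>\<open>b\<close> bounds all contraction ratios and \<open>D\<close> all attractors; the
  latter reflects boundedness of the family for \<open>ifs_dist\<close>.\<close>

locale ifs_family =
  fixes \<Gamma> :: "(('i::finite \<Rightarrow> 'a::euclidean_space \<Rightarrow> 'a) \<times> ('i \<Rightarrow> real)) set" and b D :: real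
  assumes b: "0 < b" "b < 1"
    and similar: "t \<in> \<Gamma> \<Longrightarrow> \<exists>r. 0 \<le> r \<and> r \<le> b \<and> (\<forall>x y. dist (fst t i x) (fst t i y) = r * dist x y)"
    and prob: "t \<in> \<Gamma> \<Longrightarrow> prob_vector (snd t)"
    and norm_coding: "t \<in> \<Gamma> \<Longrightarrow> norm (coding_map (fst t) w) \<le> D"
begin

lemma contracting: "t \<in> \<Gamma> \<Longrightarrow> contracting_ifs (fst t) b"
proof
  fix i x y assume "t \<in> \<Gamma>"
  then obtain r where "0 \<le> r" "r \<le> b" "dist (fst t i x) (fst t i y) = r * dist x y"
    using similar by blast
  then show "dist (fst t i x) (fst t i y) \<le> b * dist x y" by (simp add: mult_right_mono)
qed (use b in auto)

lemma bdd_coding_diff: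
  assumes "t \<in> \<Gamma>" "u \<in> \<Gamma>"
  shows "bdd_above (range (\<lambda>w. norm (coding_map (fst t) w - coding_map (fst u) w)))"
proof (rule bdd_aboveI2[of _ _ "D + D"])
  fix w show "norm (coding_map (fst t) w - coding_map (fst u) w) \<le> D + D"
    using norm_triangle_ineq4 norm_coding[OF assms(1), of w] norm_coding[OF assms(2), of w]
    by (metis add_mono order_trans)
qed

lemma ifs_dist_bounds:
  assumes "t \<in> \<Gamma>" "u \<in> \<Gamma>"
  shows "dist (coding_map (fst t) w) (coding_map (fst u) w) \<le> ifs_dist t u"
    and "\<bar>snd t i - snd u i\<bar> \<le> ifs_dist t u" and "0 \<le> ifs_dist t u"
proof -
  have 1: "norm (coding_map (fst t) w - coding_map (fst u) w) \<le> (SUP w. norm (coding_map (fst t) w - coding_map (fst u) w))" for w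
    by (rule cSUP_upper[OF UNIV_I bdd_coding_diff[OF assms]])
  have 2: "\<bar>snd t i - snd u i\<bar> \<le> Max (range (\<lambda>i. \<bar>snd t i - snd u i\<bar>))" for i
    by (intro Max_ge) auto
  have 3: "0 \<le> (SUP w. norm (coding_map (fst t) w - coding_map (fst u) w))"
    using 1 norm_ge_zero order_trans by blast
  have 4: "0 \<le> Max (range (\<lambda>i. \<bar>snd t i - snd u i\<bar>))" using 2 abs_ge_zero order_trans by blast
  show "dist (coding_map (fst t) w) (coding_map (fst u) w) \<le> ifs_dist t u"
    using 1[of w] 4 unfolding ifs_dist_def dist_norm by linarith
  show "\<bar>snd t i - snd u i\<bar> \<le> ifs_dist t u" using 2[of i] 3 unfolding ifs_dist_def by linarith
  show "0 \<le> ifs_dist t u" using 3 4 unfolding ifs_dist_def by linarith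
qed

lemma ifs_dist_le:
  assumes "\<And>w. norm (coding_map (fst t) w - coding_map (fst u) w) \<le> e1" "\<And>i. \<bar>snd t i - snd u i\<bar> \<le> e2"
  shows "ifs_dist t u \<le> e1 + e2"
  unfolding ifs_dist_def using assms by (intro add_mono cSUP_least) auto

lemma ifs_dist_commute: "ifs_dist t u = ifs_dist u t"
  unfolding ifs_dist_def by (simp add: norm_minus_commute abs_minus_commute)

lemma ifs_dist_triangle:
  assumes "t \<in> \<Gamma>" "u \<in> \<Gamma>" "v \<in> \<Gamma>"
  shows "ifs_dist t v \<le> ifs_dist t u + ifs_dist u v"
proof -
  let ?S = "\<lambda>t u. SUP w. norm (coding_map (fst t) w - coding_map (fst u) w)"
  let ?M = "\<lambda>t u. Max (range (\<lambda>i. \<bar>snd t i - snd u i\<bar>))"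
  have S: "norm (coding_map (fst t) w - coding_map (fst u) w) \<le> ?S t u" if "t \<in> \<Gamma>" "u \<in> \<Gamma>" for t u w
    by (rule cSUP_upper[OF UNIV_I bdd_coding_diff[OF that]])
  have M: "\<bar>snd t i - snd u i\<bar> \<le> ?M t u" for t u :: "('i \<Rightarrow> 'a \<Rightarrow> 'a) \<times> ('i \<Rightarrow> real)" and i
    by (intro Max_ge) auto
  have "ifs_dist t v \<le> (?S t u + ?S u v) + (?M t u + ?M u v)"
  proof (rule ifs_dist_le)
    fix w
    have "norm (coding_map (fst t) w - coding_map (fst v) w)
      \<le> norm (coding_map (fst t) w - coding_map (fst u) w) + norm (coding_map (fst u) w - coding_map (fst v) w)"
      using norm_triangle_ineq[of "coding_map (fst t) w - coding_map (fst u) w" "coding_map (fst u) w - coding_map (fst v) w"] by simp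
    then show "norm (coding_map (fst t) w - coding_map (fst v) w) \<le> ?S t u + ?S u v"
      using S[OF assms(1,2), of w] S[OF assms(2,3), of w] by linarith
  next
    fix i
    show "\<bar>snd t i - snd v i\<bar> \<le> ?M t u + ?M u v" using M[of t i u] M[of u i v] by linarith
  qed
  then show ?thesis by (simp add: ifs_dist_def)
qed

text \<open>Peeling off one letter bounds the distance of two codings by \<open>\<Delta>\<close>
  plus \<open>b\<close> times the distance for the shifted word, and
  \<open>\<Delta> / (1 - b)\<close> is the fixed point of this recursion;
  \<open>b ^ k * (2 * D)\<close> is the error after \<open>k\<close> letters. The maps are compared
  on the ball of radius \<open>D\<close>, where all coding points lie.\<close>

lemma coding_map_dist_le:
  assumes t: "t \<in> \<Gamma>" and u: "u \<in> \<Gamma>" and d: "\<And>i x. norm x \<le> D \<Longrightarrow> norm (fst t i x - fst u i x) \<le> \<Delta>"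
  shows "norm (coding_map (fst t) w - coding_map (fst u) w) \<le> \<Delta> / (1 - b)"
proof -
  interpret t: contracting_ifs "fst t" b by (rule contracting[OF t])
  interpret u: contracting_ifs "fst u" b by (rule contracting[OF u])
  have "norm (coding_map (fst t) w - coding_map (fst u) w) \<le> \<Delta> / (1 - b) + b ^ k * (2 * D)" for k w
  proof (induction k arbitrary: w)
    case 0
    have "0 \<le> \<Delta>" using d[OF norm_coding[OF t, of w]] norm_ge_zero order_trans by blast
    then have "0 \<le> \<Delta> / (1 - b)" using b by simp
    then show ?case
      using norm_triangle_ineq4[of "coding_map (fst t) w" "coding_map (fst u) w"] norm_coding[OF t, of w] norm_coding[OF u, of w]
      by simp
  next
    case (Suc k)
    let ?i = "w 0" and ?x = "coding_map (fst t) (\<lambda>j. w (Suc j))" and ?y = "coding_map (fst u) (\<lambda>j. w (Suc j))"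
    have "norm (coding_map (fst t) w - coding_map (fst u) w) = norm (fst t ?i ?x - fst u ?i ?y)"
      using t.coding_map_Suc[of w] u.coding_map_Suc[of w] by simp
    also have "\<dots> \<le> norm (fst t ?i ?x - fst u ?i ?x) + norm (fst u ?i ?x - fst u ?i ?y)"
      using norm_triangle_ineq[of "fst t ?i ?x - fst u ?i ?x" "fst u ?i ?x - fst u ?i ?y"] by simp
    also have "\<dots> \<le> \<Delta> + b * norm (?x - ?y)"
      using d[OF norm_coding[OF t], of ?i] u.lip[of ?i ?x ?y] by (simp add: dist_norm add_mono)
    also have "\<dots> \<le> \<Delta> + b * (\<Delta> / (1 - b) + b ^ k * (2 * D))"
      using b Suc by (intro add_left_mono mult_left_mono) auto
    also have "\<dots> = \<Delta> / (1 - b) + b ^ Suc k * (2 * D)" using b by (simp add: field_simps)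
    finally show ?case .
  qed
  moreover have "(\<lambda>k. \<Delta> / (1 - b) + b ^ k * (2 * D)) \<longlonglongrightarrow> \<Delta> / (1 - b) + 0 * (2 * D)"
    using b by (intro tendsto_intros LIMSEQ_power_zero) auto
  ultimately show ?thesis by (intro LIMSEQ_le_const[where X = "\<lambda>k. \<Delta> / (1 - b) + b ^ k * (2 * D)"]) auto
qed

text \<open>A system is described by the coordinates \<open>V\<close> of its maps at 0 and at the
  basis vectors together with its probabilities. These are bounded on \<Gamma> and control
  \<open>ifs_dist\<close>, so for nonempty \<Gamma> the exponent \<open>k\<close> is the number of
  coordinates.\<close>

lemma polynomial_nets:
  obtains C :: real and k :: nat where "0 < C"
    "\<And>e. 0 < e \<Longrightarrow> e < 1 \<Longrightarrow> \<exists>N\<subseteq>\<Gamma>. finite N \<and> real (card N) \<le> C * (1 / e) ^ k \<and> (\<forall>t\<in>\<Gamma>. \<exists>u\<in>N. ifs_dist t u \<le> e)"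
proof (cases "\<Gamma> = {}")
  case True
  show thesis by (rule that[of 1 0]) (use True in auto)
next
  case False
  then have D: "0 \<le> D" using norm_coding norm_ge_zero order_trans by blast
  define K :: "('i \<times> 'a \<times> 'a + 'i) set" where "K = Inl ` (UNIV \<times> insert 0 Basis \<times> Basis) \<union> range Inr"
  define V where "V = (\<lambda>(t :: ('i \<Rightarrow> 'a \<Rightarrow> 'a) \<times> ('i \<Rightarrow> real)) k. case k of Inl (i, a, a') \<Rightarrow> fst t i a \<bullet> a' | Inr i \<Rightarrow> snd t i)"
  have K: "finite K" unfolding K_def by auto
  have Vb: "\<bar>V t k\<bar> \<le> 2 * D + 1" if t: "t \<in> \<Gamma>" and k: "k \<in> K" for t k
  proof -
    interpret t: contracting_ifs "fst t" b by (rule contracting[OF t])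
    from k consider (l) i a a' where "k = Inl (i, a, a')" "a \<in> insert 0 Basis" "a' \<in> Basis" | (r) i where "k = Inr i"
      unfolding K_def by blast
    then show ?thesis
    proof cases
      case l
      \<comment> \<open>The coding of the constant word is the fixed point of the map with index
        \<open>i\<close>; from there the contraction bounds its values at 0 and at the basis
        vectors.\<close>
      define w where "w = (\<lambda>_::nat. i)"
      have "coding_map (fst t) w = fst t i (coding_map (fst t) w)" using t.coding_map_Suc[of w] by (simp add: w_def)
      then have "dist (fst t i a) (coding_map (fst t) w) \<le> b * dist a (coding_map (fst t) w)" using t.lip by metis
      also have "\<dots> \<le> dist a (coding_map (fst t) w)" using b mult_right_mono[of b 1 "dist a (coding_map (fst t) w)"] by simp
      also have "\<dots> \<le> norm a + D"
        using norm_triangle_ineq4[of a "coding_map (fst t) w"] norm_coding[OF t, of w] by (simp add: dist_norm)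
      also have "norm a \<le> 1" using l by auto
      finally have "norm (fst t i a) \<le> 2 * D + 1"
        using norm_triangle_ineq2[of "fst t i a" "coding_map (fst t) w"] norm_coding[OF t, of w] by (simp add: dist_norm)
      then show ?thesis using Basis_le_norm[OF l(3), of "fst t i a"] l by (simp add: V_def)
    next
      case r
      have "snd t i \<le> 1" "0 \<le> snd t i"
        using prob[OF t] member_le_sum[of i UNIV "snd t"] by (auto simp: prob_vector_def less_imp_le)
      then show ?thesis using D r by (simp add: V_def)
    qed
  qed
  \<comment> \<open>Coordinate errors \<open>e / c\<close> add up to \<open>e\<close>: the fraction
    comes from \<open>similarity_dist_le\<close> and \<open>coding_map_dist_le\<close>, the final 1
    from the probabilities.\<close>
  define c where "c = real DIM('a) * (1 + 2 * DIM('a) * D) / (1 - b) + 1"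
  have c: "1 \<le> c" unfolding c_def using D b by simp
  show thesis
  proof (rule that[of "((2 * (2 * D + 1) + 2) * c) ^ card K" "card K"])
    show "0 < ((2 * (2 * D + 1) + 2) * c) ^ card K" using D c by (intro zero_less_power mult_pos_pos) auto
    fix e :: real assume e: "0 < e" "e < 1"
    then have "0 < e / c" using c by simp
    have D1: "0 \<le> 2 * D + 1" using D by simp
    obtain N where N: "N \<subseteq> \<Gamma>" "finite N" "real (card N) \<le> (2 * (2 * D + 1) / (e / c) + 2) ^ card K"
      "\<And>t. t \<in> \<Gamma> \<Longrightarrow> \<exists>u\<in>N. \<forall>k\<in>K. \<bar>V t k - V u k\<bar> \<le> e / c"
      by (rule finite_net_bounded_coordinates[OF K D1 Vb \<open>0 < e / c\<close>, of \<Gamma>]) auto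
    have "ifs_dist t u \<le> e" if t: "t \<in> \<Gamma>" and u: "u \<in> \<Gamma>" and V: "\<forall>k\<in>K. \<bar>V t k - V u k\<bar> \<le> e / c" for t u
    proof -
      have "norm (coding_map (fst t) w - coding_map (fst u) w) \<le> (e / c * DIM('a) * (1 + 2 * DIM('a) * D)) / (1 - b)" for w
      proof (rule coding_map_dist_le[OF t u])
        fix i and x :: 'a assume x: "norm x \<le> D"
        obtain r r' where "\<forall>x y. dist (fst t i x) (fst t i y) = r * dist x y" "\<forall>x y. dist (fst u i x) (fst u i y) = r' * dist x y"
          using similar[OF t, of i] similar[OF u, of i] by auto
        then show "norm (fst t i x - fst u i x) \<le> e / c * DIM('a) * (1 + 2 * DIM('a) * D)"
        proof (rule similarity_dist_le[OF _ _ _ x])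
          fix a a' :: 'a assume "a \<in> insert 0 Basis" "a' \<in> Basis"
          then have "Inl (i, a, a') \<in> K" by (auto simp: K_def)
          with V have "\<bar>V t (Inl (i, a, a')) - V u (Inl (i, a, a'))\<bar> \<le> e / c" by blast
          then show "\<bar>fst t i a \<bullet> a' - fst u i a \<bullet> a'\<bar> \<le> e / c" by (simp add: V_def)
        qed
      qed
      moreover have "\<bar>snd t i - snd u i\<bar> \<le> e / c" for i
      proof -
        have "Inr i \<in> K" by (auto simp: K_def)
        with V have "\<bar>V t (Inr i) - V u (Inr i)\<bar> \<le> e / c" by blast
        then show ?thesis by (simp add: V_def)
      qed
      ultimately have "ifs_dist t u \<le> (e / c * DIM('a) * (1 + 2 * DIM('a) * D)) / (1 - b) + e / c"
        by (rule ifs_dist_le)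
      also have "\<dots> = e / c * (real DIM('a) * (1 + 2 * DIM('a) * D) / (1 - b) + 1)"
        by (simp only: distrib_left times_divide_eq_right times_divide_eq_left mult.assoc mult_1_right)
      also have "\<dots> = e / c * c" by (simp only: c_def)
      also have "\<dots> = e" using c by simp
      finally show ?thesis .
    qed
    moreover have "real (card N) \<le> ((2 * (2 * D + 1) + 2) * c) ^ card K * (1 / e) ^ card K"
    proof -
      have "2 \<le> 2 * c / e" using e c by (simp add: field_simps)
      then have "2 * (2 * D + 1) / (e / c) + 2 \<le> 2 * (2 * D + 1) * c / e + 2 * c / e" by simp
      also have "\<dots> = (2 * (2 * D + 1) + 2) * c * (1 / e)" using e by (simp add: field_simps)
      finally have "2 * (2 * D + 1) / (e / c) + 2 \<le> (2 * (2 * D + 1) + 2) * c * (1 / e)" .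
      then have "(2 * (2 * D + 1) / (e / c) + 2) ^ card K \<le> ((2 * (2 * D + 1) + 2) * c * (1 / e)) ^ card K"
        using D e c by (intro power_mono) auto
      with N(3) show ?thesis by (simp only: power_mult_distrib)
    qed
    ultimately show "\<exists>N\<subseteq>\<Gamma>. finite N \<and> real (card N) \<le> ((2 * (2 * D + 1) + 2) * c) ^ card K * (1 / e) ^ card K
        \<and> (\<forall>t\<in>\<Gamma>. \<exists>u\<in>N. ifs_dist t u \<le> e)"
      using N by (meson subsetD)
  qed
qed

end

section \<open>Integrals against self-similar measures\<close>

text \<open>A quantitative form of: \<open>\<phi>\<close> changes only across the boundaries of
  \<open>m\<close> sets of \<open>\<F>\<close>, by at most \<open>a\<close> at each. Both density
  types have this shape; only the product \<open>a * m\<close> enters the estimates, so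
  \<open>R\<close> records that alone.\<close>

definition set_variation :: "'a set set \<Rightarrow> ('a \<Rightarrow> real) \<Rightarrow> real \<Rightarrow> bool" where
  "set_variation \<F> \<phi> R \<longleftrightarrow> (\<exists>(m::nat) a \<Lambda>. 0 \<le> a \<and> a * real m \<le> R \<and> (\<forall>j<m. \<Lambda> j \<in> \<F>) \<and>
     (\<forall>x y. \<bar>\<phi> x - \<phi> y\<bar> \<le> a * (\<Sum>j<m. \<bar>indicator (\<Lambda> j) x - indicator (\<Lambda> j) y\<bar>)))"

lemma set_variation_nonneg: "set_variation \<F> \<phi> R \<Longrightarrow> 0 \<le> R"
  unfolding set_variation_def by (meson mult_nonneg_nonneg of_nat_0_le_iff order_trans)

lemma open_nbhd: "open (nbhd E \<epsilon>)"
  unfolding nbhd_def by auto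

text \<open>If exactly one end point lies in \<open>\<Lambda>\<close>, the connected segment meets
  the frontier, at a point within \<open>\<delta>\<close> of \<open>y\<close>.\<close>

lemma indicator_diff_le_nbhd:
  fixes x y :: "'a::euclidean_space"
  assumes "dist x y < \<delta>"
  shows "\<bar>indicator \<Lambda> x - indicator \<Lambda> y\<bar> \<le> (indicator (nbhd (frontier \<Lambda>) \<delta>) y :: real)"
proof (cases "x \<in> \<Lambda> \<longleftrightarrow> y \<in> \<Lambda>")
  case False
  then have "closed_segment x y \<inter> \<Lambda> \<noteq> {}" "closed_segment x y - \<Lambda> \<noteq> {}" by auto
  from connected_Int_frontier[OF _ this] obtain z where z: "z \<in> closed_segment x y" "z \<in> frontier \<Lambda>"
    by (metis connected_segment(1) disjoint_iff)
  then have "dist z y < \<delta>" using assms dist_in_closed_segment[OF z(1)] by (simp add: dist_commute)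
  then have "y \<in> nbhd (frontier \<Lambda>) \<delta>" using z unfolding nbhd_def by auto
  then show ?thesis by (auto simp: indicator_def)
qed (auto simp: indicator_def)

lemma (in contracting_ifs) ss_measure_simps:
  assumes "prob_vector p"
  shows "prob_space (ss_measure (F, p))"
    and "sets (ss_measure (F, p)) = sets borel"
    and "A \<in> sets borel \<Longrightarrow> measure (ss_measure (F, p)) A = measure (bernoulli_measure p) {w. coding_map F w \<in> A}"
    and "\<phi> \<in> borel_measurable borel \<Longrightarrow>
       integral\<^sup>L (ss_measure (F, p)) \<phi> = (\<integral>w. \<phi> (coding_map F w) \<partial>bernoulli_measure p :: real)"
proof -
  have [measurable]: "coding_map F \<in> borel_measurable (bernoulli_measure p)" by (rule measurable_coding_map)
  show "prob_space (ss_measure (F, p))" unfolding ss_measure_def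
    by (simp add: prob_space.prob_space_distr prob_space_bernoulli[OF assms])
  show "sets (ss_measure (F, p)) = sets borel" by (simp add: ss_measure_def)
  show "A \<in> sets borel \<Longrightarrow> measure (ss_measure (F, p)) A = measure (bernoulli_measure p) {w. coding_map F w \<in> A}"
    unfolding ss_measure_def by (simp add: measure_distr vimage_def)
  show "\<phi> \<in> borel_measurable borel \<Longrightarrow>
       integral\<^sup>L (ss_measure (F, p)) \<phi> = (\<integral>w. \<phi> (coding_map F w) \<partial>bernoulli_measure p :: real)"
    unfolding ss_measure_def by (simp add: integral_distr)
qed

section \<open>Cylinder sums and their continuity in the system\<close>

definition word_weight :: "('i \<Rightarrow> real) \<Rightarrow> nat \<Rightarrow> (nat \<Rightarrow> 'i) \<Rightarrow> real" where
  "word_weight p N v = (\<Prod>k<N. p (v k))"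

text \<open>A finite word \<open>v\<close> is extended by \<open>undefined\<close>, so \<open>coding_map (fst t) v\<close> is a point of the
  attractor in the cylinder of \<open>v\<close>.\<close>

definition cylinder_sum :: "('i::finite \<Rightarrow> 'a::euclidean_space \<Rightarrow> 'a) \<times> ('i \<Rightarrow> real) \<Rightarrow> nat \<Rightarrow> ('a \<Rightarrow> real) \<Rightarrow> real" where
  "cylinder_sum t N \<phi> = (\<Sum>v\<in>PiE {..<N} (\<lambda>_. UNIV). word_weight (snd t) N v * \<phi> (coding_map (fst t) v))"

lemma cylinder_sum_integral:
  "prob_vector (snd t) \<Longrightarrow>
    cylinder_sum t N \<phi> = (\<integral>w. \<phi> (coding_map (fst t) (restrict w {..<N})) \<partial>bernoulli_measure (snd t))"
  unfolding cylinder_sum_def word_weight_def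
  by (rule integral_finite_word[where f = "\<lambda>v. \<phi> (coding_map (fst t) v)", symmetric])

text \<open>\<open>g\<close> stands for \<open>s - \<gamma>1\<close>: covering a boundary zone by
  r^(-\<gamma>1) balls of radius r, each of measure at most a multiple of r^s, gives
  \<open>frontier_bound\<close>. Both bounds are stated for all positive radii;
  \<open>regular_ifs_familyI\<close> arranges this by enlarging \<open>c\<close>.\<close>

locale regular_ifs_family = ifs_family \<Gamma> b D
  for \<Gamma> :: "(('i::finite \<Rightarrow> 'a::euclidean_space \<Rightarrow> 'a) \<times> ('i \<Rightarrow> real)) set" and b D +
  fixes \<F> :: "'a set set" and c s g :: real
  assumes pos: "0 \<le> D" "0 < c" "0 < s" "0 < g"
    and ball_bound: "t \<in> \<Gamma> \<Longrightarrow> 0 < r \<Longrightarrow> measure (ss_measure t) (ball x r) \<le> c * r powr s"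
    and frontier_bound: "t \<in> \<Gamma> \<Longrightarrow> \<Lambda> \<in> \<F> \<Longrightarrow> 0 < \<delta> \<Longrightarrow>
        measure (ss_measure t) (nbhd (frontier \<Lambda>) \<delta>) \<le> c * \<delta> powr g"
begin

lemma ss_simps:
  assumes "t \<in> \<Gamma>"
  shows "prob_space (ss_measure t)" and "sets (ss_measure t) = sets borel"
    and "A \<in> sets borel \<Longrightarrow> measure (ss_measure t) A = measure (bernoulli_measure (snd t)) {w. coding_map (fst t) w \<in> A}"
    and "\<phi> \<in> borel_measurable borel \<Longrightarrow>
       integral\<^sup>L (ss_measure t) \<phi> = (\<integral>w. \<phi> (coding_map (fst t) w) \<partial>bernoulli_measure (snd t) :: real)"
  using contracting_ifs.ss_measure_simps[OF contracting[OF assms] prob[OF assms]] by simp_all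

text \<open>The values of \<open>\<phi>\<close> at \<open>X w\<close> and at the coding point differ
  only if the latter is \<open>\<delta>\<close>-close to the frontier of one of the \<open>m\<close>
  sets. Keeping \<open>X\<close> general covers truncated words as well as truncated codings of a
  neighbouring system.\<close>

lemma integral_perturbed_coding:
  assumes t: "t \<in> \<Gamma>" and X: "X \<in> borel_measurable (bernoulli_measure (snd t))"
    and d: "\<And>w. dist (X w) (coding_map (fst t) w) < \<delta>"
    and \<phi>: "\<phi> \<in> borel_measurable borel" "\<And>x. \<bar>\<phi> x\<bar> \<le> U" "set_variation \<F> \<phi> R"
  shows "\<bar>(\<integral>w. \<phi> (X w) \<partial>bernoulli_measure (snd t)) - integral\<^sup>L (ss_measure t) \<phi>\<bar> \<le> R * c * \<delta> powr g"
proof -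
  let ?P = "bernoulli_measure (snd t)" and ?x = "coding_map (fst t)"
  interpret P: prob_space ?P by (rule prob_space_bernoulli[OF prob[OF t]])
  interpret t: contracting_ifs "fst t" b by (rule contracting[OF t])
  note [measurable] = X \<phi>(1) t.measurable_coding_map[of "snd t"]
  have d0: "0 < \<delta>" using d zero_le_dist le_less_trans by blast
  obtain m :: nat and a \<Lambda> where v: "0 \<le> a" "a * real m \<le> R" "\<And>j. j < m \<Longrightarrow> \<Lambda> j \<in> \<F>"
    "\<And>x y. \<bar>\<phi> x - \<phi> y\<bar> \<le> a * (\<Sum>j<m. \<bar>indicator (\<Lambda> j) x - indicator (\<Lambda> j) y\<bar>)"
    using \<phi>(3) unfolding set_variation_def by blast
  define A where "A = (\<lambda>j. {w. ?x w \<in> nbhd (frontier (\<Lambda> j)) \<delta>})"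
  have A[measurable]: "A j \<in> sets ?P" for j
  proof -
    have "?x -` nbhd (frontier (\<Lambda> j)) \<delta> \<inter> space ?P \<in> sets ?P"
      by (intro measurable_sets[OF t.measurable_coding_map] borel_open open_nbhd)
    then show ?thesis by (simp add: A_def vimage_def)
  qed
  have mA: "measure ?P (A j) \<le> c * \<delta> powr g" if "j < m" for j
    using frontier_bound[OF t v(3)[OF that] d0] ss_simps(3)[OF t, of "nbhd (frontier (\<Lambda> j)) \<delta>"] open_nbhd[of "frontier (\<Lambda> j)" \<delta>]
    by (simp add: A_def)
  have i: "integrable ?P (\<lambda>w. \<phi> (X w))" "integrable ?P (\<lambda>w. \<phi> (?x w))"
    using \<phi>(2) by (intro P.integrable_const_bound[of _ U]; simp)+
  have iA: "integrable ?P (indicator (A j) :: _ \<Rightarrow> real)" for j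
    by (intro integrable_real_indicator A) (simp add: P.emeasure_eq_measure)
  have "\<bar>(\<integral>w. \<phi> (X w) \<partial>?P) - integral\<^sup>L (ss_measure t) \<phi>\<bar> = \<bar>\<integral>w. \<phi> (X w) - \<phi> (?x w) \<partial>?P\<bar>"
    using i ss_simps(4)[OF t \<phi>(1)] by simp
  also have "\<dots> \<le> (\<integral>w. \<bar>\<phi> (X w) - \<phi> (?x w)\<bar> \<partial>?P)" by (rule integral_abs_bound)
  also have "\<dots> \<le> (\<integral>w. a * (\<Sum>j<m. indicator (A j) w) \<partial>?P)"
  proof (rule integral_mono)
    show "integrable ?P (\<lambda>w. \<bar>\<phi> (X w) - \<phi> (?x w)\<bar>)" using i by auto
    show "integrable ?P (\<lambda>w. a * (\<Sum>j<m. indicator (A j) w))" using iA by auto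
    fix w
    have "\<bar>\<phi> (X w) - \<phi> (?x w)\<bar> \<le> a * (\<Sum>j<m. \<bar>indicator (\<Lambda> j) (X w) - indicator (\<Lambda> j) (?x w)\<bar>)" by (rule v(4))
    also have "\<dots> \<le> a * (\<Sum>j<m. indicator (nbhd (frontier (\<Lambda> j)) \<delta>) (?x w))"
      using v(1) d by (intro mult_left_mono sum_mono indicator_diff_le_nbhd) auto
    also have "\<dots> = a * (\<Sum>j<m. indicator (A j) w)" by (simp add: A_def indicator_def)
    finally show "\<bar>\<phi> (X w) - \<phi> (?x w)\<bar> \<le> a * (\<Sum>j<m. indicator (A j) w)" .
  qed
  also have "\<dots> = a * (\<Sum>j<m. measure ?P (A j))"
    using iA A by (simp add: Bochner_Integration.integral_sum)
  also have "\<dots> \<le> a * (of_nat m * (c * \<delta> powr g))"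
    using v(1) mA sum_bounded_above[of "{..<m}" "\<lambda>j. measure ?P (A j)" "c * \<delta> powr g"] by (intro mult_left_mono) auto
  also have "\<dots> = a * real m * (c * \<delta> powr g)" by simp
  also have "\<dots> \<le> R * (c * \<delta> powr g)" using v(2) pos by (intro mult_right_mono) auto
  finally show ?thesis by (simp add: mult_ac)
qed

lemma coding_restrict_dist:
  assumes "t \<in> \<Gamma>"
  shows "dist (coding_map (fst t) (restrict w {..<N})) (coding_map (fst t) w) < (2 * D + 1) * b ^ N"
proof -
  have "dist (coding_map (fst t) (restrict w {..<N})) (coding_map (fst t) w) \<le> 2 * D * b ^ N"
    by (rule contracting_ifs.coding_map_cylinder[OF contracting[OF assms]]) (auto simp: norm_coding[OF assms])
  also have "\<dots> < (2 * D + 1) * b ^ N" using b by (simp add: algebra_simps)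
  finally show ?thesis .
qed

lemma cylinder_sum_approx:
  assumes t: "t \<in> \<Gamma>" and \<phi>: "\<phi> \<in> borel_measurable borel" "\<And>x. \<bar>\<phi> x\<bar> \<le> U" "set_variation \<F> \<phi> R"
  shows "\<bar>cylinder_sum t N \<phi> - integral\<^sup>L (ss_measure t) \<phi>\<bar> \<le> R * c * ((2 * D + 1) * b ^ N) powr g"
  unfolding cylinder_sum_integral[OF prob[OF t]]
  by (rule integral_perturbed_coding[OF t measurable_finite_word[of "coding_map (fst t)"] coding_restrict_dist[OF t] \<phi>]) simp

text \<open>A word whose point lies in the cell has its whole cylinder in a slightly larger ball, so
  the discretised measure inherits the ball bound. Of the radius, \<open>DIM('a) / 2 ^ n\<close> is
  for the cell and \<open>1 / 2 ^ n\<close> for the cylinder.\<close>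

lemma cylinder_sum_dyadic_cell:
  assumes t: "t \<in> \<Gamma>" and N: "(2 * D + 1) * b ^ N \<le> 1 / 2 ^ n"
  shows "(\<Sum>v | v \<in> PiE {..<N} (\<lambda>_. UNIV) \<and> coding_map (fst t) v \<in> dyadic_cell (Suc n) x. word_weight (snd t) N v)
     \<le> c * ((real DIM('a) + 1) / 2 ^ n) powr s"
proof -
  let ?P = "bernoulli_measure (snd t)"
  interpret P: prob_space ?P by (rule prob_space_bernoulli[OF prob[OF t]])
  interpret t: contracting_ifs "fst t" b by (rule contracting[OF t])
  let ?r = "(real DIM('a) + 1) / 2 ^ n"
  let ?B = "{w. coding_map (fst t) w \<in> ball x ?r}"
  have B: "?B \<in> sets ?P"
  proof -
    have "coding_map (fst t) -` ball x ?r \<inter> space ?P \<in> sets ?P"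
      by (intro measurable_sets[OF t.measurable_coding_map]) auto
    then show ?thesis by (simp add: vimage_def)
  qed
  have "(\<Sum>v | v \<in> PiE {..<N} (\<lambda>_. UNIV) \<and> coding_map (fst t) v \<in> dyadic_cell (Suc n) x. word_weight (snd t) N v)
    = cylinder_sum t N (indicator (dyadic_cell (Suc n) x))"
    unfolding cylinder_sum_def
    by (rule sum.mono_neutral_cong_left[OF finite_words]) (auto simp: indicator_def)
  also have "\<dots> \<le> (\<integral>w. indicator ?B w \<partial>?P)"
    unfolding cylinder_sum_integral[OF prob[OF t]]
  proof (rule integral_mono)
    show "integrable ?P (indicator ?B :: _ \<Rightarrow> real)"
      using B by (intro integrable_real_indicator) (simp_all add: P.emeasure_eq_measure)
    show "integrable ?P (\<lambda>w. indicator (dyadic_cell (Suc n) x) (coding_map (fst t) (restrict w {..<N})) :: real)"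
      by (rule P.integrable_const_bound[of _ 1])
        (auto intro!: measurable_finite_word[of "\<lambda>v. indicator (dyadic_cell (Suc n) x) (coding_map (fst t) v)"])
    fix w
    have "coding_map (fst t) w \<in> ball x ?r" if "coding_map (fst t) (restrict w {..<N}) \<in> dyadic_cell (Suc n) x"
    proof -
      let ?y = "coding_map (fst t) (restrict w {..<N})"
      have "dist x ?y \<le> real DIM('a) / 2 ^ Suc n" using dyadic_cell_dist[OF that] .
      also have "\<dots> \<le> real DIM('a) / 2 ^ n" by (intro divide_left_mono) auto
      finally have "dist x (coding_map (fst t) w) < real DIM('a) / 2 ^ n + 1 / 2 ^ n"
        using coding_restrict_dist[OF t, of w N] N dist_triangle[of x "coding_map (fst t) w" ?y] by linarith
      then show ?thesis by (simp add: add_divide_distrib)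
    qed
    then show "(indicator (dyadic_cell (Suc n) x) (coding_map (fst t) (restrict w {..<N})) :: real) \<le> indicator ?B w"
      by (simp add: indicator_def)
  qed
  also have "\<dots> = measure (ss_measure t) (ball x ?r)" using B ss_simps(3)[OF t, of "ball x ?r"] by simp
  also have "\<dots> \<le> c * ?r powr s" by (intro ball_bound t) (simp add: add_pos_nonneg)
  finally show ?thesis .
qed

lemma word_weight_diff:
  assumes "t \<in> \<Gamma>" "u \<in> \<Gamma>" and e: "ifs_dist t u \<le> \<epsilon>"
  shows "\<bar>word_weight (snd t) N v - word_weight (snd u) N v\<bar> \<le> N * \<epsilon>"
proof -
  have le1: "norm (snd t i) \<le> 1" if "t \<in> \<Gamma>" for t i
    using prob[OF that] member_le_sum[of i UNIV "snd t"] by (auto simp: prob_vector_def less_imp_le abs_of_pos)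
  have "norm ((\<Prod>k<N. snd t (v k)) - (\<Prod>k<N. snd u (v k))) \<le> (\<Sum>k<N. norm (snd t (v k) - snd u (v k)))"
    using le1 assms by (intro norm_prod_diff) auto
  also have "\<dots> \<le> of_nat (card {..<N}) * \<epsilon>"
    using ifs_dist_bounds(2)[OF assms(1,2)] e by (intro sum_bounded_above) (auto intro: order_trans)
  finally show ?thesis by (simp add: word_weight_def)
qed

lemma abs_integral_le:
  fixes \<phi> :: "'a \<Rightarrow> real"
  assumes t: "t \<in> \<Gamma>" and \<phi>: "\<phi> \<in> borel_measurable borel" "\<And>x. \<bar>\<phi> x\<bar> \<le> U"
  shows "\<bar>integral\<^sup>L (ss_measure t) \<phi>\<bar> \<le> U"
proof -
  interpret ps: prob_space "ss_measure t" by (rule ss_simps[OF t])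
  have U: "0 \<le> U" using \<phi>(2) abs_ge_zero order_trans by blast
  have "\<bar>integral\<^sup>L (ss_measure t) \<phi>\<bar> \<le> (\<integral>x. \<bar>\<phi> x\<bar> \<partial>ss_measure t)" by (rule integral_abs_bound)
  also have "\<dots> \<le> (\<integral>x. U \<partial>ss_measure t)"
    using \<phi> ss_simps(2)[OF t] by (intro integral_mono ps.integrable_const_bound[of _ U]) (auto simp: U cong: measurable_cong_sets)
  also have "\<dots> = U" by (simp add: ps.prob_space)
  finally show ?thesis .
qed

text \<open>Both integrals are compared with sums over words of length \<open>N\<close> evaluated at
  the truncated codings of \<open>t\<close>, with the weights of \<open>t\<close> and of
  \<open>u\<close> respectively. The truncation error is a power of b^N + \<epsilon> up to
  constants; the change of weights costs at most m^N N \<epsilon> U. An \<open>N\<close> logarithmic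
  in 1/\<epsilon> makes both a power of \<epsilon>.\<close>

lemma holder_continuity:
  obtains h C where "0 < h" "0 < C"
    "\<And>t u \<epsilon> \<phi> U R. t \<in> \<Gamma> \<Longrightarrow> u \<in> \<Gamma> \<Longrightarrow> 0 < \<epsilon> \<Longrightarrow> ifs_dist t u \<le> \<epsilon> \<Longrightarrow>
       \<phi> \<in> borel_measurable borel \<Longrightarrow> (\<And>x. \<bar>\<phi> x\<bar> \<le> U) \<Longrightarrow> set_variation \<F> \<phi> R \<Longrightarrow>
       \<bar>integral\<^sup>L (ss_measure t) \<phi> - integral\<^sup>L (ss_measure u) \<phi>\<bar> \<le> C * (R + U) * \<epsilon> powr h"
proof -
  define m where "m = real CARD('i)"
  have m: "1 \<le> m" unfolding m_def using zero_less_card_finite[where 'a='i] by linarith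
  \<comment> \<open>Chosen so that \<open>b = (2 * m) powr (- \<beta>)\<close>, which converts
    growth of the number of words into contraction. The factor 2 absorbs the \<open>N\<close> from
    \<open>word_weight_diff\<close> and keeps the base above 1 for a single map.\<close>
  define \<beta> where "\<beta> = ln (1 / b) / ln (2 * m)"
  have \<beta>: "0 < \<beta>" unfolding \<beta>_def using b m by (intro divide_pos_pos ln_gt_zero) auto
  have b_eq: "b = (2 * m) powr (- \<beta>)"
    unfolding \<beta>_def powr_def using m b by (simp add: ln_div)
  \<comment> \<open>The cap 1 makes \<open>\<epsilon>\<close> itself, the distance between the
    codings, at most \<open>\<epsilon> powr \<beta>'\<close> when
    \<open>\<epsilon> < 1\<close>.\<close>
  define \<beta>' where "\<beta>' = min (\<beta> / 2) 1"
  define A where "A = (2 * D + 1) / b + 1"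
  have A: "1 \<le> A" unfolding A_def using pos b by simp
  define h where "h = min (g * \<beta>') (1/2)"
  define C where "C = 2 * c * A powr g + 2"
  have b': "0 < \<beta>'" "\<beta>' \<le> 1" "\<beta>' \<le> \<beta> / 2" using \<beta> by (auto simp: \<beta>'_def)
  have h: "0 < h" using b' pos by (simp add: h_def)
  have C: "0 < C" unfolding C_def using pos by (simp add: add_nonneg_pos)
  show thesis
  proof (rule that[OF h C])
    fix t u \<epsilon> \<phi> U R
    assume t: "t \<in> \<Gamma>" and u: "u \<in> \<Gamma>" and e: "0 < \<epsilon>" and d: "ifs_dist t u \<le> \<epsilon>"
      and \<phi>: "\<phi> \<in> borel_measurable borel" "\<And>x. \<bar>\<phi> x\<bar> \<le> U" "set_variation \<F> \<phi> R"
    interpret Pt: prob_space "bernoulli_measure (snd t)" by (rule prob_space_bernoulli[OF prob[OF t]])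
    have R: "0 \<le> R" by (rule set_variation_nonneg[OF \<phi>(3)])
    have U: "0 \<le> U" using \<phi>(2) abs_ge_zero order_trans by blast
    show "\<bar>integral\<^sup>L (ss_measure t) \<phi> - integral\<^sup>L (ss_measure u) \<phi>\<bar> \<le> C * (R + U) * \<epsilon> powr h"
    proof (cases "1 \<le> \<epsilon>")
      case True
      from abs_integral_le[OF t \<phi>(1,2)] abs_integral_le[OF u \<phi>(1,2)]
      have "\<bar>integral\<^sup>L (ss_measure t) \<phi> - integral\<^sup>L (ss_measure u) \<phi>\<bar> \<le> 2 * U * 1" by linarith
      also have "\<dots> \<le> C * (R + U) * \<epsilon> powr h"
      proof (intro mult_mono)
        show "1 \<le> \<epsilon> powr h" using True h by (simp add: ge_one_powr_ge_zero)
        show "2 \<le> C" using pos by (simp add: C_def)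
      qed (use R U C in auto)
      finally show ?thesis .
    next
      case False
      \<comment> \<open>The largest \<open>N\<close> with
        \<open>(2 * m) ^ N \<le> \<epsilon> powr (-1/2)\<close>: half of the power of
        \<open>\<epsilon>\<close> pays for the number of words, the other half remains.\<close>
      define N where "N = (LEAST n. \<epsilon> powr (-1/2) < (2 * m) ^ n) - 1"
      have ex: "\<exists>n. \<epsilon> powr (-1/2) < (2 * m) ^ n" using real_arch_pow[of "2 * m"] m by auto
      have e1: "1 \<le> \<epsilon> powr (-1/2)"
        using e False powr_mono'[of "-1/2" 0 \<epsilon>] by simp
      have "(LEAST n. \<epsilon> powr (-1/2) < (2 * m) ^ n) \<noteq> 0"
      proof
        assume "(LEAST n. \<epsilon> powr (-1/2) < (2 * m) ^ n) = 0"
        with LeastI_ex[OF ex] have "\<epsilon> powr (-1/2) < (2 * m) ^ 0" by metis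
        with e1 show False by simp
      qed
      then have SN: "Suc N = (LEAST n. \<epsilon> powr (-1/2) < (2 * m) ^ n)" by (simp add: N_def)
      have N1: "\<epsilon> powr (-1/2) < (2 * m) ^ Suc N" unfolding SN by (rule LeastI_ex[OF ex])
      have N2: "(2 * m) ^ N \<le> \<epsilon> powr (-1/2)"
        using not_less_Least[of N "\<lambda>n. \<epsilon> powr (-1/2) < (2 * m) ^ n"] SN by simp
      have bN: "b ^ Suc N \<le> \<epsilon> powr (\<beta> / 2)"
      proof -
        have "((2 * m) powr (- \<beta>)) ^ n = ((2 * m) ^ n) powr (- \<beta>)" for n
          using m by (induction n) (simp_all add: powr_mult)
        from this[of "Suc N"] have "b ^ Suc N = ((2 * m) ^ Suc N) powr (- \<beta>)" by (simp only: b_eq[symmetric])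
        also have "\<dots> \<le> (\<epsilon> powr (-1/2)) powr (- \<beta>)"
          using N1 e \<beta> by (intro powr_mono2') auto
        also have "\<dots> = \<epsilon> powr (\<beta> / 2)" by (simp add: powr_powr)
        finally show ?thesis .
      qed
      have eb: "\<epsilon> powr (\<beta> / 2) \<le> \<epsilon> powr \<beta>'" "\<epsilon> \<le> \<epsilon> powr \<beta>'"
        using powr_mono'[of \<beta>' "\<beta> / 2" \<epsilon>] powr_mono'[of \<beta>' 1 \<epsilon>] e False b' by auto
      define \<delta> where "\<delta> = (2 * D + 1) * b ^ N"
      have \<delta>0: "0 < \<delta>" unfolding \<delta>_def using pos b by (intro mult_pos_pos) auto
      have "\<delta> = (2 * D + 1) / b * b ^ Suc N" unfolding \<delta>_def using b by simp
      also have "\<dots> \<le> (2 * D + 1) / b * \<epsilon> powr \<beta>'"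
        using bN eb pos b by (intro mult_left_mono) auto
      finally have \<delta>: "\<delta> + \<epsilon> \<le> A * \<epsilon> powr \<beta>'" using eb unfolding A_def by (simp add: algebra_simps)
      have err: "R * c * \<delta>' powr g \<le> R * (c * A powr g) * \<epsilon> powr h" if "0 < \<delta>'" "\<delta>' \<le> \<delta> + \<epsilon>" for \<delta>'
      proof -
        have "\<delta>' powr g \<le> (A * \<epsilon> powr \<beta>') powr g" using that \<delta> pos by (intro powr_mono2) auto
        also have "\<dots> = A powr g * \<epsilon> powr (g * \<beta>')" using A by (simp add: powr_mult powr_powr mult.commute)
        also have "\<dots> \<le> A powr g * \<epsilon> powr h"
          using e False by (intro mult_left_mono powr_mono') (auto simp: h_def)
        finally have "R * c * \<delta>' powr g \<le> R * c * (A powr g * \<epsilon> powr h)"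
          using R pos by (intro mult_left_mono) auto
        then show ?thesis by (simp add: mult_ac)
      qed
      let ?X = "\<lambda>w. coding_map (fst t) (restrict w {..<N})"
      have 1: "\<bar>(\<integral>w. \<phi> (?X w) \<partial>bernoulli_measure (snd t)) - integral\<^sup>L (ss_measure t) \<phi>\<bar> \<le> R * c * \<delta> powr g"
        using cylinder_sum_approx[OF t \<phi>, of N] by (simp add: cylinder_sum_integral[OF prob[OF t]] \<delta>_def)
      have 2: "\<bar>(\<integral>w. \<phi> (?X w) \<partial>bernoulli_measure (snd u)) - integral\<^sup>L (ss_measure u) \<phi>\<bar> \<le> R * c * (\<delta> + \<epsilon>) powr g"
      proof (rule integral_perturbed_coding[OF u measurable_finite_word[of "coding_map (fst t)"] _ \<phi>])
        fix w
        show "dist (?X w) (coding_map (fst u) w) < \<delta> + \<epsilon>"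
          using coding_restrict_dist[OF t, of w N, folded \<delta>_def] ifs_dist_bounds(1)[OF t u, of w] d
            dist_triangle[of "?X w" "coding_map (fst u) w" "coding_map (fst t) w"] by linarith
      qed simp
      have 3: "\<bar>(\<integral>w. \<phi> (?X w) \<partial>bernoulli_measure (snd t)) - (\<integral>w. \<phi> (?X w) \<partial>bernoulli_measure (snd u))\<bar> \<le> U * \<epsilon> powr h"
      proof -
        let ?W = "PiE {..<N} (\<lambda>_. UNIV :: 'i set)"
        have "\<bar>(\<integral>w. \<phi> (?X w) \<partial>bernoulli_measure (snd t)) - (\<integral>w. \<phi> (?X w) \<partial>bernoulli_measure (snd u))\<bar>
          = \<bar>\<Sum>v\<in>?W. (word_weight (snd t) N v - word_weight (snd u) N v) * \<phi> (coding_map (fst t) v)\<bar>"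
          unfolding integral_finite_word[OF prob[OF t], of "\<lambda>v. \<phi> (coding_map (fst t) v)"]
            integral_finite_word[OF prob[OF u], of "\<lambda>v. \<phi> (coding_map (fst t) v)"]
          by (simp add: word_weight_def sum_subtractf left_diff_distrib)
        also have "\<dots> \<le> (\<Sum>v\<in>?W. \<bar>(word_weight (snd t) N v - word_weight (snd u) N v) * \<phi> (coding_map (fst t) v)\<bar>)" by (rule sum_abs)
        also have "\<dots> \<le> of_nat (card ?W) * (N * \<epsilon> * U)"
          unfolding abs_mult using word_weight_diff[OF t u d] \<phi>(2) e by (intro sum_bounded_above mult_mono) auto
        also have "real (card ?W) = m ^ N" by (simp add: card_PiE m_def)
        also have "m ^ N * (N * \<epsilon> * U) \<le> (2 * m) ^ N * (\<epsilon> * U)"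
        proof -
          have "real N \<le> 2 ^ N" using of_nat_less_two_power[of N] by (simp add: less_imp_le)
          then have "m ^ N * (\<epsilon> * U) * real N \<le> m ^ N * (\<epsilon> * U) * 2 ^ N" using m e U by (intro mult_left_mono) auto
          then show ?thesis by (simp add: power_mult_distrib mult_ac)
        qed
        also have "\<dots> \<le> \<epsilon> powr (-1/2) * (\<epsilon> * U)" using N2 e U by (intro mult_right_mono) auto
        also have "\<dots> = U * (\<epsilon> powr (-1/2) * \<epsilon> powr 1)" using e by simp
        also have "\<dots> = U * \<epsilon> powr (1/2)" unfolding powr_add[symmetric] by simp
        also have "\<dots> \<le> U * \<epsilon> powr h" using U e False by (intro mult_left_mono powr_mono') (auto simp: h_def)
        finally show ?thesis .
      qed
      have "\<bar>integral\<^sup>L (ss_measure t) \<phi> - integral\<^sup>L (ss_measure u) \<phi>\<bar> \<le> R * c * \<delta> powr g + R * c * (\<delta> + \<epsilon>) powr g + U * \<epsilon> powr h"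
        using 1 2 3 by linarith
      also have "\<dots> \<le> R * (c * A powr g) * \<epsilon> powr h + R * (c * A powr g) * \<epsilon> powr h + U * \<epsilon> powr h"
        using err[of \<delta>] err[of "\<delta> + \<epsilon>"] \<delta>0 e by simp
      also have "\<dots> = (2 * c * A powr g * R + U) * \<epsilon> powr h" by (simp add: algebra_simps)
      also have "\<dots> \<le> (C * (R + U)) * \<epsilon> powr h"
      proof (rule mult_right_mono)
        have "0 \<le> c * (A powr g * U)" using pos U by simp
        then show "2 * c * A powr g * R + U \<le> C * (R + U)" using R U unfolding C_def by (simp add: algebra_simps)
      qed simp
      finally show ?thesis .
    qed
  qed
qed

end

section \<open>Cutout and cell types\<close>

lemma sum_atLeast1_atMost: "(\<Sum>j\<in>{1..n}. f j) = (\<Sum>j<n. f (Suc j))" for f :: "nat \<Rightarrow> real"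
  using sum.atLeast1_atMost_eq[of f n] by simp

lemma set_variation_cells:
  assumes "\<And>j. \<Lambda> j \<in> \<F>" "\<And>j. 0 \<le> c j" "\<And>j. c j \<le> a"
  shows "set_variation \<F> (\<lambda>x. \<Sum>j\<in>{1..m}. c j * indicator (\<Lambda> j) x) (a * real m)"
  unfolding set_variation_def
proof (intro exI conjI allI impI)
  show "0 \<le> a" using assms(2,3) order_trans by blast
  fix x y
  have "\<bar>(\<Sum>j\<in>{1..m}. c j * indicator (\<Lambda> j) x) - (\<Sum>j\<in>{1..m}. c j * indicator (\<Lambda> j) y)\<bar>
     = \<bar>\<Sum>j<m. c (Suc j) * (indicator (\<Lambda> (Suc j)) x - indicator (\<Lambda> (Suc j)) y)\<bar>"
    unfolding sum_atLeast1_atMost by (simp add: sum_subtractf right_diff_distrib)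
  also have "\<dots> \<le> (\<Sum>j<m. \<bar>c (Suc j) * (indicator (\<Lambda> (Suc j)) x - indicator (\<Lambda> (Suc j)) y)\<bar>)" by (rule sum_abs)
  also have "\<dots> \<le> (\<Sum>j<m. a * \<bar>indicator (\<Lambda> (Suc j)) x - indicator (\<Lambda> (Suc j)) y\<bar>)"
    unfolding abs_mult using assms by (intro sum_mono mult_right_mono) auto
  finally show "\<bar>(\<Sum>j\<in>{1..m}. c j * indicator (\<Lambda> j) x) - (\<Sum>j\<in>{1..m}. c j * indicator (\<Lambda> j) y)\<bar>
      \<le> a * (\<Sum>j<m. \<bar>indicator ((\<lambda>j. \<Lambda> (Suc j)) j) x - indicator ((\<lambda>j. \<Lambda> (Suc j)) j) y\<bar>)"
    by (simp add: sum_distrib_left)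
qed (use assms in auto)

text \<open>If \<open>x\<close> and \<open>y\<close> agree on \<open>\<Omega>\<close> and on all
  removed sets, they agree on the cutout set; otherwise one summand is 1. The set
  \<open>\<Omega>\<close> accounts for \<open>Suc m\<close> and takes index 0, left free by the
  numbering from 1.\<close>

lemma set_variation_cutout:
  assumes "\<Omega> \<in> \<F>" "\<And>j. \<Lambda> j \<in> \<F>" "0 \<le> a"
  shows "set_variation \<F> (\<lambda>x. a * indicator (\<Omega> - (\<Union>j\<in>{1..m}. \<Lambda> j)) x) (a * real (Suc m))"
  unfolding set_variation_def
proof (intro exI conjI allI impI)
  define L where "L = (\<lambda>j. if j = 0 then \<Omega> else \<Lambda> j)"
  show "L j \<in> \<F>" for j using assms by (simp add: L_def)
  fix x y
  have "\<bar>indicator (\<Omega> - (\<Union>j\<in>{1..m}. \<Lambda> j)) x - indicator (\<Omega> - (\<Union>j\<in>{1..m}. \<Lambda> j)) y\<bar>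
      \<le> (\<Sum>j<Suc m. \<bar>indicator (L j) x - indicator (L j) y\<bar> :: real)"
  proof (cases "\<forall>j<Suc m. x \<in> L j \<longleftrightarrow> y \<in> L j")
    case True
    have "x \<in> \<Omega> \<longleftrightarrow> y \<in> \<Omega>" using True[rule_format, of 0] by (simp add: L_def)
    moreover have "x \<in> \<Lambda> j \<longleftrightarrow> y \<in> \<Lambda> j" if "j \<in> {1..m}" for j
      using True[rule_format, of j] that by (auto simp: L_def)
    ultimately have "x \<in> \<Omega> - (\<Union>j\<in>{1..m}. \<Lambda> j) \<longleftrightarrow> y \<in> \<Omega> - (\<Union>j\<in>{1..m}. \<Lambda> j)" by blast
    then show ?thesis by (simp add: indicator_def sum_nonneg)
  next
    case False
    then obtain j where j: "j < Suc m" "(x \<in> L j) \<noteq> (y \<in> L j)" by blast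
    then have "1 = \<bar>indicator (L j) x - indicator (L j) y :: real\<bar>" by (auto simp: indicator_def)
    also have "\<dots> \<le> (\<Sum>j<Suc m. \<bar>indicator (L j) x - indicator (L j) y\<bar>)"
      by (rule member_le_sum) (use j in auto)
    finally show ?thesis by (auto simp: indicator_def)
  qed
  then show "\<bar>a * indicator (\<Omega> - (\<Union>j\<in>{1..m}. \<Lambda> j)) x - a * indicator (\<Omega> - (\<Union>j\<in>{1..m}. \<Lambda> j)) y\<bar>
     \<le> a * (\<Sum>j<Suc m. \<bar>indicator (L j) x - indicator (L j) y\<bar>)"
    using assms(3) by (simp only: right_diff_distrib[symmetric] abs_mult abs_of_nonneg mult_left_mono)
qed (use assms in auto)

lemma set_variation_mono: "set_variation \<F> \<phi> R \<Longrightarrow> R \<le> R' \<Longrightarrow> set_variation \<F> \<phi> R'"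
proof -
  assume "set_variation \<F> \<phi> R" and le: "R \<le> R'"
  then obtain m :: nat and a \<Lambda> where *: "0 \<le> a" "a * real m \<le> R" "\<forall>j<m. \<Lambda> j \<in> \<F>"
    "\<forall>x y. \<bar>\<phi> x - \<phi> y\<bar> \<le> a * (\<Sum>j<m. \<bar>indicator (\<Lambda> j) x - indicator (\<Lambda> j) y\<bar>)"
    unfolding set_variation_def by blast
  show "set_variation \<F> \<phi> R'"
    unfolding set_variation_def
    by (intro exI[of _ m] exI[of _ a] exI[of _ \<Lambda>] conjI order_trans[OF *(2) le]) (use * in simp_all)
qed

text \<open>Puts both types in one form. The exponent \<open>\<alpha>\<close> is kept apart from the
  crude \<open>\<theta>\<close>, since it is \<open>\<alpha>\<close> that lies below
  \<open>s\<close>. Some variation bound \<open>R\<close> holds for every \<open>\<omega>\<close>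
  and \<open>n\<close>, the exponential one only eventually and almost surely, like the bounds on
  the number of sets.\<close>

lemma regular_density:
  fixes M :: "'b measure" and \<mu> :: "nat \<Rightarrow> 'b \<Rightarrow> 'a::euclidean_space \<Rightarrow> real"
  assumes \<mu>0: "\<And>n \<omega> x. \<omega> \<in> space M \<Longrightarrow> 0 \<le> \<mu> n \<omega> x"
    and ne: "space M \<noteq> {}"
    and F: "\<And>\<Lambda>. \<Lambda> \<in> \<F> \<Longrightarrow> \<Lambda> \<in> sets borel"
    and type: "(cell_type M \<F> \<tau> \<zeta> \<mu> \<and> (\<exists>C. \<forall>n. \<forall>\<omega>\<in>space M. \<forall>x. \<mu> n \<omega> x \<le> C * 2 powr (\<alpha> * real n)))
               \<or> cutout_type M \<F> \<alpha> \<zeta> \<mu>"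
  obtains U \<theta> where "0 < U" "0 \<le> \<theta>"
    "\<And>n \<omega>. \<omega> \<in> space M \<Longrightarrow> \<mu> n \<omega> \<in> borel_measurable borel"
    "\<And>n \<omega> x. \<omega> \<in> space M \<Longrightarrow> \<bar>\<mu> n \<omega> x\<bar> \<le> U * 2 powr (\<alpha> * real n)"
    "\<And>n \<omega> x. \<omega> \<in> space M \<Longrightarrow> \<bar>\<mu> n \<omega> x\<bar> \<le> U * 2 powr (\<theta> * real n)"
    "\<And>n \<omega>. \<omega> \<in> space M \<Longrightarrow> \<exists>R. set_variation \<F> (\<mu> n \<omega>) R"
    "AE \<omega> in M. \<exists>N0. \<forall>n\<ge>N0. set_variation \<F> (\<mu> n \<omega>) (U * 2 powr (\<theta> * real n))"
proof -
  \<comment> \<open>A nonnegative exponent that is at least \<open>\<alpha>\<close>,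
    \<open>\<tau> + \<zeta>\<close> and \<open>\<alpha> + \<bar>\<zeta>\<bar>\<close>, so that it
    serves both types.\<close>
  define \<theta> where "\<theta> = \<bar>\<alpha>\<bar> + \<bar>\<tau>\<bar> + \<bar>\<zeta>\<bar>"
  have le\<theta>: "2 powr (p * real n) \<le> 2 powr (\<theta> * real n)" if "p \<le> \<theta>" for p n
    using that by (simp add: mult_right_mono)
  have one\<theta>: "1 \<le> 2 powr (\<theta> * real n)" for n
    using le\<theta>[of 0 n] by (simp add: \<theta>_def)
  from type show thesis
  proof
    assume "cell_type M \<F> \<tau> \<zeta> \<mu> \<and> (\<exists>C. \<forall>n. \<forall>\<omega>\<in>space M. \<forall>x. \<mu> n \<omega> x \<le> C * 2 powr (\<alpha> * real n))"
    then obtain C' where cell: "cell_type M \<F> \<tau> \<zeta> \<mu>"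
      and C': "\<And>n \<omega> x. \<omega> \<in> space M \<Longrightarrow> \<mu> n \<omega> x \<le> C' * 2 powr (\<alpha> * real n)" by blast
    from cell obtain C Mn c Fs where
      Fs: "\<And>n \<omega> j. \<omega> \<in> space M \<Longrightarrow> Fs n \<omega> j \<in> \<F>"
      and c: "\<And>n \<omega> j. \<omega> \<in> space M \<Longrightarrow> 0 \<le> c n \<omega> j" "\<And>n \<omega> j. \<omega> \<in> space M \<Longrightarrow> c n \<omega> j \<le> C * 2 powr (\<tau> * real n)"
      and \<mu>: "\<And>n \<omega>. \<omega> \<in> space M \<Longrightarrow> \<mu> n \<omega> = (\<lambda>x. \<Sum>j\<in>{1..Mn n \<omega>::nat}. c n \<omega> j * indicator (Fs n \<omega> j) x)"
      and AE: "AE \<omega> in M. \<exists>N0. \<forall>n\<ge>N0. real (Mn n \<omega>) \<le> C * 2 powr (\<zeta> * real n)"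
      unfolding cell_type_def by blast
    obtain \<omega>0 where \<omega>0: "\<omega>0 \<in> space M" using ne by blast
    have C: "0 \<le> C"
    proof -
      have "0 \<le> C * 2 powr (\<tau> * real 0)" by (rule order_trans[OF c(1)[OF \<omega>0] c(2)[OF \<omega>0]])
      then show ?thesis by simp
    qed
    define U where "U = C * C + \<bar>C'\<bar> + 1"
    have U: "0 < U" "C * C \<le> U" "C' \<le> U"
    proof -
      have "0 < y + z + 1 \<and> y \<le> y + z + 1 \<and> C' \<le> y + z + 1" if "0 \<le> y" "0 \<le> z" "C' \<le> z" for y z :: real
        using that by linarith
      from this[of "C * C" "\<bar>C'\<bar>"] show "0 < U" "C * C \<le> U" "C' \<le> U" by (simp_all add: U_def)
    qed
    have bd: "\<bar>\<mu> n \<omega> x\<bar> \<le> U * 2 powr (\<alpha> * real n)" if "\<omega> \<in> space M" for n \<omega> x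
    proof -
      have "\<mu> n \<omega> x \<le> C' * 2 powr (\<alpha> * real n)" by (rule C'[OF that])
      also have "\<dots> \<le> U * 2 powr (\<alpha> * real n)" using U by (intro mult_right_mono) auto
      finally show ?thesis using \<mu>0[OF that] by simp
    qed
    have var: "set_variation \<F> (\<mu> n \<omega>) (C * 2 powr (\<tau> * real n) * real (Mn n \<omega>))" if "\<omega> \<in> space M" for n \<omega>
      unfolding \<mu>[OF that] by (rule set_variation_cells) (use Fs c that in auto)
    show thesis
    proof (rule that[of U \<theta>])
      show "0 < U" by (rule U)
      show "0 \<le> \<theta>" by (simp add: \<theta>_def)
      fix n \<omega> assume w: "\<omega> \<in> space M"
      have [measurable]: "Fs n \<omega> j \<in> sets borel" for j using F Fs[OF w] by blast
      show "\<mu> n \<omega> \<in> borel_measurable borel" unfolding \<mu>[OF w] by measurable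
      show "\<exists>R. set_variation \<F> (\<mu> n \<omega>) R" using var[OF w] by blast
      fix x show "\<bar>\<mu> n \<omega> x\<bar> \<le> U * 2 powr (\<alpha> * real n)" by (rule bd[OF w])
      also have "\<dots> \<le> U * 2 powr (\<theta> * real n)" using U by (intro mult_left_mono le\<theta>) (auto simp: \<theta>_def)
      finally show "\<bar>\<mu> n \<omega> x\<bar> \<le> U * 2 powr (\<theta> * real n)" .
    next
      show "AE \<omega> in M. \<exists>N0. \<forall>n\<ge>N0. set_variation \<F> (\<mu> n \<omega>) (U * 2 powr (\<theta> * real n))"
        using AE AE_space
      proof eventually_elim
        case (elim \<omega>)
        then obtain N0 where N0: "\<And>n. n \<ge> N0 \<Longrightarrow> real (Mn n \<omega>) \<le> C * 2 powr (\<zeta> * real n)" by blast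
        have "set_variation \<F> (\<mu> n \<omega>) (U * 2 powr (\<theta> * real n))" if "n \<ge> N0" for n
        proof (rule set_variation_mono[OF var[OF elim(2)]])
          have "C * 2 powr (\<tau> * real n) * real (Mn n \<omega>) \<le> C * 2 powr (\<tau> * real n) * (C * 2 powr (\<zeta> * real n))"
            using C N0[OF that] by (intro mult_left_mono) auto
          also have "\<dots> = C * C * 2 powr ((\<tau> + \<zeta>) * real n)" by (simp add: powr_add distrib_right)
          also have "\<dots> \<le> U * 2 powr (\<theta> * real n)" using U C by (intro mult_mono le\<theta>) (auto simp: \<theta>_def)
          finally show "C * 2 powr (\<tau> * real n) * real (Mn n \<omega>) \<le> U * 2 powr (\<theta> * real n)" .
        qed
        then show ?case by blast
      qed
    qed
  next
    assume "cutout_type M \<F> \<alpha> \<zeta> \<mu>"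
    then obtain \<Omega> C Mn \<Lambda> where \<Omega>: "\<Omega> \<in> \<F>" and \<Lambda>: "\<And>n \<omega> j. \<omega> \<in> space M \<Longrightarrow> \<Lambda> n \<omega> j \<in> \<F>"
      and \<mu>: "\<And>n \<omega>. \<omega> \<in> space M \<Longrightarrow> \<mu> n \<omega> = (\<lambda>x. 2 powr (\<alpha> * real n) * indicator (\<Omega> - (\<Union>j\<in>{1..Mn n \<omega>::nat}. \<Lambda> n \<omega> j)) x)"
      and AE: "AE \<omega> in M. \<exists>N0. \<forall>n\<ge>N0. real (Mn n \<omega>) \<le> C * 2 powr (\<zeta> * real n)"
      unfolding cutout_type_def by blast
    define U where "U = \<bar>C\<bar> + 1"
    have U: "1 \<le> U" by (simp add: U_def)
    have bd: "\<bar>\<mu> n \<omega> x\<bar> \<le> U * 2 powr (\<alpha> * real n)" if "\<omega> \<in> space M" for n \<omega> x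
    proof -
      have "\<bar>\<mu> n \<omega> x\<bar> \<le> 1 * 2 powr (\<alpha> * real n)" unfolding \<mu>[OF that] by (simp add: indicator_def)
      also have "\<dots> \<le> U * 2 powr (\<alpha> * real n)" using U by (intro mult_right_mono) auto
      finally show ?thesis .
    qed
    have var: "set_variation \<F> (\<mu> n \<omega>) (2 powr (\<alpha> * real n) * real (Suc (Mn n \<omega>)))" if "\<omega> \<in> space M" for n \<omega>
      unfolding \<mu>[OF that] by (rule set_variation_cutout) (use \<Omega> \<Lambda> that in auto)
    show thesis
    proof (rule that[of U \<theta>])
      show "0 < U" using U by simp
      show "0 \<le> \<theta>" by (simp add: \<theta>_def)
      fix n \<omega> assume w: "\<omega> \<in> space M"
      have [measurable]: "\<Lambda> n \<omega> j \<in> sets borel" "\<Omega> \<in> sets borel" for j using F \<Lambda>[OF w] \<Omega> by blast+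
      show "\<mu> n \<omega> \<in> borel_measurable borel" unfolding \<mu>[OF w] by measurable
      show "\<exists>R. set_variation \<F> (\<mu> n \<omega>) R" using var[OF w] by blast
      fix x show "\<bar>\<mu> n \<omega> x\<bar> \<le> U * 2 powr (\<alpha> * real n)" by (rule bd[OF w])
      also have "\<dots> \<le> U * 2 powr (\<theta> * real n)" using U by (intro mult_left_mono le\<theta>) (auto simp: \<theta>_def)
      finally show "\<bar>\<mu> n \<omega> x\<bar> \<le> U * 2 powr (\<theta> * real n)" .
    next
      show "AE \<omega> in M. \<exists>N0. \<forall>n\<ge>N0. set_variation \<F> (\<mu> n \<omega>) (U * 2 powr (\<theta> * real n))"
        using AE AE_space
      proof eventually_elim
        case (elim \<omega>)
        then obtain N0 where N0: "\<And>n. n \<ge> N0 \<Longrightarrow> real (Mn n \<omega>) \<le> C * 2 powr (\<zeta> * real n)" by blast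
        have "set_variation \<F> (\<mu> n \<omega>) (U * 2 powr (\<theta> * real n))" if "n \<ge> N0" for n
        proof (rule set_variation_mono[OF var[OF elim(2)]])
          have "real (Mn n \<omega>) \<le> C * 2 powr (\<zeta> * real n)" by (rule N0[OF that])
          also have "\<dots> \<le> \<bar>C\<bar> * 2 powr (\<bar>\<zeta>\<bar> * real n)"
            by (intro mult_mono) (auto intro!: mult_right_mono)
          finally have "real (Suc (Mn n \<omega>)) \<le> \<bar>C\<bar> * 2 powr (\<bar>\<zeta>\<bar> * real n) + 1 * 2 powr (\<bar>\<zeta>\<bar> * real n)"
            using ge_one_powr_ge_zero[of 2 "\<bar>\<zeta>\<bar> * real n"] by simp
          also have "\<dots> = U * 2 powr (\<bar>\<zeta>\<bar> * real n)" by (simp only: U_def distrib_right)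
          finally have "2 powr (\<alpha> * real n) * real (Suc (Mn n \<omega>)) \<le> 2 powr (\<alpha> * real n) * (U * 2 powr (\<bar>\<zeta>\<bar> * real n))"
            by (rule mult_left_mono) simp
          also have "\<dots> = U * 2 powr ((\<alpha> + \<bar>\<zeta>\<bar>) * real n)" by (simp add: powr_add distrib_right)
          also have "\<dots> \<le> U * 2 powr (\<theta> * real n)" using U by (intro mult_left_mono le\<theta>) (auto simp: \<theta>_def)
          finally show "2 powr (\<alpha> * real n) * real (Suc (Mn n \<omega>)) \<le> U * 2 powr (\<theta> * real n)" .
        qed
        then show ?case by blast
      qed
    qed
  qed
qed

text \<open>A boundary zone has at most the number of covering balls times the measure of one,
  \<delta>^(-\<gamma>1) \<delta>^s up to constants. A common bound for the attractors comes from one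
  fixed member and the diameter of the family.\<close>

lemma regular_ifs_familyI:
  fixes \<Gamma> :: "(('i::finite \<Rightarrow> 'a::euclidean_space \<Rightarrow> 'a) \<times> ('i \<Rightarrow> real)) set"
  assumes ne: "\<Gamma> \<noteq> {}"
    and prob: "\<And>t. t \<in> \<Gamma> \<Longrightarrow> prob_vector (snd t)"
    and bdd: "\<And>t u. t \<in> \<Gamma> \<Longrightarrow> u \<in> \<Gamma> \<Longrightarrow> ifs_dist t u \<le> R"
    and b: "0 < b" "b < 1"
    and sim: "\<And>t i. t \<in> \<Gamma> \<Longrightarrow> \<exists>r. 0 \<le> r \<and> r \<le> b \<and> (\<forall>x y. dist (fst t i x) (fst t i y) = r * dist x y)"
    and \<gamma>: "0 < \<gamma>1" "\<gamma>1 < s"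
    and ball: "\<And>x t r. t \<in> \<Gamma> \<Longrightarrow> 0 < r \<Longrightarrow> r < 1 \<Longrightarrow> measure (ss_measure t) (ball x r) \<le> c1 * r powr s"
    and cover: "\<And>\<epsilon> t \<Lambda>. 0 < \<epsilon> \<Longrightarrow> \<epsilon> < 1 \<Longrightarrow> t \<in> \<Gamma> \<Longrightarrow> \<Lambda> \<in> \<F> \<Longrightarrow>
       \<exists>X. finite X \<and> real (card X) \<le> c2 * \<epsilon> powr (- \<gamma>1) \<and> nbhd (frontier \<Lambda>) \<epsilon> \<inter> attractor (fst t) \<subseteq> (\<Union>x\<in>X. ball x \<epsilon>)"
  obtains D c where "regular_ifs_family \<Gamma> b D \<F> c s (s - \<gamma>1)"
proof -
  have contr: "contracting_ifs (fst t) b" if t: "t \<in> \<Gamma>" for t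
  proof
    fix i x y
    obtain r where "0 \<le> r" "r \<le> b" "dist (fst t i x) (fst t i y) = r * dist x y"
      using sim[OF t] by blast
    then show "dist (fst t i x) (fst t i y) \<le> b * dist x y" by (simp add: mult_right_mono)
  qed (use b in auto)
  have cb: "\<exists>D. \<forall>w. norm (coding_map (fst t) w) \<le> D" if "t \<in> \<Gamma>" for t
    using contracting_ifs.bounded_coding_map[OF contr[OF that]] unfolding bounded_iff by auto
  obtain t0 where t0: "t0 \<in> \<Gamma>" using ne by blast
  obtain D0 where D0: "\<And>w. norm (coding_map (fst t0) w) \<le> D0" using cb[OF t0] by blast
  define D where "D = D0 + R"
  have D: "norm (coding_map (fst t) w) \<le> D" if t: "t \<in> \<Gamma>" for t w
  proof -
    obtain D1 where D1: "\<And>w. norm (coding_map (fst t) w) \<le> D1" using cb[OF t] by blast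
    have "bdd_above (range (\<lambda>w. norm (coding_map (fst t) w - coding_map (fst t0) w)))"
    proof (rule bdd_aboveI2[of _ _ "D1 + D0"])
      fix w show "norm (coding_map (fst t) w - coding_map (fst t0) w) \<le> D1 + D0"
        using norm_triangle_ineq4 D1[of w] D0[of w] by (metis add_mono order_trans)
    qed
    then have "norm (coding_map (fst t) w - coding_map (fst t0) w) \<le> (SUP w. norm (coding_map (fst t) w - coding_map (fst t0) w))"
      by (intro cSUP_upper) auto
    \<comment> \<open>Any index shows that the probability part of \<open>ifs_dist\<close> is
      nonnegative, so \<open>R\<close> bounds the coding part by itself.\<close>
    moreover have "\<bar>snd t undefined - snd t0 undefined\<bar> \<le> Max (range (\<lambda>i. \<bar>snd t i - snd t0 i\<bar>))"
      by (intro Max_ge) auto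
    ultimately have "norm (coding_map (fst t) w - coding_map (fst t0) w) \<le> R"
      using bdd[OF t t0] abs_ge_zero[of "snd t undefined - snd t0 undefined"] unfolding ifs_dist_def by linarith
    then show ?thesis
      using D0[of w] norm_triangle_ineq2[of "coding_map (fst t) w" "coding_map (fst t0) w"] by (simp add: D_def)
  qed
  interpret fam: ifs_family \<Gamma> b D
    by unfold_locales (use b sim prob D in auto)
  \<comment> \<open>Absolute values guard against negative constants; the summand 1 gives
    \<open>1 \<le> c\<close>, which settles radii at least 1 by total mass.\<close>
  define c where "c = \<bar>c2\<bar> * \<bar>c1\<bar> + \<bar>c1\<bar> + 1"
  have c: "1 \<le> c" "c1 \<le> c" "\<bar>c2\<bar> * \<bar>c1\<bar> \<le> c" 
  proof -
    have "1 \<le> y + z + 1 \<and> c1 \<le> y + z + 1 \<and> y \<le> y + z + 1" if "0 \<le> y" "0 \<le> z" "c1 \<le> z" for y z :: real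
      using that by linarith
    from this[of "\<bar>c2\<bar> * \<bar>c1\<bar>" "\<bar>c1\<bar>"] show "1 \<le> c" "c1 \<le> c" "\<bar>c2\<bar> * \<bar>c1\<bar> \<le> c"
      by (simp_all add: c_def)
  qed
  note ss = contracting_ifs.ss_measure_simps[OF contr prob, of t t for t, simplified]
  have big: "measure (ss_measure t) A \<le> c * r powr p" if "t \<in> \<Gamma>" "1 \<le> r" "0 \<le> p" for t A r p
  proof -
    interpret ps: prob_space "ss_measure t" using ss(1)[OF that(1) that(1)] .
    have "measure (ss_measure t) A \<le> 1 * 1" by simp
    also have "\<dots> \<le> c * r powr p" using c ge_one_powr_ge_zero[OF that(2,3)] by (intro mult_mono) auto
    finally show ?thesis .
  qed
  show thesis
  proof (rule that)
    show "regular_ifs_family \<Gamma> b D \<F> c s (s - \<gamma>1)"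
    proof unfold_locales
      show "0 \<le> D" using D[OF t0] norm_ge_zero order_trans by blast
      show "0 < c" "0 < s" "0 < s - \<gamma>1" using c \<gamma> by auto
      fix t and x :: 'a and r :: real assume t: "t \<in> \<Gamma>" and r: "0 < r"
      show "measure (ss_measure t) (ball x r) \<le> c * r powr s"
      proof (cases "r < 1")
        case True
        have "measure (ss_measure t) (ball x r) \<le> c1 * r powr s" by (rule ball[OF t r True])
        also have "\<dots> \<le> c * r powr s" using c by (intro mult_right_mono) auto
        finally show ?thesis .
      qed (use big[OF t] \<gamma> in auto)
    next
      fix t \<Lambda> and \<delta> :: real assume t: "t \<in> \<Gamma>" and L: "\<Lambda> \<in> \<F>" and d: "0 < \<delta>"
      show "measure (ss_measure t) (nbhd (frontier \<Lambda>) \<delta>) \<le> c * \<delta> powr (s - \<gamma>1)"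
      proof (cases "\<delta> < 1")
        case True
        interpret P: prob_space "bernoulli_measure (snd t)" by (rule prob_space_bernoulli[OF prob[OF t]])
        interpret S: prob_space "ss_measure t" using ss(1)[OF t t] .
        interpret t: contracting_ifs "fst t" b by (rule contr[OF t])
        obtain X where X: "finite X" "real (card X) \<le> c2 * \<delta> powr (- \<gamma>1)"
            "nbhd (frontier \<Lambda>) \<delta> \<inter> attractor (fst t) \<subseteq> (\<Union>x\<in>X. ball x \<delta>)"
          using cover[OF d True t L] by blast
        let ?O = "\<Union>x\<in>X. ball x \<delta>"
        have O: "open ?O" by auto
        have "coding_map (fst t) -` ?O \<inter> space (bernoulli_measure (snd t)) \<in> sets (bernoulli_measure (snd t))"
          by (intro measurable_sets[OF t.measurable_coding_map] borel_open O)
        then have m: "{w. coding_map (fst t) w \<in> ?O} \<in> sets (bernoulli_measure (snd t))" by (simp add: vimage_def)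
        have "measure (ss_measure t) (nbhd (frontier \<Lambda>) \<delta>)
            = measure (bernoulli_measure (snd t)) {w. coding_map (fst t) w \<in> nbhd (frontier \<Lambda>) \<delta>}"
          by (rule ss(3)[OF t t borel_open[OF open_nbhd]])
        also have "\<dots> \<le> measure (bernoulli_measure (snd t)) {w. coding_map (fst t) w \<in> ?O}"
        proof (rule P.finite_measure_mono[OF _ m])
          \<comment> \<open>The coding map takes values in the attractor, so covering the part
            inside the attractor suffices.\<close>
          show "{w. coding_map (fst t) w \<in> nbhd (frontier \<Lambda>) \<delta>} \<subseteq> {w. coding_map (fst t) w \<in> ?O}"
            using X(3) unfolding attractor_def by blast
        qed
        also have "\<dots> = measure (ss_measure t) ?O"
          by (rule ss(3)[OF t t borel_open[OF O], symmetric])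
        also have "\<dots> \<le> (\<Sum>x\<in>X. measure (ss_measure t) (ball x \<delta>))"
          by (rule S.finite_measure_subadditive_finite[OF X(1)]) (simp add: image_subset_iff ss(2)[OF t t])
        also have "\<dots> \<le> of_nat (card X) * (\<bar>c1\<bar> * \<delta> powr s)"
        proof (rule sum_bounded_above)
          fix x
          have "measure (ss_measure t) (ball x \<delta>) \<le> c1 * \<delta> powr s" by (rule ball[OF t d True])
          also have "\<dots> \<le> \<bar>c1\<bar> * \<delta> powr s" by (intro mult_right_mono) auto
          finally show "measure (ss_measure t) (ball x \<delta>) \<le> \<bar>c1\<bar> * \<delta> powr s" .
        qed
        also have "\<dots> \<le> (\<bar>c2\<bar> * \<delta> powr (- \<gamma>1)) * (\<bar>c1\<bar> * \<delta> powr s)"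
        proof (rule mult_right_mono)
          have "c2 * \<delta> powr (- \<gamma>1) \<le> \<bar>c2\<bar> * \<delta> powr (- \<gamma>1)" by (intro mult_right_mono) auto
          with X(2) show "real (card X) \<le> \<bar>c2\<bar> * \<delta> powr (- \<gamma>1)" by linarith
        qed auto
        also have "\<dots> = \<bar>c2\<bar> * \<bar>c1\<bar> * \<delta> powr (s - \<gamma>1)" using d by (simp add: powr_diff powr_minus field_simps)
        also have "\<dots> \<le> c * \<delta> powr (s - \<gamma>1)" using c by (intro mult_right_mono) auto
        finally show ?thesis .
      qed (use big[OF t] \<gamma> in auto)
    qed
  qed
qed

section \<open>Limits of fields with geometrically decaying increments\<close>

text \<open>In the variable x = 2^n the term is smaller than every power of x, in particular O(1/x),
  and 1/2^n is summable.\<close>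

lemma summable_powr_times_exp:
  fixes \<kappa> \<delta> B C :: real
  assumes "0 < \<delta>" "0 < B"
  shows "summable (\<lambda>n. C * 2 powr (\<kappa> * real n) * exp (- (2 powr (\<delta> * real n)) / B))"
proof (rule summable_comparison_test_bigo)
  show "summable (\<lambda>n. norm (1 / 2 ^ n :: real))"
    using summable_geometric[of "1/2 :: real"] by (simp add: power_divide)
  have "(\<lambda>x. C * x powr \<kappa> * exp (- (x powr \<delta>) / B)) \<in> O[at_top](\<lambda>x::real. 1 / x)"
    using assms by real_asymp
  then have "(\<lambda>n. C * (2 ^ n) powr \<kappa> * exp (- ((2 ^ n) powr \<delta>) / B)) \<in> O(\<lambda>n. 1 / 2 ^ n)"
    by (rule landau_o.big.compose) real_asymp
  then show "(\<lambda>n. C * 2 powr (\<kappa> * real n) * exp (- (2 powr (\<delta> * real n)) / B)) \<in> O(\<lambda>n. 1 / 2 ^ n)"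
    by (simp add: powr_realpow[symmetric] powr_powr mult.commute)
qed

text \<open>With \<gamma> > 0 the power is continuous up to base 0, so bounds with a slack
  \<open>e\<close> survive the limit even at distance 0.\<close>

lemma tendsto_powr_affine:
  fixes a c \<gamma> :: real
  assumes "0 \<le> a" "0 \<le> c" "0 < \<gamma>"
  shows "((\<lambda>e. (a + c * e) powr \<gamma>) \<longlongrightarrow> a powr \<gamma>) (at_right 0)"
proof (rule tendsto_powr2)
  show "((\<lambda>e. a + c * e) \<longlongrightarrow> a) (at_right 0)" by (auto intro!: tendsto_eq_intros)
  show "\<forall>\<^sub>F e in at_right 0. 0 \<le> a + c * e"
    using eventually_at_right_less[of "0::real"] by eventually_elim (use assms in auto)
qed (use assms in auto)

text \<open>A discrete Gronwall argument: each step multiplies \<open>max 1 (y n t)\<close> by at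
  most \<open>1 + A * q ^ n\<close>, and the product of these factors is at most
  \<open>exp (A / (1 - q))\<close>. Once \<open>max 1 (y n t)\<close> is bounded, the increments are
  geometric in absolute terms, uniformly on \<open>T\<close>.\<close>

lemma uniform_limit_geometric_increments:
  fixes y :: "nat \<Rightarrow> 't \<Rightarrow> real"
  assumes q: "0 < q" "q < 1" and A: "0 \<le> A"
    and inc: "\<And>n t. N \<le> n \<Longrightarrow> t \<in> T \<Longrightarrow> \<bar>y (Suc n) t - y n t\<bar> \<le> A * q ^ n * max 1 (y n t)"
    and U: "\<And>t. t \<in> T \<Longrightarrow> y N t \<le> U"
  obtains H where "0 \<le> H" "uniform_limit T y (\<lambda>t. lim (\<lambda>n. y n t)) sequentially"
    "\<And>n t. N \<le> n \<Longrightarrow> t \<in> T \<Longrightarrow> \<bar>lim (\<lambda>n. y n t) - y n t\<bar> \<le> H * q ^ n"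
proof -
  define E where "E = max 1 U * exp (A / (1 - q))"
  define H where "H = A * E / (1 - q)"
  have E: "0 \<le> E" by (simp add: E_def)
  have H: "0 \<le> H" using A E q by (simp add: H_def)
  \<comment> \<open>The exponent is the partial geometric sum, so that one more factor closes the
    induction exactly.\<close>
  have bound: "max 1 (y n t) \<le> max 1 U * exp (A * (1 - q ^ n) / (1 - q))" if n: "N \<le> n" and t: "t \<in> T" for n t
    using n
  proof (induction n rule: dec_induct)
    case base
    have "max 1 (y N t) \<le> max 1 U * 1" using U[OF t] by auto
    also have "\<dots> \<le> max 1 U * exp (A * (1 - q ^ N) / (1 - q))"
      using A q power_le_one[of q N] by (intro mult_left_mono) auto
    finally show ?case .
  next
    case (step n)
    have "max 1 (y (Suc n) t) \<le> max 1 (y n t) + A * q ^ n * max 1 (y n t)"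
      using inc[OF step(1) t] by linarith
    also have "\<dots> = max 1 (y n t) * (1 + A * q ^ n)" by (simp add: algebra_simps)
    also have "\<dots> \<le> max 1 U * exp (A * (1 - q ^ n) / (1 - q)) * exp (A * q ^ n)"
      using step.IH A q by (intro mult_mono exp_ge_add_one_self) auto
    also have "\<dots> = max 1 U * exp (A * (1 - q ^ n) / (1 - q) + A * q ^ n)" by (simp add: exp_add)
    also have "A * (1 - q ^ n) / (1 - q) + A * q ^ n = A * (1 - q ^ Suc n) / (1 - q)"
      using q by (simp add: field_simps)
    finally show ?case .
  qed
  have incr: "\<bar>y (Suc n) t - y n t\<bar> \<le> H * (q ^ n - q ^ Suc n)" if n: "N \<le> n" and t: "t \<in> T" for n t
  proof -
    have "A * (1 - q ^ n) / (1 - q) \<le> A / (1 - q)"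
      using A q by (intro divide_right_mono) (auto intro!: mult_left_le)
    then have "max 1 U * exp (A * (1 - q ^ n) / (1 - q)) \<le> E" unfolding E_def by (intro mult_left_mono) auto
    with bound[OF n t] have "max 1 (y n t) \<le> E" by linarith
    then have "A * q ^ n * max 1 (y n t) \<le> A * q ^ n * E" using A q by (intro mult_left_mono) auto
    also have "\<dots> = H * (q ^ n - q ^ Suc n)" using q by (simp add: H_def field_simps)
    finally show ?thesis using inc[OF n t] by linarith
  qed
  have tele: "\<bar>y m t - y n t\<bar> \<le> H * (q ^ n - q ^ m)" if n: "N \<le> n" and m: "n \<le> m" and t: "t \<in> T" for n m t
    using m
  proof (induction m rule: dec_induct)
    case (step m)
    have "\<bar>y (Suc m) t - y n t\<bar> \<le> \<bar>y (Suc m) t - y m t\<bar> + \<bar>y m t - y n t\<bar>" by linarith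
    also have "\<dots> \<le> H * (q ^ m - q ^ Suc m) + H * (q ^ n - q ^ m)" using step n incr[OF _ t, of m] by simp
    finally show ?case by (simp add: algebra_simps)
  qed simp
  have tele': "\<bar>y m t - y n t\<bar> \<le> H * q ^ n" if "N \<le> n" "n \<le> m" "t \<in> T" for n m t
  proof -
    have "0 \<le> H * q ^ m" using H q by simp
    with tele[OF that] show ?thesis by (simp add: right_diff_distrib)
  qed
  have q0: "(\<lambda>n. H * q ^ n) \<longlonglongrightarrow> 0" using q by (intro tendsto_mult_right_zero LIMSEQ_power_zero) auto
  have conv: "convergent (\<lambda>n. y n t)" if t: "t \<in> T" for t
  proof (rule Cauchy_convergent, rule CauchyI')
    fix e :: real assume "0 < e"
    then have "eventually (\<lambda>n. H * q ^ n < e) sequentially" using q0 by (simp add: order_tendstoD(2))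
    then obtain n0 where n0: "\<And>n. n \<ge> n0 \<Longrightarrow> H * q ^ n < e" by (auto simp: eventually_sequentially)
    show "\<exists>M. \<forall>m\<ge>M. \<forall>n>m. dist (y m t) (y n t) < e"
    proof (intro exI allI impI)
      fix m n assume "max N n0 \<le> m" "m < n"
      then show "dist (y m t) (y n t) < e"
        using tele'[of m n t] n0[of m] t by (simp add: dist_real_def abs_minus_commute)
    qed
  qed
  have lim: "\<bar>lim (\<lambda>n. y n t) - y n t\<bar> \<le> H * q ^ n" if n: "N \<le> n" and t: "t \<in> T" for n t
  proof (rule LIMSEQ_le_const2)
    show "(\<lambda>m. \<bar>y m t - y n t\<bar>) \<longlonglongrightarrow> \<bar>lim (\<lambda>n. y n t) - y n t\<bar>"
      using conv[OF t] by (intro tendsto_intros) (simp add: convergent_LIMSEQ_iff)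
    show "\<exists>M. \<forall>m\<ge>M. \<bar>y m t - y n t\<bar> \<le> H * q ^ n" using tele'[OF n _ t] by blast
  qed
  have "uniform_limit T y (\<lambda>t. lim (\<lambda>n. y n t)) sequentially"
  proof (rule uniform_limitI)
    fix e :: real assume "0 < e"
    then have "eventually (\<lambda>n. H * q ^ n < e) sequentially" using q0 by (simp add: order_tendstoD(2))
    with eventually_ge_at_top[of N]
    show "\<forall>\<^sub>F n in sequentially. \<forall>t\<in>T. dist (y n t) (lim (\<lambda>n. y n t)) < e"
    proof eventually_elim
      case (elim n)
      then show ?case using lim by (fastforce simp: dist_real_def abs_minus_commute)
    qed
  qed
  with H lim show thesis using that by blast
qed

text \<open>The exponent is fixed before the constants, since those are random in the application.\<close>

lemma holder_limit:
  fixes \<rho> \<theta> h :: real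
  assumes "0 < \<rho>" "0 \<le> \<theta>" "0 < h"
  obtains \<gamma> where "0 < \<gamma>"
    "\<And>(y :: nat \<Rightarrow> 't \<Rightarrow> real) Y T d H G N. 0 \<le> H \<Longrightarrow> 0 \<le> G \<Longrightarrow>
      (\<And>n t. N \<le> n \<Longrightarrow> t \<in> T \<Longrightarrow> \<bar>Y t - y n t\<bar> \<le> H * (2 powr - \<rho>) ^ n) \<Longrightarrow>
      (\<And>n t. t \<in> T \<Longrightarrow> \<bar>y n t\<bar> \<le> G * 2 powr (\<theta> * real n)) \<Longrightarrow>
      (\<And>n t u e. N \<le> n \<Longrightarrow> t \<in> T \<Longrightarrow> u \<in> T \<Longrightarrow> 0 < e \<Longrightarrow> d t u \<le> e \<Longrightarrow> \<bar>y n t - y n u\<bar> \<le> G * 2 powr (\<theta> * real n) * e powr h) \<Longrightarrow>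
      (\<And>t u. t \<in> T \<Longrightarrow> u \<in> T \<Longrightarrow> 0 \<le> d t u) \<Longrightarrow>
      \<exists>K. \<forall>t\<in>T. \<forall>u\<in>T. \<bar>Y t - Y u\<bar> \<le> K * d t u powr \<gamma>"
proof -
  \<comment> \<open>At level \<sigma> log2(1/e) the growth 2^(\<theta>n) is at most e^(-h/2), so
    half of the exponent \<open>h\<close> survives, while the distance to the limit is of order
    e^(\<sigma>\<rho>); \<gamma> is the worse of the two. The 1 avoids division by 0 when \<theta> =
    0.\<close>
  define \<sigma> where "\<sigma> = h / (2 * (\<theta> + 1))"
  define \<gamma> where "\<gamma> = min (h / 2) (\<sigma> * \<rho>)"
  have \<sigma>: "0 < \<sigma>" using assms by (simp add: \<sigma>_def)
  have \<sigma>\<theta>: "\<sigma> * \<theta> \<le> h / 2" using assms by (simp add: \<sigma>_def field_simps)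
  have \<gamma>: "0 < \<gamma>" using assms \<sigma> by (simp add: \<gamma>_def)
  show thesis
  proof (rule that[OF \<gamma>])
    fix y :: "nat \<Rightarrow> 't \<Rightarrow> real" and Y T and d :: "'t \<Rightarrow> 't \<Rightarrow> real" and H G :: real and N :: nat
    assume H: "0 \<le> H" and G: "0 \<le> G"
      and Y: "\<And>n t. N \<le> n \<Longrightarrow> t \<in> T \<Longrightarrow> \<bar>Y t - y n t\<bar> \<le> H * (2 powr - \<rho>) ^ n"
      and bd: "\<And>n t. t \<in> T \<Longrightarrow> \<bar>y n t\<bar> \<le> G * 2 powr (\<theta> * real n)"
      and hol: "\<And>n t u e. N \<le> n \<Longrightarrow> t \<in> T \<Longrightarrow> u \<in> T \<Longrightarrow> 0 < e \<Longrightarrow> d t u \<le> e \<Longrightarrow> \<bar>y n t - y n u\<bar> \<le> G * 2 powr (\<theta> * real n) * e powr h"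
      and d: "\<And>t u. t \<in> T \<Longrightarrow> u \<in> T \<Longrightarrow> 0 \<le> d t u"
    define q where "q = 2 powr - \<rho>"
    have q: "0 < q" "q < 1" using assms powr_less_mono[of "-\<rho>" 0 2] by (auto simp: q_def)
    have qn: "q ^ n = 2 powr (- \<rho> * real n)" for n by (simp add: q_def powr_power mult.commute)
    define K where "K = 2 * H * 2 powr \<rho> + 2 * G * 2 powr (\<theta> * real N)"
    have small: "\<bar>Y t - Y u\<bar> \<le> K * e powr \<gamma>" if t: "t \<in> T" and u: "u \<in> T" and e: "0 < e" "e < 1" and de: "d t u \<le> e" for t u e
    proof -
      \<comment> \<open>Rounding the level down costs the factor \<open>2 powr \<rho>\<close> in
        \<open>K\<close>; starting the levels at \<open>N\<close> costs
        \<open>2 powr (\<theta> * real N)\<close>.\<close>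
      define k where "k = nat \<lfloor>\<sigma> * log 2 (1 / e)\<rfloor>"
      have l0: "0 \<le> \<sigma> * log 2 (1 / e)" using e \<sigma> by simp
      have k: "real k \<le> \<sigma> * log 2 (1 / e)" "\<sigma> * log 2 (1 / e) \<le> real k + 1"
        unfolding k_def using l0 by linarith+
      have pe: "2 powr (p * log 2 (1 / e)) = e powr (- p)" for p
        using e by (simp add: powr_def log_def ln_div)
      have "\<bar>Y t - Y u\<bar> \<le> \<bar>Y t - y (N + k) t\<bar> + \<bar>y (N + k) t - y (N + k) u\<bar> + \<bar>Y u - y (N + k) u\<bar>" by linarith
      also have "\<dots> \<le> H * q ^ (N + k) + G * 2 powr (\<theta> * real (N + k)) * e powr h + H * q ^ (N + k)"
        unfolding q_def by (intro add_mono Y hol t u e de) auto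
      also have "\<dots> = 2 * H * q ^ (N + k) + G * 2 powr (\<theta> * real (N + k)) * e powr h" by simp
      also have "\<dots> \<le> 2 * H * (2 powr \<rho> * e powr \<gamma>) + G * (2 powr (\<theta> * real N) * e powr \<gamma>)"
      proof (intro add_mono mult_left_mono)
        have "q ^ (N + k) \<le> q ^ k" using q by (intro power_decreasing) auto
        also have "\<dots> = 2 powr \<rho> * 2 powr (- \<rho> * (real k + 1))"
          unfolding qn powr_add[symmetric] by (simp add: algebra_simps)
        also have "\<dots> \<le> 2 powr \<rho> * 2 powr (- \<rho> * (\<sigma> * log 2 (1 / e)))"
          using k(2) assms by (intro mult_left_mono powr_mono mult_left_mono_neg[of _ _ "- \<rho>"]) auto
        also have "2 powr (- \<rho> * (\<sigma> * log 2 (1 / e))) = e powr (\<sigma> * \<rho>)"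
          using pe[of "- \<rho> * \<sigma>"] by (simp add: mult_ac)
        also have "2 powr \<rho> * e powr (\<sigma> * \<rho>) \<le> 2 powr \<rho> * e powr \<gamma>"
          using e by (intro mult_left_mono powr_mono') (auto simp: \<gamma>_def)
        finally show "q ^ (N + k) \<le> 2 powr \<rho> * e powr \<gamma>" .
        have "2 powr (\<theta> * real k) \<le> 2 powr (\<theta> * (\<sigma> * log 2 (1 / e)))"
          using k assms by (intro powr_mono mult_left_mono) auto
        also have "\<dots> = e powr (- (\<sigma> * \<theta>))" using pe[of "\<sigma> * \<theta>"] by (simp add: mult_ac)
        finally have "2 powr (\<theta> * real k) * e powr h \<le> e powr (- (\<sigma> * \<theta>)) * e powr h" by (intro mult_right_mono) auto
        also have "\<dots> = e powr (h - \<sigma> * \<theta>)" by (simp add: powr_add[symmetric])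
        also have "\<dots> \<le> e powr \<gamma>" using e \<sigma>\<theta> by (intro powr_mono') (auto simp: \<gamma>_def)
        finally have "2 powr (\<theta> * real N) * (2 powr (\<theta> * real k) * e powr h) \<le> 2 powr (\<theta> * real N) * e powr \<gamma>"
          by (intro mult_left_mono) auto
        then have "G * (2 powr (\<theta> * real N) * (2 powr (\<theta> * real k) * e powr h)) \<le> G * (2 powr (\<theta> * real N) * e powr \<gamma>)"
          using G by (intro mult_left_mono) auto
        then show "G * 2 powr (\<theta> * real (N + k)) * e powr h \<le> G * (2 powr (\<theta> * real N) * e powr \<gamma>)"
          by (simp add: powr_add distrib_left mult_ac)
      qed (use H in auto)
      also have "\<dots> \<le> K * e powr \<gamma>" unfolding K_def using G by (simp add: algebra_simps)
      finally show ?thesis .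
    qed
    have "\<bar>Y t - Y u\<bar> \<le> K * d t u powr \<gamma>" if t: "t \<in> T" and u: "u \<in> T" for t u
    proof -
      consider (zero) "d t u = 0" | (small) "0 < d t u" "d t u < 1" | (large) "1 \<le> d t u" using d[OF t u] by linarith
      then show ?thesis
      proof cases
        case zero
        \<comment> \<open>Distance 0 need not mean \<open>t = u\<close>, so the estimate for
          positive \<open>e\<close> is used with \<open>e\<close> tending to 0.\<close>
        have "((\<lambda>e. K * e powr \<gamma>) \<longlongrightarrow> K * 0 powr \<gamma>) (at_right 0)"
          using tendsto_powr_affine[of 0 1 \<gamma>] \<gamma> by (intro tendsto_mult tendsto_const) simp
        moreover have "\<forall>\<^sub>F e in at_right 0. \<bar>Y t - Y u\<bar> \<le> K * e powr \<gamma>"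
          using eventually_at_right_less[of "0::real"] eventually_at_right_real[OF zero_less_one[where 'a = real]]
          by (eventually_elim) (use small[OF t u] zero in auto)
        ultimately have "\<bar>Y t - Y u\<bar> \<le> K * 0 powr \<gamma>"
          by (intro tendsto_lowerbound[of "\<lambda>e. K * e powr \<gamma>"]) auto
        then show ?thesis using zero by simp
      next
        case large
        have "\<bar>Y t - Y u\<bar> \<le> \<bar>Y t - y N t\<bar> + \<bar>y N t\<bar> + \<bar>y N u\<bar> + \<bar>Y u - y N u\<bar>" by linarith
        also have "\<dots> \<le> H * q ^ N + G * 2 powr (\<theta> * real N) + G * 2 powr (\<theta> * real N) + H * q ^ N"
          unfolding q_def by (intro add_mono Y bd t u) auto
        also have "\<dots> \<le> K"
        proof -
          have "q ^ N \<le> 1" using q by (intro power_le_one) auto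
          also have "1 \<le> 2 powr \<rho>" using assms by (simp add: ge_one_powr_ge_zero)
          finally have "H * q ^ N \<le> H * 2 powr \<rho>" using H by (intro mult_left_mono)
          then show ?thesis unfolding K_def by linarith
        qed
        also have "K = K * 1" by simp
        also have "\<dots> \<le> K * d t u powr \<gamma>"
          using large \<gamma> H G by (intro mult_left_mono ge_one_powr_ge_zero) (auto simp: K_def)
        finally show ?thesis .
      qed (use small[OF t u] in auto)
    qed
    then show "\<exists>K. \<forall>t\<in>T. \<forall>u\<in>T. \<bar>Y t - Y u\<bar> \<le> K * d t u powr \<gamma>" by blast
  qed
qed

text \<open>The constants \<open>K0\<close> need not depend measurably on \<open>\<omega>\<close>, but the least admissible constant
  over a countable dense set does.\<close>

lemma measurable_holder_constant:
  fixes Y :: "'b \<Rightarrow> 't \<Rightarrow> real" and d :: "'t \<Rightarrow> 't \<Rightarrow> real"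
  assumes S: "countable S" "S \<subseteq> T" and dense: "\<And>t e. t \<in> T \<Longrightarrow> 0 < e \<Longrightarrow> \<exists>u\<in>S. d t u \<le> e"
    and d: "\<And>t u. t \<in> T \<Longrightarrow> u \<in> T \<Longrightarrow> 0 \<le> d t u" "\<And>t u. t \<in> T \<Longrightarrow> u \<in> T \<Longrightarrow> d t u = d u t"
      "\<And>t u v. t \<in> T \<Longrightarrow> u \<in> T \<Longrightarrow> v \<in> T \<Longrightarrow> d t v \<le> d t u + d u v"
    and \<gamma>: "0 < \<gamma>" and meas: "\<And>t. t \<in> S \<Longrightarrow> (\<lambda>\<omega>. Y \<omega> t) \<in> borel_measurable M"
  obtains K where "K \<in> borel_measurable M"
    "\<And>\<omega> K0 t u. (\<And>t u. t \<in> T \<Longrightarrow> u \<in> T \<Longrightarrow> \<bar>Y \<omega> t - Y \<omega> u\<bar> \<le> K0 * d t u powr \<gamma>) \<Longrightarrow> t \<in> T \<Longrightarrow> u \<in> T \<Longrightarrow>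
       \<bar>Y \<omega> t - Y \<omega> u\<bar> \<le> K \<omega> * d t u powr \<gamma>"
proof -
  \<comment> \<open>Pairs at distance 0 contribute 0 by division by zero; there the bound with
    \<open>K0\<close> already forces equal values of \<open>Y\<close>.\<close>
  define f where "f = (\<lambda>\<omega> (t, u). \<bar>Y \<omega> t - Y \<omega> u\<bar> / d t u powr \<gamma>)"
  \<comment> \<open>An infinite supremum would become 0, but a bound with some \<open>K0\<close>
    makes it finite, and the claim concerns only such \<open>\<omega>\<close>.\<close>
  define K where "K = (\<lambda>\<omega>. real_of_ereal (SUP x\<in>S \<times> S. ereal (f \<omega> x)))"
  show thesis
  proof (rule that)
    have "(\<lambda>\<omega>. SUP x\<in>S \<times> S. ereal (f \<omega> x)) \<in> borel_measurable M"
      using S(1) meas by (intro borel_measurable_SUP) (auto simp: f_def)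
    then show "K \<in> borel_measurable M" unfolding K_def by measurable
    fix \<omega> K0 t u
    assume K0: "\<And>t u. t \<in> T \<Longrightarrow> u \<in> T \<Longrightarrow> \<bar>Y \<omega> t - Y \<omega> u\<bar> \<le> K0 * d t u powr \<gamma>" and t: "t \<in> T" and u: "u \<in> T"
    have onS: "\<bar>Y \<omega> t - Y \<omega> u\<bar> \<le> K \<omega> * d t u powr \<gamma>" if t: "t \<in> S" and u: "u \<in> S" for t u
    proof (cases "d t u = 0")
      case True
      then show ?thesis using K0[of t u] S t u by auto
    next
      case False
      then have d0: "0 < d t u powr \<gamma>" by simp
      have bd: "f \<omega> x \<le> \<bar>K0\<bar>" if "x \<in> S \<times> S" for x
      proof -
        obtain v w where x: "x = (v, w)" "v \<in> T" "w \<in> T" using \<open>x \<in> S \<times> S\<close> S by auto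
        have "\<bar>Y \<omega> v - Y \<omega> w\<bar> \<le> K0 * d v w powr \<gamma>" using K0 x by simp
        also have "\<dots> \<le> \<bar>K0\<bar> * d v w powr \<gamma>" by (intro mult_right_mono) auto
        finally have le: "\<bar>Y \<omega> v - Y \<omega> w\<bar> \<le> \<bar>K0\<bar> * d v w powr \<gamma>" .
        show ?thesis
        proof (cases "d v w = 0")
          case False
          then show ?thesis using le by (simp add: f_def x pos_divide_le_eq)
        qed (simp add: f_def x)
      qed
      let ?s = "SUP x\<in>S \<times> S. ereal (f \<omega> x)"
      have le: "ereal (f \<omega> (t, u)) \<le> ?s" using t u by (intro SUP_upper) auto
      have "?s \<le> ereal \<bar>K0\<bar>" using bd by (intro SUP_least) auto
      with le have "\<bar>?s\<bar> \<noteq> \<infinity>" by auto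
      then have "ereal (K \<omega>) = ?s" unfolding K_def by (simp add: ereal_real)
      with le have "f \<omega> (t, u) \<le> K \<omega>" by (metis ereal_less_eq(3))
      then show ?thesis using d0 by (simp add: f_def pos_divide_le_eq)
    qed
    have "0 \<le> K \<omega>"
    proof -
      obtain v where v: "v \<in> S" using dense[OF t zero_less_one] by blast
      have "ereal 0 \<le> ereal (f \<omega> (v, v))" by (simp add: f_def)
      also have "\<dots> \<le> (SUP x\<in>S \<times> S. ereal (f \<omega> x))" using v by (intro SUP_upper) auto
      finally show ?thesis unfolding K_def by (simp add: real_of_ereal_pos zero_ereal_def)
    qed
    \<comment> \<open>\<open>K0\<close> only weights the distance to points of \<open>S\<close>, so
      it disappears as \<open>e\<close> tends to 0.\<close>
    have approx: "\<bar>Y \<omega> t - Y \<omega> u\<bar> \<le> 2 * \<bar>K0\<bar> * e powr \<gamma> + K \<omega> * (d t u + 2 * e) powr \<gamma>" if e: "0 < e" for e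
    proof -
      obtain t' u' where t': "t' \<in> S" "d t t' \<le> e" and u': "u' \<in> S" "d u u' \<le> e"
        using dense[OF t e] dense[OF u e] by blast
      have near: "\<bar>Y \<omega> v - Y \<omega> v'\<bar> \<le> \<bar>K0\<bar> * e powr \<gamma>" if "v \<in> T" "v' \<in> T" "d v v' \<le> e" for v v'
      proof -
        have "\<bar>Y \<omega> v - Y \<omega> v'\<bar> \<le> K0 * d v v' powr \<gamma>" using K0 that by simp
        also have "\<dots> \<le> \<bar>K0\<bar> * e powr \<gamma>"
          using that d(1) \<gamma> by (intro mult_mono powr_mono2) auto
        finally show ?thesis .
      qed
      have "d t' u' \<le> d t t' + d t u + d u u'"
      proof -
        have "t' \<in> T" "u' \<in> T" using t' u' S by auto
        then show ?thesis using d(3)[of t' t u'] d(3)[of t u u'] d(2)[of t' t] t u by linarith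
      qed
      then have "d t' u' powr \<gamma> \<le> (d t u + 2 * e) powr \<gamma>"
        using t' u' S d(1) \<gamma> by (intro powr_mono2) auto
      then have "K \<omega> * d t' u' powr \<gamma> \<le> K \<omega> * (d t u + 2 * e) powr \<gamma>" using \<open>0 \<le> K \<omega>\<close> by (intro mult_left_mono)
      moreover have "\<bar>Y \<omega> t' - Y \<omega> u'\<bar> \<le> K \<omega> * d t' u' powr \<gamma>" using onS t' u' by blast
      moreover have "\<bar>Y \<omega> t - Y \<omega> t'\<bar> \<le> \<bar>K0\<bar> * e powr \<gamma>" "\<bar>Y \<omega> u - Y \<omega> u'\<bar> \<le> \<bar>K0\<bar> * e powr \<gamma>"
        using near t u t' u' S by auto
      ultimately show ?thesis by linarith
    qed
    have "((\<lambda>e. 2 * \<bar>K0\<bar> * e powr \<gamma> + K \<omega> * (d t u + 2 * e) powr \<gamma>) \<longlongrightarrow> 2 * \<bar>K0\<bar> * 0 powr \<gamma> + K \<omega> * d t u powr \<gamma>) (at_right 0)"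
      using tendsto_powr_affine[of 0 1 \<gamma>] tendsto_powr_affine[of "d t u" 2 \<gamma>] \<gamma> d(1)[OF t u]
      by (intro tendsto_add tendsto_mult tendsto_const) simp_all
    moreover have "\<forall>\<^sub>F e in at_right 0. \<bar>Y \<omega> t - Y \<omega> u\<bar> \<le> 2 * \<bar>K0\<bar> * e powr \<gamma> + K \<omega> * (d t u + 2 * e) powr \<gamma>"
      using eventually_at_right_less[of "0::real"] by eventually_elim (rule approx)
    ultimately have "\<bar>Y \<omega> t - Y \<omega> u\<bar> \<le> 2 * \<bar>K0\<bar> * 0 powr \<gamma> + K \<omega> * d t u powr \<gamma>"
      by (intro tendsto_lowerbound[of "\<lambda>e. 2 * \<bar>K0\<bar> * e powr \<gamma> + K \<omega> * (d t u + 2 * e) powr \<gamma>"]) auto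
    then show "\<bar>Y \<omega> t - Y \<omega> u\<bar> \<le> K \<omega> * d t u powr \<gamma>" by simp
  qed
qed

section \<open>Almost sure convergence\<close>

context regular_ifs_family
begin

text \<open>At level \<open>n\<close> words of length \<open>l n\<close> replace the integral and
  the net \<open>S n\<close> replaces \<Gamma>. Both replacements cost a multiple of 2^(-n), for the
  densities of levels \<open>n\<close> and \<open>Suc n\<close> alike, and the remaining finitely
  many bad events per level have summable probability.\<close>

lemma almost_sure_increments:
  fixes M :: "'b measure" and \<mu> :: "nat \<Rightarrow> 'b \<Rightarrow> 'a \<Rightarrow> real"
  assumes SI: "SI_martingale M B \<mu>" and \<alpha>: "\<alpha> < s" and U: "0 < U" and \<theta>: "0 \<le> \<theta>"
    and meas: "\<And>n \<omega>. \<omega> \<in> space M \<Longrightarrow> \<mu> n \<omega> \<in> borel_measurable borel"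
    and bd\<alpha>: "\<And>n \<omega> x. \<omega> \<in> space M \<Longrightarrow> \<bar>\<mu> n \<omega> x\<bar> \<le> U * 2 powr (\<alpha> * real n)"
    and bd\<theta>: "\<And>n \<omega> x. \<omega> \<in> space M \<Longrightarrow> \<bar>\<mu> n \<omega> x\<bar> \<le> U * 2 powr (\<theta> * real n)"
    and var: "AE \<omega> in M. \<exists>N0. \<forall>n\<ge>N0. set_variation \<F> (\<mu> n \<omega>) (U * 2 powr (\<theta> * real n))"
  obtains \<rho> where "0 < \<rho>"
    "AE \<omega> in M. \<exists>N A. 0 \<le> A \<and> (\<forall>n\<ge>N. \<forall>t\<in>\<Gamma>.
        \<bar>integral\<^sup>L (ss_measure t) (\<mu> (Suc n) \<omega>) - integral\<^sup>L (ss_measure t) (\<mu> n \<omega>)\<bar>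
          \<le> A * (2 powr - \<rho>) ^ n * max 1 (integral\<^sup>L (ss_measure t) (\<mu> n \<omega>)))"
proof -
  interpret prob_space M using SI by (simp add: SI_martingale_def)
  note [measurable] = SI_martingale_measurable[OF SI]
  obtain h Ch where h: "0 < h" "0 < Ch" and hol: "\<And>t u \<epsilon> \<phi> U R. t \<in> \<Gamma> \<Longrightarrow> u \<in> \<Gamma> \<Longrightarrow> 0 < \<epsilon> \<Longrightarrow> ifs_dist t u \<le> \<epsilon> \<Longrightarrow>
       \<phi> \<in> borel_measurable borel \<Longrightarrow> (\<And>x. \<bar>\<phi> x\<bar> \<le> U) \<Longrightarrow> set_variation \<F> \<phi> R \<Longrightarrow>
       \<bar>integral\<^sup>L (ss_measure t) \<phi> - integral\<^sup>L (ss_measure u) \<phi>\<bar> \<le> Ch * (R + U) * \<epsilon> powr h"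
    using holder_continuity by blast
  obtain Cn :: real and k :: nat where Cn: "0 < Cn" and nets: "\<And>e. 0 < e \<Longrightarrow> e < 1 \<Longrightarrow>
      \<exists>N\<subseteq>\<Gamma>. finite N \<and> real (card N) \<le> Cn * (1 / e) ^ k \<and> (\<forall>t\<in>\<Gamma>. \<exists>u\<in>N. ifs_dist t u \<le> e)"
    using polynomial_nets by blast
  obtain m :: real where m: "0 < m" and conc: "\<And>n (V::(nat \<Rightarrow> 'i) set) q p b L k. finite V \<Longrightarrow> (\<And>v. v \<in> V \<Longrightarrow> 0 \<le> q v) \<Longrightarrow>
       (\<And>\<omega> x. \<omega> \<in> space M \<Longrightarrow> \<mu> (Suc n) \<omega> x \<le> L) \<Longrightarrow>
       (\<And>v. v \<in> V \<Longrightarrow> L * (\<Sum>v' | v' \<in> V \<and> p v' \<in> dyadic_cell (Suc n) (p v). q v') \<le> b) \<Longrightarrow>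
       0 < b \<Longrightarrow> 0 < k \<Longrightarrow> k \<le> 2 \<Longrightarrow>
       measure M {\<omega> \<in> space M. m * k * max 1 (\<Sum>v\<in>V. q v * \<mu> n \<omega> (p v))
           < \<bar>(\<Sum>v\<in>V. q v * \<mu> (Suc n) \<omega> (p v)) - (\<Sum>v\<in>V. q v * \<mu> n \<omega> (p v))\<bar>}
        \<le> 2 * m * exp (- k\<^sup>2 / (4 * b))"
    by (rule SI_martingale_concentration[OF SI, where 'v = "nat \<Rightarrow> 'i"]) auto
  \<comment> \<open>The cell bound decays like 2^(-4\<delta>n) and the tolerated deviation
    \<open>kn n\<close> like 2^(-\<delta>n), leaving 2^(2\<delta>n) in the exponent of the
    tail.\<close>
  define \<delta> where "\<delta> = (s - \<alpha>) / 4"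
  have \<delta>: "0 < \<delta>" using \<alpha> by (simp add: \<delta>_def)
  define \<beta> where "\<beta> = U * 2 powr \<alpha> * c * (real DIM('a) + 1) powr s"
  have \<beta>: "0 < \<beta>" unfolding \<beta>_def using U pos by (intro mult_pos_pos) (auto simp: add_pos_nonneg)
  \<comment> \<open>The mesh for which \<open>e n powr h\<close> equals
    \<open>2 powr (- (\<theta> + 1) * real n)\<close>; this cancels the growth 2^(\<theta>n) and
    leaves 2^(-n).\<close>
  define e where "e = (\<lambda>n. 2 powr (- ((\<theta> + 1) / h) * real n))"
  define \<kappa> where "\<kappa> = real k * (\<theta> + 1) / h"
  define kn where "kn = (\<lambda>n. 2 powr (- \<delta> * real n))"
  have kn: "0 < kn n" "kn n \<le> 1" for n
    using \<delta> powr_mono[of "- \<delta> * real n" 0 2] by (auto simp: kn_def)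
  \<comment> \<open>The first entry keeps cylinders at the scale of the cells, as
    \<open>cylinder_sum_dyadic_cell\<close> needs; the second yields the factor 2^(-(\<theta>+1)n)
    again once raised to the power \<open>g\<close>.\<close>
  define l where "l = (\<lambda>n. SOME N. (2 * D + 1) * b ^ N \<le> min (1 / 2 ^ n) (2 powr (- ((\<theta> + 1) / g) * real n)))"
  have l: "(2 * D + 1) * b ^ l n \<le> 1 / 2 ^ n" "(2 * D + 1) * b ^ l n \<le> 2 powr (- ((\<theta> + 1) / g) * real n)" for n
  proof -
    let ?x = "min (1 / 2 ^ n) (2 powr (- ((\<theta> + 1) / g) * real n))"
    have "0 < ?x / (2 * D + 1)" using pos by (auto simp: min_def)
    from real_arch_pow_inv[OF this b(2)] obtain N where "b ^ N < ?x / (2 * D + 1)" by blast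
    then have "(2 * D + 1) * b ^ N \<le> ?x" using pos by (simp add: pos_less_divide_eq mult.commute less_imp_le)
    then have "(2 * D + 1) * b ^ l n \<le> ?x" unfolding l_def by (rule someI)
    then show "(2 * D + 1) * b ^ l n \<le> 1 / 2 ^ n" "(2 * D + 1) * b ^ l n \<le> 2 powr (- ((\<theta> + 1) / g) * real n)" by simp_all
  qed
  have "\<exists>S\<subseteq>\<Gamma>. finite S \<and> real (card S) \<le> Cn * 2 powr (\<kappa> * real n) \<and> (0 < n \<longrightarrow> (\<forall>t\<in>\<Gamma>. \<exists>u\<in>S. ifs_dist t u \<le> e n))" for n
  \<comment> \<open>At \<open>n = 0\<close> the mesh is 1, outside the range of \<open>nets\<close>;
    the empty set is harmless, since only large \<open>n\<close> matter.\<close>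
  proof (cases "n = 0")
    case True
    then show ?thesis using Cn by (intro exI[of _ "{}"]) simp
  next
    case False
    then have "0 < e n" "e n < 1"
      using \<theta> h powr_less_mono[of "- ((\<theta> + 1) / h) * real n" 0 2] by (auto simp: e_def)
    from nets[OF this] obtain S where S: "S \<subseteq> \<Gamma>" "finite S" "real (card S) \<le> Cn * (1 / e n) ^ k" "\<forall>t\<in>\<Gamma>. \<exists>u\<in>S. ifs_dist t u \<le> e n"
      by blast
    have "1 / e n = 2 powr ((\<theta> + 1) / h * real n)" by (simp add: e_def powr_minus divide_inverse)
    then have "(1 / e n) ^ k = 2 powr (\<kappa> * real n)" by (simp add: powr_power \<kappa>_def mult_ac)
    with S show ?thesis by auto
  qed
  then obtain S where S: "\<And>n. S n \<subseteq> \<Gamma>" "\<And>n. finite (S n)" "\<And>n. real (card (S n)) \<le> Cn * 2 powr (\<kappa> * real n)"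
    "\<And>n t. 0 < n \<Longrightarrow> t \<in> \<Gamma> \<Longrightarrow> \<exists>u\<in>S n. ifs_dist t u \<le> e n" by metis
  let ?c = "\<lambda>n t j \<omega>. cylinder_sum t (l n) (\<mu> j \<omega>)"
  define bad where "bad = (\<lambda>n (t :: ('i \<Rightarrow> 'a \<Rightarrow> 'a) \<times> ('i \<Rightarrow> real)). {\<omega> \<in> space M. m * kn n * max 1 (?c n t n \<omega>) < \<bar>?c n t (Suc n) \<omega> - ?c n t n \<omega>\<bar>})"
  have badM[measurable]: "bad n t \<in> sets M" for n t
    unfolding bad_def cylinder_sum_def by measurable
  have prob_bad: "measure M (bad n t) \<le> 2 * m * exp (- (2 powr (2 * \<delta> * real n)) / (4 * \<beta>))" if t: "t \<in> \<Gamma>" for n t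
  proof -
    let ?V = "PiE {..<l n} (\<lambda>_. UNIV :: 'i set)"
    have "measure M (bad n t) \<le> 2 * m * exp (- (kn n)\<^sup>2 / (4 * (\<beta> * 2 powr (- (4 * \<delta>) * real n))))"
      unfolding bad_def cylinder_sum_def
    proof (rule conc[of ?V "word_weight (snd t) (l n)" n "U * 2 powr (\<alpha> * real (Suc n))" "coding_map (fst t)"])
      show "finite ?V" by (rule finite_words)
      show "0 \<le> word_weight (snd t) (l n) v" for v
        using prob[OF t] by (auto simp: word_weight_def prob_vector_def less_imp_le intro!: prod_nonneg)
      show "\<mu> (Suc n) \<omega> x \<le> U * 2 powr (\<alpha> * real (Suc n))" if "\<omega> \<in> space M" for \<omega> x
        using bd\<alpha>[OF that, of "Suc n" x] by linarith
      fix v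
      have "(\<Sum>v' | v' \<in> ?V \<and> coding_map (fst t) v' \<in> dyadic_cell (Suc n) (coding_map (fst t) v). word_weight (snd t) (l n) v')
          \<le> c * ((real DIM('a) + 1) / 2 ^ n) powr s"
        by (rule cylinder_sum_dyadic_cell[OF t l(1)])
      then have "U * 2 powr (\<alpha> * real (Suc n)) * (\<Sum>v' | v' \<in> ?V \<and> coding_map (fst t) v' \<in> dyadic_cell (Suc n) (coding_map (fst t) v). word_weight (snd t) (l n) v')
         \<le> U * 2 powr (\<alpha> * real (Suc n)) * (c * ((real DIM('a) + 1) / 2 ^ n) powr s)"
        using U by (intro mult_left_mono) auto
      also have "((real DIM('a) + 1) / 2 ^ n) powr s = (real DIM('a) + 1) powr s * 2 powr (- s * real n)"
      proof -
        have "(2 ^ n) powr s = 2 powr (s * real n)" by (simp add: powr_realpow[symmetric] powr_powr mult.commute)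
        then show ?thesis by (simp add: powr_divide powr_minus_divide)
      qed
      also have "U * 2 powr (\<alpha> * real (Suc n)) * (c * ((real DIM('a) + 1) powr s * 2 powr (- s * real n)))
         = \<beta> * (2 powr (\<alpha> * real n) * 2 powr (- s * real n))"
        by (simp add: \<beta>_def distrib_left powr_add mult_ac)
      also have "2 powr (\<alpha> * real n) * 2 powr (- s * real n) = 2 powr (- (4 * \<delta>) * real n)"
      proof -
        have "4 * \<delta> = s - \<alpha>" by (simp add: \<delta>_def)
        then show ?thesis by (simp only: powr_add[symmetric]) (simp add: algebra_simps)
      qed
      finally show "U * 2 powr (\<alpha> * real (Suc n)) * (\<Sum>v' | v' \<in> ?V \<and> coding_map (fst t) v' \<in> dyadic_cell (Suc n) (coding_map (fst t) v). word_weight (snd t) (l n) v')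
         \<le> \<beta> * 2 powr (- (4 * \<delta>) * real n)" .
    qed (use kn[of n] \<beta> in auto)
    also have "- (kn n)\<^sup>2 / (4 * (\<beta> * 2 powr (- (4 * \<delta>) * real n))) = - (2 powr (2 * \<delta> * real n)) / (4 * \<beta>)"
    proof -
      have "(kn n)\<^sup>2 = 2 powr (2 * \<delta> * real n) * 2 powr (- (4 * \<delta>) * real n)"
        unfolding kn_def power2_eq_square powr_add[symmetric] by (simp add: algebra_simps)
      then show ?thesis by simp
    qed
    finally show ?thesis .
  qed
  define Bad where "Bad = (\<lambda>n. \<Union>t\<in>S n. bad n t)"
  have BadM: "Bad n \<in> sets M" for n unfolding Bad_def using S(2) by (intro sets.finite_UN) auto
  have "measure M (Bad n) \<le> (Cn * 2 * m) * 2 powr (\<kappa> * real n) * exp (- (2 powr ((2 * \<delta>) * real n)) / (4 * \<beta>))" for n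
  proof -
    have "measure M (Bad n) \<le> (\<Sum>t\<in>S n. measure M (bad n t))"
      unfolding Bad_def by (rule finite_measure_subadditive_finite[OF S(2)]) auto
    also have "\<dots> \<le> of_nat (card (S n)) * (2 * m * exp (- (2 powr (2 * \<delta> * real n)) / (4 * \<beta>)))"
      by (intro sum_bounded_above prob_bad subsetD[OF S(1)])
    also have "\<dots> \<le> Cn * 2 powr (\<kappa> * real n) * (2 * m * exp (- (2 powr (2 * \<delta> * real n)) / (4 * \<beta>)))"
      using S(3)[of n] m by (intro mult_right_mono) auto
    finally show ?thesis by (simp add: mult_ac)
  qed
  then have Bad_le: "norm (measure M (Bad n)) \<le> (Cn * 2 * m) * 2 powr (\<kappa> * real n) * exp (- (2 powr ((2 * \<delta>) * real n)) / (4 * \<beta>))" for n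
    by simp
  have "0 < 2 * \<delta>" "0 < 4 * \<beta>" using \<delta> \<beta> by simp_all
  from summable_comparison_test'[OF summable_powr_times_exp[OF this] Bad_le]
  have "summable (\<lambda>n. measure M (Bad n))" .
  \<comment> \<open>Borel-Cantelli: the net has exponential size in \<open>n\<close>, while failure
    at one member is doubly exponentially unlikely.\<close>
  then have good: "AE \<omega> in M. eventually (\<lambda>n. \<omega> \<in> space M - Bad n) sequentially"
    using BadM by (intro borel_cantelli_AE1) (auto simp: emeasure_eq_measure)
  \<comment> \<open>The smaller of the stochastic rate \<open>\<delta>\<close> and the rate 1 of the
    discretisation errors.\<close>
  define \<rho> where "\<rho> = min \<delta> 1"
  have \<rho>: "0 < \<rho>" using \<delta> by (simp add: \<rho>_def)
  have \<rho>n: "(2 powr - \<rho>) ^ n = 2 powr (- \<rho> * real n)" for n by (simp add: powr_power mult.commute)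
  \<comment> \<open>The errors from moving to the net and from cutting words;
    \<open>2 powr \<theta>\<close> is the price of using level \<open>Suc n\<close> at the mesh
    chosen for \<open>n\<close>.\<close>
  define A1 where "A1 = Ch * (2 * U * 2 powr \<theta>) + U * 2 powr \<theta> * c"
  have A1: "0 \<le> A1" unfolding A1_def using h U pos by simp
  define A where "A = 2 * A1 + m * (1 + A1)"
  have A: "0 \<le> A" using A1 m by (simp add: A_def)
  let ?y = "\<lambda>n \<omega> t. integral\<^sup>L (ss_measure t) (\<mu> n \<omega>)"
  show thesis
  proof (rule that[OF \<rho>])
    show "AE \<omega> in M. \<exists>N A. 0 \<le> A \<and> (\<forall>n\<ge>N. \<forall>t\<in>\<Gamma>.
        \<bar>?y (Suc n) \<omega> t - ?y n \<omega> t\<bar> \<le> A * (2 powr - \<rho>) ^ n * max 1 (?y n \<omega> t))"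
      using good var AE_space
    proof eventually_elim
      case (elim \<omega>)
      note w = elim(3)
      obtain N1 where N1: "\<And>n. n \<ge> N1 \<Longrightarrow> \<omega> \<notin> Bad n" using elim(1) by (auto simp: eventually_sequentially)
      obtain N0 where N0: "\<And>n. n \<ge> N0 \<Longrightarrow> set_variation \<F> (\<mu> n \<omega>) (U * 2 powr (\<theta> * real n))" using elim(2) by blast
      have "\<bar>?y (Suc n) \<omega> t - ?y n \<omega> t\<bar> \<le> A * (2 powr - \<rho>) ^ n * max 1 (?y n \<omega> t)"
        if n: "max 1 (max N0 N1) \<le> n" and t: "t \<in> \<Gamma>" for n t
      proof -
        have n': "0 < n" "N0 \<le> n" "N1 \<le> n" using n by auto
        obtain u where u: "u \<in> S n" "ifs_dist t u \<le> e n" using S(4)[OF n'(1) t] by blast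
        have u\<Gamma>: "u \<in> \<Gamma>" by (rule subsetD[OF S(1) u(1)])
        define p where "p = 2 powr (- real n)"
        have pow: "2 powr (\<theta> * real j) * 2 powr (- (\<theta> + 1) * real n) \<le> 2 powr \<theta> * p" if "j \<le> Suc n" for j
        proof -
          have "\<theta> * real j \<le> \<theta> * real (Suc n)" using that \<theta> by (intro mult_left_mono) auto
          then have "2 powr (\<theta> * real j + (- (\<theta> + 1) * real n)) \<le> 2 powr (\<theta> + (- real n))"
            by (intro powr_mono) (auto simp: algebra_simps)
          then show ?thesis by (simp only: powr_add p_def)
        qed
        have near: "\<bar>?c n u j \<omega> - ?y j \<omega> t\<bar> \<le> A1 * p" if j: "n \<le> j" "j \<le> Suc n" for j
        proof -
          have v: "set_variation \<F> (\<mu> j \<omega>) (U * 2 powr (\<theta> * real j))" using N0[of j] n'(2) j(1) by simp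
          have "0 < e n" by (simp add: e_def)
          from hol[OF t u\<Gamma> this u(2) meas[OF w] bd\<theta>[OF w] v]
          have "\<bar>?y j \<omega> t - ?y j \<omega> u\<bar> \<le> Ch * (2 * U * 2 powr (\<theta> * real j)) * e n powr h" by simp
          also have "e n powr h = 2 powr (- (\<theta> + 1) * real n)" using h unfolding e_def powr_powr by (intro arg_cong[where f = "(powr) 2"]) (simp add: field_simps)
          also have "Ch * (2 * U * 2 powr (\<theta> * real j)) * 2 powr (- (\<theta> + 1) * real n)
              = Ch * (2 * U) * (2 powr (\<theta> * real j) * 2 powr (- (\<theta> + 1) * real n))" by (simp only: mult_ac)
          also have "\<dots> \<le> Ch * (2 * U) * (2 powr \<theta> * p)" using h U by (intro mult_left_mono pow[OF j(2)]) auto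
          finally have 1: "\<bar>?y j \<omega> t - ?y j \<omega> u\<bar> \<le> Ch * (2 * U) * (2 powr \<theta> * p)" .
          have "\<bar>?c n u j \<omega> - ?y j \<omega> u\<bar> \<le> U * 2 powr (\<theta> * real j) * c * ((2 * D + 1) * b ^ l n) powr g"
            by (rule cylinder_sum_approx[OF u\<Gamma> meas[OF w] bd\<theta>[OF w] v])
          also have "\<dots> \<le> U * 2 powr (\<theta> * real j) * c * (2 powr (- ((\<theta> + 1) / g) * real n)) powr g"
            using U pos b l(2)[of n] by (intro mult_left_mono powr_mono2) auto
          also have "(2 powr (- ((\<theta> + 1) / g) * real n)) powr g = 2 powr (- (\<theta> + 1) * real n)"
            using pos unfolding powr_powr by (intro arg_cong[where f = "(powr) 2"]) (simp add: field_simps)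
          also have "U * 2 powr (\<theta> * real j) * c * 2 powr (- (\<theta> + 1) * real n)
              = U * c * (2 powr (\<theta> * real j) * 2 powr (- (\<theta> + 1) * real n))" by (simp only: mult_ac)
          also have "\<dots> \<le> U * c * (2 powr \<theta> * p)" using pos U by (intro mult_left_mono pow[OF j(2)]) auto
          finally have 2: "\<bar>?c n u j \<omega> - ?y j \<omega> u\<bar> \<le> U * c * (2 powr \<theta> * p)" .
          have "A1 * p = Ch * (2 * U) * (2 powr \<theta> * p) + U * c * (2 powr \<theta> * p)"
            by (simp add: A1_def algebra_simps)
          with 1 2 show ?thesis by linarith
        qed
        have near0: "\<bar>?c n u n \<omega> - ?y n \<omega> t\<bar> \<le> A1 * p" and near1: "\<bar>?c n u (Suc n) \<omega> - ?y (Suc n) \<omega> t\<bar> \<le> A1 * p"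
          using near[of n] near[of "Suc n"] by auto
        let ?m = "max 1 (?y n \<omega> t)"
        have p: "0 \<le> p" "p \<le> 1" by (auto simp: p_def powr_minus field_simps ge_one_powr_ge_zero)
        have "\<omega> \<notin> bad n u" using N1[OF n'(3)] u(1) by (auto simp: Bad_def)
        then have "\<bar>?c n u (Suc n) \<omega> - ?c n u n \<omega>\<bar> \<le> m * kn n * max 1 (?c n u n \<omega>)"
          using w by (simp add: bad_def not_less)
        \<comment> \<open>The relative bound at the net point becomes one at \<open>t\<close>, since
          the two values differ by at most \<open>A1\<close> and the maximum is at least 1.\<close>
        also have "\<dots> \<le> m * kn n * ((1 + A1) * ?m)"
        proof (rule mult_left_mono)
          have "A1 * p \<le> A1 * ?m" using A1 p by (intro mult_left_mono) auto
          then have "?c n u n \<omega> \<le> ?m + A1 * ?m" using near0 by linarith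
          moreover have "0 \<le> A1 * ?m" using A1 by simp
          ultimately show "max 1 (?c n u n \<omega>) \<le> (1 + A1) * ?m" by (simp add: distrib_right)
        qed (use m kn[of n] in auto)
        finally have "\<bar>?y (Suc n) \<omega> t - ?y n \<omega> t\<bar> \<le> m * kn n * ((1 + A1) * ?m) + 2 * (A1 * p)"
          using near0 near1 by linarith
        also have "\<dots> \<le> m * 2 powr (- \<rho> * real n) * ((1 + A1) * ?m) + 2 * (A1 * (2 powr (- \<rho> * real n) * ?m))"
        proof (intro add_mono mult_right_mono mult_left_mono)
          have "\<rho> * real n \<le> \<delta> * real n" "\<rho> * real n \<le> 1 * real n" by (intro mult_right_mono; simp add: \<rho>_def)+
          then show "kn n \<le> 2 powr (- \<rho> * real n)" unfolding kn_def by (intro powr_mono) auto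
          have "p \<le> 2 powr (- \<rho> * real n) * 1"
            using \<open>\<rho> * real n \<le> 1 * real n\<close> unfolding p_def by simp
          also have "\<dots> \<le> 2 powr (- \<rho> * real n) * ?m" by (intro mult_left_mono) auto
          finally show "p \<le> 2 powr (- \<rho> * real n) * ?m" .
        qed (use m A1 in auto)
        also have "\<dots> = A * 2 powr (- \<rho> * real n) * ?m" by (simp add: A_def algebra_simps)
        finally show ?thesis by (simp only: \<rho>n)
      qed
      then show ?case using A by blast
    qed
  qed
qed

end

theorem theorem9p1:
  fixes M :: "'b measure" and B :: "nat \<Rightarrow> 'b measure"
    and \<mu> :: "nat \<Rightarrow> 'b \<Rightarrow> 'a::euclidean_space \<Rightarrow> real"
    and \<F> :: "'a set set" and \<alpha> \<tau> \<zeta> :: real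
    and \<Gamma> :: "(('i::finite \<Rightarrow> 'a \<Rightarrow> 'a) \<times> ('i \<Rightarrow> real)) set"
  assumes SI: "SI_martingale M B \<mu>"
    and F_ball: "\<exists>c R. \<forall>\<Lambda>\<in>\<F>. \<Lambda> \<in> sets borel \<and> \<Lambda> \<subseteq> ball c R"
    and type: "(cell_type M \<F> \<tau> \<zeta> \<mu> \<and> (\<exists>C. \<forall>n. \<forall>\<omega>\<in>space M. \<forall>x. \<mu> n \<omega> x \<le> C * 2 powr (\<alpha> * real n)))
               \<or> cutout_type M \<F> \<alpha> \<zeta> \<mu>"
    and Gamma_sim: "\<forall>t\<in>\<Gamma>. (\<forall>i. contracting_similarity (fst t i)) \<and> prob_vector (snd t)"
    and Gamma_bdd: "\<exists>R. \<forall>t\<in>\<Gamma>. \<forall>u\<in>\<Gamma>. ifs_dist t u \<le> R"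
    and Gamma_ratios: "\<exists>a b. 0 < a \<and> b < 1 \<and> (\<forall>t\<in>\<Gamma>. \<forall>i. \<exists>r. a \<le> r \<and> r \<le> b \<and>
                          (\<forall>x y. dist (fst t i x) (fst t i y) = r * dist x y))"
    and dims: "\<exists>s>\<alpha>. (\<exists>c. \<forall>x. \<forall>t\<in>\<Gamma>. \<forall>r. 0 < r \<and> r < 1 \<longrightarrow>
                          measure (ss_measure t) (ball x r) \<le> c * r powr s) \<and>
                 (\<exists>\<gamma>1. 0 < \<gamma>1 \<and> \<gamma>1 < s \<and> (\<exists>c. \<forall>\<epsilon>. 0 < \<epsilon> \<and> \<epsilon> < 1 \<longrightarrow>
                     (\<forall>t\<in>\<Gamma>. \<forall>\<Lambda>\<in>\<F>. \<exists>X. finite X \<and> real (card X) \<le> c * \<epsilon> powr (- \<gamma>1) \<and>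
                        nbhd (frontier \<Lambda>) \<epsilon> \<inter> attractor (fst t) \<subseteq> (\<Union>x\<in>X. ball x \<epsilon>))))"
  shows "\<exists>\<gamma>>0. \<exists>K :: 'b \<Rightarrow> real. K \<in> borel_measurable M \<and>
           (AE \<omega> in M. \<exists>Y :: ('i \<Rightarrow> 'a \<Rightarrow> 'a) \<times> ('i \<Rightarrow> real) \<Rightarrow> real.
              uniform_limit \<Gamma> (\<lambda>n t. integral\<^sup>L (ss_measure t) (\<mu> n \<omega>)) Y sequentially \<and>
              (\<forall>t\<in>\<Gamma>. \<forall>u\<in>\<Gamma>. \<bar>Y t - Y u\<bar> \<le> K \<omega> * ifs_dist t u powr \<gamma>))"
\<comment> \<open>An empty family has no member from which a common \<open>D\<close> or the sign of
  \<open>b\<close> could be read off.\<close>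
proof (cases "\<Gamma> = {}")
  case True
  then show ?thesis
    by (intro exI[of _ 1] exI[of _ "\<lambda>_. 0"] conjI AE_I2 exI[of _ "\<lambda>_. 0"]) (auto intro: uniform_limitI)
next
  case False
  interpret prob_space M using SI by (simp add: SI_martingale_def)
  note [measurable] = SI_martingale_measurable[OF SI]
  have \<mu>0: "0 \<le> \<mu> n \<omega> x" if "\<omega> \<in> space M" for n \<omega> x using SI that by (simp add: SI_martingale_def)
  obtain a b where ab: "0 < a" "b < 1" and ratios: "\<And>t i. t \<in> \<Gamma> \<Longrightarrow> \<exists>r. a \<le> r \<and> r \<le> b \<and> (\<forall>x y. dist (fst t i x) (fst t i y) = r * dist x y)"
    using Gamma_ratios by blast
  have b: "0 < b" 
  proof -
    obtain t where "t \<in> \<Gamma>" using False by blast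
    from ratios[OF this, of undefined] ab(1) show ?thesis by auto
  qed
  obtain s c1 \<gamma>1 c2 where s: "\<alpha> < s" and \<gamma>1: "0 < \<gamma>1" "\<gamma>1 < s"
    and ball: "\<And>x t r. t \<in> \<Gamma> \<Longrightarrow> 0 < r \<Longrightarrow> r < 1 \<Longrightarrow> measure (ss_measure t) (ball x r) \<le> c1 * r powr s"
    and cover: "\<And>\<epsilon> t \<Lambda>. 0 < \<epsilon> \<Longrightarrow> \<epsilon> < 1 \<Longrightarrow> t \<in> \<Gamma> \<Longrightarrow> \<Lambda> \<in> \<F> \<Longrightarrow>
       \<exists>X. finite X \<and> real (card X) \<le> c2 * \<epsilon> powr (- \<gamma>1) \<and> nbhd (frontier \<Lambda>) \<epsilon> \<inter> attractor (fst t) \<subseteq> (\<Union>x\<in>X. ball x \<epsilon>)"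
  proof -
    obtain s c1 \<gamma>1 c2 where "\<alpha> < s" "0 < \<gamma>1" "\<gamma>1 < s"
      "\<forall>x. \<forall>t\<in>\<Gamma>. \<forall>r. 0 < r \<and> r < 1 \<longrightarrow> measure (ss_measure t) (ball x r) \<le> c1 * r powr s"
      "\<forall>\<epsilon>. 0 < \<epsilon> \<and> \<epsilon> < 1 \<longrightarrow> (\<forall>t\<in>\<Gamma>. \<forall>\<Lambda>\<in>\<F>. \<exists>X. finite X \<and> real (card X) \<le> c2 * \<epsilon> powr (- \<gamma>1) \<and>
          nbhd (frontier \<Lambda>) \<epsilon> \<inter> attractor (fst t) \<subseteq> (\<Union>x\<in>X. ball x \<epsilon>))"
      using dims by (elim exE conjE)
    then show thesis by (intro that[of s \<gamma>1 c1 c2]) simp_all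
  qed
  obtain R where R: "\<And>t u. t \<in> \<Gamma> \<Longrightarrow> u \<in> \<Gamma> \<Longrightarrow> ifs_dist t u \<le> R" using Gamma_bdd by blast
  obtain D c where "regular_ifs_family \<Gamma> b D \<F> c s (s - \<gamma>1)"
  proof (rule regular_ifs_familyI[OF False _ R b ab(2) _ \<gamma>1 ball cover])
    show "prob_vector (snd t)" if "t \<in> \<Gamma>" for t using Gamma_sim that by blast
    show "\<exists>r. 0 \<le> r \<and> r \<le> b \<and> (\<forall>x y. dist (fst t i x) (fst t i y) = r * dist x y)" if t: "t \<in> \<Gamma>" for t i
      
    proof -
      obtain r where "a \<le> r" "r \<le> b" "\<forall>x y. dist (fst t i x) (fst t i y) = r * dist x y"
        using ratios[OF t, of i] by blast
      with ab(1) show ?thesis by (intro exI[of _ r]) auto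
    qed
  qed auto
  then interpret regular_ifs_family \<Gamma> b D \<F> c s "s - \<gamma>1" .
  have FB: "\<Lambda> \<in> sets borel" if "\<Lambda> \<in> \<F>" for \<Lambda> using F_ball that by blast
  obtain U \<theta> where U: "0 < U" and \<theta>: "0 \<le> \<theta>"
    and meas: "\<And>n \<omega>. \<omega> \<in> space M \<Longrightarrow> \<mu> n \<omega> \<in> borel_measurable borel"
    and bd\<alpha>: "\<And>n \<omega> x. \<omega> \<in> space M \<Longrightarrow> \<bar>\<mu> n \<omega> x\<bar> \<le> U * 2 powr (\<alpha> * real n)"
    and bd\<theta>: "\<And>n \<omega> x. \<omega> \<in> space M \<Longrightarrow> \<bar>\<mu> n \<omega> x\<bar> \<le> U * 2 powr (\<theta> * real n)"
    and var0: "\<And>n \<omega>. \<omega> \<in> space M \<Longrightarrow> \<exists>R. set_variation \<F> (\<mu> n \<omega>) R"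
    and var: "AE \<omega> in M. \<exists>N0. \<forall>n\<ge>N0. set_variation \<F> (\<mu> n \<omega>) (U * 2 powr (\<theta> * real n))"
    by (rule regular_density[OF \<mu>0 not_empty FB type]) auto
  obtain \<rho> where \<rho>: "0 < \<rho>" and incr: "AE \<omega> in M. \<exists>N A. 0 \<le> A \<and> (\<forall>n\<ge>N. \<forall>t\<in>\<Gamma>.
        \<bar>integral\<^sup>L (ss_measure t) (\<mu> (Suc n) \<omega>) - integral\<^sup>L (ss_measure t) (\<mu> n \<omega>)\<bar>
          \<le> A * (2 powr - \<rho>) ^ n * max 1 (integral\<^sup>L (ss_measure t) (\<mu> n \<omega>)))"
    by (rule almost_sure_increments[OF SI s U \<theta> meas bd\<alpha> bd\<theta> var]) auto
  obtain h Ch where h: "0 < h" "0 < Ch" and hol: "\<And>t u \<epsilon> \<phi> U R. t \<in> \<Gamma> \<Longrightarrow> u \<in> \<Gamma> \<Longrightarrow> 0 < \<epsilon> \<Longrightarrow> ifs_dist t u \<le> \<epsilon> \<Longrightarrow>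
       \<phi> \<in> borel_measurable borel \<Longrightarrow> (\<And>x. \<bar>\<phi> x\<bar> \<le> U) \<Longrightarrow> set_variation \<F> \<phi> R \<Longrightarrow>
       \<bar>integral\<^sup>L (ss_measure t) \<phi> - integral\<^sup>L (ss_measure u) \<phi>\<bar> \<le> Ch * (R + U) * \<epsilon> powr h"
    using holder_continuity by blast
  let ?y = "\<lambda>\<omega> n t. integral\<^sup>L (ss_measure t) (\<mu> n \<omega>)"
  \<comment> \<open>\<open>lim\<close> is total, so \<open>Y\<close> is defined for every
    \<open>\<omega>\<close>, which makes sense of its measurability.\<close>
  define Y where "Y = (\<lambda>\<omega> (t :: ('i \<Rightarrow> 'a \<Rightarrow> 'a) \<times> ('i \<Rightarrow> real)). lim (\<lambda>n. ?y \<omega> n t))"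
  obtain \<gamma> where \<gamma>: "0 < \<gamma>" and hl: "\<And>(y :: nat \<Rightarrow> ('i \<Rightarrow> 'a \<Rightarrow> 'a) \<times> ('i \<Rightarrow> real) \<Rightarrow> real) Y T d H G N. 0 \<le> H \<Longrightarrow> 0 \<le> G \<Longrightarrow>
      (\<And>n t. N \<le> n \<Longrightarrow> t \<in> T \<Longrightarrow> \<bar>Y t - y n t\<bar> \<le> H * (2 powr - \<rho>) ^ n) \<Longrightarrow>
      (\<And>n t. t \<in> T \<Longrightarrow> \<bar>y n t\<bar> \<le> G * 2 powr (\<theta> * real n)) \<Longrightarrow>
      (\<And>n t u e. N \<le> n \<Longrightarrow> t \<in> T \<Longrightarrow> u \<in> T \<Longrightarrow> 0 < e \<Longrightarrow> d t u \<le> e \<Longrightarrow> \<bar>y n t - y n u\<bar> \<le> G * 2 powr (\<theta> * real n) * e powr h) \<Longrightarrow>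
      (\<And>t u. t \<in> T \<Longrightarrow> u \<in> T \<Longrightarrow> 0 \<le> d t u) \<Longrightarrow>
      \<exists>K. \<forall>t\<in>T. \<forall>u\<in>T. \<bar>Y t - Y u\<bar> \<le> K * d t u powr \<gamma>"
    by (rule holder_limit[OF \<rho> \<theta> h(1), where 't = "('i \<Rightarrow> 'a \<Rightarrow> 'a) \<times> ('i \<Rightarrow> real)"]) auto
  have limit: "AE \<omega> in M. uniform_limit \<Gamma> (?y \<omega>) (Y \<omega>) sequentially \<and> (\<exists>K. \<forall>t\<in>\<Gamma>. \<forall>u\<in>\<Gamma>. \<bar>Y \<omega> t - Y \<omega> u\<bar> \<le> K * ifs_dist t u powr \<gamma>)"
    using incr var AE_space
  proof eventually_elim
    case (elim \<omega>)
    note w = elim(3)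
    obtain N1 A where A: "0 \<le> A" and inc: "\<And>n t. N1 \<le> n \<Longrightarrow> t \<in> \<Gamma> \<Longrightarrow>
        \<bar>?y \<omega> (Suc n) t - ?y \<omega> n t\<bar> \<le> A * (2 powr - \<rho>) ^ n * max 1 (?y \<omega> n t)"
      using elim(1) by blast
    obtain N0 where N0: "\<And>n. n \<ge> N0 \<Longrightarrow> set_variation \<F> (\<mu> n \<omega>) (U * 2 powr (\<theta> * real n))" using elim(2) by blast
    define N where "N = max N0 N1"
    have yb: "\<bar>?y \<omega> n t\<bar> \<le> U * 2 powr (\<theta> * real n)" if "t \<in> \<Gamma>" for n t
      by (rule abs_integral_le[OF that meas[OF w] bd\<theta>[OF w]])
    have q: "0 < 2 powr - \<rho>" "2 powr - \<rho> < 1" using \<rho> powr_less_mono[of "-\<rho>" 0 2] by auto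
    have inc': "\<bar>?y \<omega> (Suc n) t - ?y \<omega> n t\<bar> \<le> A * (2 powr - \<rho>) ^ n * max 1 (?y \<omega> n t)" if "N \<le> n" "t \<in> \<Gamma>" for n t
      using inc that by (simp add: N_def)
    have UN: "?y \<omega> N t \<le> U * 2 powr (\<theta> * real N)" if "t \<in> \<Gamma>" for t using yb[OF that, of N] by linarith
    obtain H where H: "0 \<le> H" "uniform_limit \<Gamma> (?y \<omega>) (Y \<omega>) sequentially"
      "\<And>n t. N \<le> n \<Longrightarrow> t \<in> \<Gamma> \<Longrightarrow> \<bar>Y \<omega> t - ?y \<omega> n t\<bar> \<le> H * (2 powr - \<rho>) ^ n"
      unfolding Y_def by (rule uniform_limit_geometric_increments[OF q A inc' UN]) auto
    define G where "G = U + 2 * Ch * U"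
    have G: "0 \<le> G" "U \<le> G" "2 * Ch * U \<le> G" using U h by (auto simp: G_def)
    have "\<exists>K. \<forall>t\<in>\<Gamma>. \<forall>u\<in>\<Gamma>. \<bar>Y \<omega> t - Y \<omega> u\<bar> \<le> K * ifs_dist t u powr \<gamma>"
    proof (rule hl[OF H(1) G(1) H(3)])
      show "\<bar>?y \<omega> n t\<bar> \<le> G * 2 powr (\<theta> * real n)" if "t \<in> \<Gamma>" for n t
      proof -
        have "U * 2 powr (\<theta> * real n) \<le> G * 2 powr (\<theta> * real n)" using G by (intro mult_right_mono) auto
        with yb[OF that, of n] show ?thesis by linarith
      qed
      show "\<bar>?y \<omega> n t - ?y \<omega> n u\<bar> \<le> G * 2 powr (\<theta> * real n) * e powr h"
        if "N \<le> n" "t \<in> \<Gamma>" "u \<in> \<Gamma>" "0 < e" "ifs_dist t u \<le> e" for n t u e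
      proof -
        have "set_variation \<F> (\<mu> n \<omega>) (U * 2 powr (\<theta> * real n))" using N0 that(1) by (simp add: N_def)
        from hol[OF that(2,3,4,5) meas[OF w] bd\<theta>[OF w] this]
        have "\<bar>?y \<omega> n t - ?y \<omega> n u\<bar> \<le> (2 * Ch * U) * (2 powr (\<theta> * real n) * e powr h)" by (simp add: mult_ac)
        also have "\<dots> \<le> G * (2 powr (\<theta> * real n) * e powr h)" using G by (intro mult_right_mono) auto
        finally show ?thesis by (simp add: mult.assoc)
      qed
      show "0 \<le> ifs_dist t u" if "t \<in> \<Gamma>" "u \<in> \<Gamma>" for t u using ifs_dist_bounds(3)[OF that] .
    qed
    with H(2) show ?case by blast
  qed
  \<comment> \<open>The integral is a limit of finite sums of point evaluations of
    \<open>\<mu> n\<close>, each measurable. Some variation bound \<open>R\<close> depending on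
    \<open>\<omega>\<close> is enough for this, so the limit holds on the whole space.\<close>
  have ymeas: "(\<lambda>\<omega>. ?y \<omega> n t) \<in> borel_measurable M" if t: "t \<in> \<Gamma>" for n t
  proof (rule borel_measurable_LIMSEQ_metric[where f = "\<lambda>N \<omega>. cylinder_sum t N (\<mu> n \<omega>)"])
    show "(\<lambda>\<omega>. cylinder_sum t N (\<mu> n \<omega>)) \<in> borel_measurable M" for N
      unfolding cylinder_sum_def by measurable
    fix \<omega> assume w: "\<omega> \<in> space M"
    obtain R where R: "set_variation \<F> (\<mu> n \<omega>) R" using var0[OF w] by blast
    have "(\<lambda>N. (2 * D + 1) * b ^ N) \<longlonglongrightarrow> 0"
      using b ab(2) by (intro tendsto_mult_right_zero LIMSEQ_power_zero) auto
    then have "(\<lambda>N. ((2 * D + 1) * b ^ N) powr (s - \<gamma>1)) \<longlonglongrightarrow> 0 powr (s - \<gamma>1)"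
      using \<gamma>1 pos b by (intro tendsto_powr2) (auto intro!: always_eventually)
    then have z: "(\<lambda>N. R * c * ((2 * D + 1) * b ^ N) powr (s - \<gamma>1)) \<longlonglongrightarrow> 0"
      by (intro tendsto_mult_right_zero) simp
    show "(\<lambda>N. cylinder_sum t N (\<mu> n \<omega>)) \<longlonglongrightarrow> ?y \<omega> n t"
      using cylinder_sum_approx[OF t meas[OF w] bd\<theta>[OF w] R]
      by (intro LIM_zero_cancel[OF Lim_null_comparison[OF _ z]]) auto
  qed
  obtain Cn :: real and k :: nat where "0 < Cn" and nets: "\<And>e. 0 < e \<Longrightarrow> e < 1 \<Longrightarrow>
      \<exists>N\<subseteq>\<Gamma>. finite N \<and> real (card N) \<le> Cn * (1 / e) ^ k \<and> (\<forall>t\<in>\<Gamma>. \<exists>u\<in>N. ifs_dist t u \<le> e)"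
    using polynomial_nets by blast
  \<comment> \<open>The shift by 2 keeps the mesh below 1, as \<open>nets\<close> demands.\<close>
  have "\<exists>N\<subseteq>\<Gamma>. finite N \<and> (\<forall>t\<in>\<Gamma>. \<exists>u\<in>N. ifs_dist t u \<le> 1 / (real j + 2))" for j :: nat
  proof -
    have "0 < 1 / (real j + 2)" "1 / (real j + 2) < 1" by auto
    from nets[OF this] show ?thesis by blast
  qed
  then obtain S where S: "\<And>j. S j \<subseteq> \<Gamma>" "\<And>j. finite (S j)" "\<And>j t. t \<in> \<Gamma> \<Longrightarrow> \<exists>u\<in>S j. ifs_dist t u \<le> 1 / (real j + 2)"
    by metis
  have dense: "\<exists>u\<in>\<Union>(range S). ifs_dist t u \<le> e" if t: "t \<in> \<Gamma>" and e: "0 < e" for t e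
  proof -
    obtain j where j: "inverse (real (Suc j)) < e" using reals_Archimedean[OF e] by blast
    obtain u where u: "u \<in> S j" "ifs_dist t u \<le> 1 / (real j + 2)" using S(3)[OF t] by blast
    have "1 / (real j + 2) \<le> inverse (real (Suc j))" by (simp add: field_simps)
    then show ?thesis using u j by (intro bexI[of _ u]) auto
  qed
  obtain K where K: "K \<in> borel_measurable M"
    "\<And>\<omega> K0 t u. (\<And>t u. t \<in> \<Gamma> \<Longrightarrow> u \<in> \<Gamma> \<Longrightarrow> \<bar>Y \<omega> t - Y \<omega> u\<bar> \<le> K0 * ifs_dist t u powr \<gamma>) \<Longrightarrow> t \<in> \<Gamma> \<Longrightarrow> u \<in> \<Gamma> \<Longrightarrow>
       \<bar>Y \<omega> t - Y \<omega> u\<bar> \<le> K \<omega> * ifs_dist t u powr \<gamma>"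
  proof (rule measurable_holder_constant[of "\<Union>(range S)" \<Gamma> ifs_dist \<gamma> Y M])
    show "countable (\<Union>(range S))" using S(2) by (intro countable_UN) (auto intro: countable_finite)
    show "\<Union>(range S) \<subseteq> \<Gamma>" using S(1) by blast
    show "(\<lambda>\<omega>. Y \<omega> t) \<in> borel_measurable M" if "t \<in> \<Union>(range S)" for t
    proof -
      have "t \<in> \<Gamma>" using S(1) that by blast
      then show ?thesis unfolding Y_def by (intro borel_measurable_lim_metric ymeas)
    qed
  qed (use dense ifs_dist_bounds(3) ifs_dist_commute ifs_dist_triangle \<gamma> in auto)
  show ?thesis
  proof (intro exI[of _ \<gamma>] exI[of _ K] conjI \<gamma> K(1))
    show "AE \<omega> in M. \<exists>Y. uniform_limit \<Gamma> (\<lambda>n t. ?y \<omega> n t) Y sequentially \<and>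
              (\<forall>t\<in>\<Gamma>. \<forall>u\<in>\<Gamma>. \<bar>Y t - Y u\<bar> \<le> K \<omega> * ifs_dist t u powr \<gamma>)"
      using limit
    proof eventually_elim
      case (elim \<omega>)
      then obtain K0 where "\<And>t u. t \<in> \<Gamma> \<Longrightarrow> u \<in> \<Gamma> \<Longrightarrow> \<bar>Y \<omega> t - Y \<omega> u\<bar> \<le> K0 * ifs_dist t u powr \<gamma>" by blast
      from K(2)[OF this] elim show ?case by (intro exI[of _ "Y \<omega>"]) auto
    qed
  qed
qed

end
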